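(* On Riemannian manifolds $(M,g)$ of dimension $n=6$, the GJMS-operator $P_6$ is given by $$P_6=\Delta^3+4\Delta\,\delta\,T_2\,d+4\,\delta\,T_2\,d\,\Delta+2\Delta(\mathsf J\Delta)+8\,\delta\,T_4\,d$$ with $$T_2=\mathsf J-2\mathsf P\quad\text{and}\quad T_4=-\mathsf J^2+|\mathsf P|^2+4\mathsf J\,\mathsf P-6\,\mathsf P^2-\mathcal B.$$
   Context: $\delta$ is the formal adjoint of $d$ with respect to $g$ and $\Delta=-\delta d$ (so $-\Delta\ge0$). $\mathsf J=\frac{\mathrm{scal}}{2(n-1)}$; $\mathsf P$ is the Schouten tensor, $(n-2)\mathsf P=\mathrm{Ric}-\mathsf Jg$; $|\mathsf P|^2=\mathsf P_{ij}\mathsf P^{ij}$. The Bach tensor is $\mathcal B_{ij}=\Delta(\mathsf P)_{ij}-\nabla^k\nabla_j(\mathsf P)_{ik}+\mathsf P^{kl}W_{kijl}$, where $W$ is the Weyl tensor in the sign convention for which the curvature tensor satisfies $\mathrm{Ric}_{jk}=R^{i}{}_{jki}$ (opposite to Fefferman–Graham). Symmetric 2-tensors ($\mathsf P$, $\mathsf P^2$, $\mathcal B$, $T_2$, $T_4$) are regarded, using $g$, as endomorphisms of one-forms; scalar functions act as multiples of the identity. $\Delta(\mathsf J\Delta)$ denotes $u\mapsto\Delta(\mathsf J\,\Delta u)$, and $\delta Td$ denotes $u\mapsto\delta(T\,du)$. GJMS-operator $P_{2N}$ in dimension $n$ ($2N\le n$ for even $n$): let $g_+=r^{-2}(dr^2+g_r)$,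 $g_0=g$, $g_r$ even in $r$, be a Poincaré–Einstein metric, i.e. $\mathrm{Ric}(g_+)+ng_+=0$ asymptotically at $r=0$ (for even $n$: $O(r^{n-2})$ with vanishing $g$-trace of the coefficient of $r^{n-2}$), and let $\tilde g=2t\,dt\,d\rho+2\rho\,dt^2+t^2g(\rho)$ with $g(\rho)=g_r$ for $\rho=-r^2/2$ be the ambient metric. Then $P_{2N}u=\Delta_{\tilde g}^N(t^{N-n/2}\tilde u)|_{\rho=0,t=1}$ for any smooth extension $\tilde u(x,\rho)$ of $u\in C^\infty(M)$. *)

theory Defs
  imports "HOL-Analysis.Analysis" "HOL-Library.Landau_Symbols"
begin

section \<open>Smooth functions on open subsets of Euclidean space\<close>

definition pd :: "'m \<Rightarrow> (real^'m \<Rightarrow> real) \<Rightarrow> real^'m \<Rightarrow> real" where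
  "pd i f x = frechet_derivative f (at x) (axis i 1)"

primrec Ck_on :: "nat \<Rightarrow> (real^'m) set \<Rightarrow> (real^'m \<Rightarrow> real) \<Rightarrow> bool" where
  "Ck_on 0 U f \<longleftrightarrow> continuous_on U f"
| "Ck_on (Suc k) U f \<longleftrightarrow> (\<forall>x\<in>U. f differentiable (at x)) \<and> (\<forall>i. Ck_on k U (pd i f))"

definition smooth_on :: "(real^'m) set \<Rightarrow> (real^'m \<Rightarrow> real) \<Rightarrow> bool" where
  "smooth_on U f \<longleftrightarrow> (\<forall>k. Ck_on k U f)"


section \<open>Pseudo-Riemannian geometry in local coordinates\<close>

text \<open>A metric or a covariant 2-tensor is a matrix-valued function of the coordinates; a one-form is
  a vector-valued one. All notions below only depend on the germ of the metric at the point, or on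
  its restriction to the open set \<open>U\<close>.\<close>

definition grad_form :: "(real^'m \<Rightarrow> real) \<Rightarrow> real^'m \<Rightarrow> real^'m" where
  "grad_form f x = (\<chi> i. pd i f x)"

definition test_function :: "(real^'m) set \<Rightarrow> (real^'m \<Rightarrow> real) \<Rightarrow> bool" where
  "test_function U f \<longleftrightarrow> smooth_on UNIV f \<and> (\<exists>K. compact K \<and> K \<subseteq> U \<and> (\<forall>x. x \<notin> K \<longrightarrow> f x = 0))"

text \<open>\<open>v = \<delta>\<omega>\<close> on \<open>U\<close>: the pairing of \<open>f\<close> with \<open>v\<close> equals the pairing of \<open>df\<close> with \<open>\<omega>\<close>, with respect
  to the volume density of \<open>g\<close>. As \<open>\<delta>\<close> is local, testing with functions supported in the coordinate
  domain \<open>U\<close> determines \<open>\<delta>\<omega>\<close> there. The absolute value accommodates the Lorentzian ambient metric.\<close>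

definition is_codifferential ::
  "(real^'m) set \<Rightarrow> (real^'m \<Rightarrow> real^'m^'m) \<Rightarrow> (real^'m \<Rightarrow> real^'m) \<Rightarrow> (real^'m \<Rightarrow> real) \<Rightarrow> bool" where
  "is_codifferential U g \<omega> v \<longleftrightarrow> smooth_on U v \<and>
     (\<forall>f. test_function U f \<longrightarrow>
        (LINT x:U|lborel. f x * v x * sqrt \<bar>det (g x)\<bar>)
        = (LINT x:U|lborel. (grad_form f x \<bullet> (matrix_inv (g x) *v \<omega> x)) * sqrt \<bar>det (g x)\<bar>))"

text \<open>For smooth data the choice is unique on \<open>U\<close>; values outside \<open>U\<close> are irrelevant.\<close>

definition codifferential ::
  "(real^'m) set \<Rightarrow> (real^'m \<Rightarrow> real^'m^'m) \<Rightarrow> (real^'m \<Rightarrow> real^'m) \<Rightarrow> real^'m \<Rightarrow> real" where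
  "codifferential U g \<omega> = (SOME v. is_codifferential U g \<omega> v)"

definition laplacian ::
  "(real^'m) set \<Rightarrow> (real^'m \<Rightarrow> real^'m^'m) \<Rightarrow> (real^'m \<Rightarrow> real) \<Rightarrow> real^'m \<Rightarrow> real" where
  "laplacian U g f x = - codifferential U g (grad_form f) x"

text \<open>\<open>f \<mapsto> \<delta>(T df)\<close>, where \<open>(T \<omega>)\<^sub>i = \<Sum>\<^sub>j T x $ i $ j * \<omega>\<^sub>j\<close> is an endomorphism of one-forms.\<close>

definition delta_T_d ::
  "(real^'m) set \<Rightarrow> (real^'m \<Rightarrow> real^'m^'m) \<Rightarrow> (real^'m \<Rightarrow> real^'m^'m) \<Rightarrow> (real^'m \<Rightarrow> real) \<Rightarrow> real^'m \<Rightarrow> real"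
  where "delta_T_d U g T f = codifferential U g (\<lambda>x. T x *v grad_form f x)"

definition christoffel :: "(real^'m \<Rightarrow> real^'m^'m) \<Rightarrow> 'm \<Rightarrow> 'm \<Rightarrow> 'm \<Rightarrow> real^'m \<Rightarrow> real" where
  "christoffel g k i j x = (\<Sum>l\<in>UNIV. matrix_inv (g x) $ k $ l *
     (pd i (\<lambda>y. g y $ j $ l) x + pd j (\<lambda>y. g y $ i $ l) x - pd l (\<lambda>y. g y $ i $ j) x)) / 2"

text \<open>\<open>riemann_up g i j k l\<close> is the component \<open>R\<^sup>i\<^sub>j\<^sub>k\<^sub>l\<close> in the sign convention in which
  \<open>Ric\<^sub>j\<^sub>k = R\<^sup>i\<^sub>j\<^sub>k\<^sub>i\<close>, with \<open>Ric\<close> positive on round spheres.\<close>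

definition riemann_up :: "(real^'m \<Rightarrow> real^'m^'m) \<Rightarrow> 'm \<Rightarrow> 'm \<Rightarrow> 'm \<Rightarrow> 'm \<Rightarrow> real^'m \<Rightarrow> real" where
  "riemann_up g i j k l x = pd l (christoffel g i k j) x - pd k (christoffel g i l j) x
     + (\<Sum>m\<in>UNIV. christoffel g i l m x * christoffel g m k j x
                  - christoffel g i k m x * christoffel g m l j x)"

definition riemann :: "(real^'m \<Rightarrow> real^'m^'m) \<Rightarrow> 'm \<Rightarrow> 'm \<Rightarrow> 'm \<Rightarrow> 'm \<Rightarrow> real^'m \<Rightarrow> real" where
  "riemann g i j k l x = (\<Sum>m\<in>UNIV. g x $ i $ m * riemann_up g m j k l x)"

definition ricci :: "(real^'m \<Rightarrow> real^'m^'m) \<Rightarrow> real^'m \<Rightarrow> real^'m^'m" where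
  "ricci g x = (\<chi> j k. \<Sum>i\<in>UNIV. riemann_up g i j k i x)"

definition scal :: "(real^'m \<Rightarrow> real^'m^'m) \<Rightarrow> real^'m \<Rightarrow> real" where
  "scal g x = (\<Sum>i\<in>UNIV. \<Sum>j\<in>UNIV. matrix_inv (g x) $ i $ j * ricci g x $ i $ j)"

definition schouten_J :: "(real^'m \<Rightarrow> real^'m^'m) \<Rightarrow> real^'m \<Rightarrow> real" where
  "schouten_J g x = scal g x / (2 * (real CARD('m) - 1))"

definition schouten :: "(real^'m \<Rightarrow> real^'m^'m) \<Rightarrow> real^'m \<Rightarrow> real^'m^'m" where
  "schouten g x = (1 / (real CARD('m) - 2)) *\<^sub>R (ricci g x - schouten_J g x *\<^sub>R g x)"

definition schouten_norm2 :: "(real^'m \<Rightarrow> real^'m^'m) \<Rightarrow> real^'m \<Rightarrow> real" where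
  "schouten_norm2 g x = (\<Sum>i\<in>UNIV. \<Sum>j\<in>UNIV. \<Sum>k\<in>UNIV. \<Sum>l\<in>UNIV.
     matrix_inv (g x) $ i $ k * matrix_inv (g x) $ j $ l * schouten g x $ i $ j * schouten g x $ k $ l)"

text \<open>The trace-free part of the curvature tensor; the signs of the Schouten terms go with the sign
  of \<open>riemann\<close>.\<close>

definition weyl :: "(real^'m \<Rightarrow> real^'m^'m) \<Rightarrow> 'm \<Rightarrow> 'm \<Rightarrow> 'm \<Rightarrow> 'm \<Rightarrow> real^'m \<Rightarrow> real" where
  "weyl g i j k l x = riemann g i j k l x
     + schouten g x $ i $ k * g x $ j $ l - schouten g x $ i $ l * g x $ j $ k
     - schouten g x $ j $ k * g x $ i $ l + schouten g x $ j $ l * g x $ i $ k"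

text \<open>\<open>cov1 g S k i j\<close> is \<open>(\<nabla>\<^sub>k S)\<^sub>i\<^sub>j\<close> and \<open>cov2 g S l k i j\<close> is \<open>(\<nabla>\<^sub>l \<nabla>\<^sub>k S)\<^sub>i\<^sub>j\<close>, the component of the
  second covariant derivative with the derivative in direction \<open>k\<close> taken first.\<close>

definition cov1 ::
  "(real^'m \<Rightarrow> real^'m^'m) \<Rightarrow> (real^'m \<Rightarrow> real^'m^'m) \<Rightarrow> 'm \<Rightarrow> 'm \<Rightarrow> 'm \<Rightarrow> real^'m \<Rightarrow> real" where
  "cov1 g S k i j x = pd k (\<lambda>y. S y $ i $ j) x
     - (\<Sum>m\<in>UNIV. christoffel g m k i x * S x $ m $ j + christoffel g m k j x * S x $ i $ m)"

definition cov2 ::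
  "(real^'m \<Rightarrow> real^'m^'m) \<Rightarrow> (real^'m \<Rightarrow> real^'m^'m) \<Rightarrow> 'm \<Rightarrow> 'm \<Rightarrow> 'm \<Rightarrow> 'm \<Rightarrow> real^'m \<Rightarrow> real" where
  "cov2 g S l k i j x = pd l (cov1 g S k i j) x
     - (\<Sum>m\<in>UNIV. christoffel g m l k x * cov1 g S m i j x
                  + christoffel g m l i x * cov1 g S k m j x
                  + christoffel g m l j x * cov1 g S k i m x)"

definition bach :: "(real^'m \<Rightarrow> real^'m^'m) \<Rightarrow> real^'m \<Rightarrow> real^'m^'m" where
  "bach g x = (\<chi> i j.
     (\<Sum>k\<in>UNIV. \<Sum>l\<in>UNIV. matrix_inv (g x) $ k $ l *
        (cov2 g (schouten g) l k i j x - cov2 g (schouten g) l j i k x))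
     + (\<Sum>k\<in>UNIV. \<Sum>l\<in>UNIV. \<Sum>p\<in>UNIV. \<Sum>q\<in>UNIV.
          matrix_inv (g x) $ k $ p * matrix_inv (g x) $ l $ q * schouten g x $ p $ q * weyl g k i j l x))"

text \<open>A covariant 2-tensor as an endomorphism of one-forms: \<open>S\<^sub>i\<^sup>j = S\<^sub>i\<^sub>k g\<^sup>k\<^sup>j\<close>.\<close>

definition endo :: "(real^'m \<Rightarrow> real^'m^'m) \<Rightarrow> (real^'m \<Rightarrow> real^'m^'m) \<Rightarrow> real^'m \<Rightarrow> real^'m^'m" where
  "endo g S x = S x ** matrix_inv (g x)"

definition T2 :: "(real^'m \<Rightarrow> real^'m^'m) \<Rightarrow> real^'m \<Rightarrow> real^'m^'m" where
  "T2 g x = mat (schouten_J g x) - 2 *\<^sub>R endo g (schouten g) x"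

definition T4 :: "(real^'m \<Rightarrow> real^'m^'m) \<Rightarrow> real^'m \<Rightarrow> real^'m^'m" where
  "T4 g x = mat (- (schouten_J g x)\<^sup>2 + schouten_norm2 g x)
     + (4 * schouten_J g x) *\<^sub>R endo g (schouten g) x
     - 6 *\<^sub>R (endo g (schouten g) x ** endo g (schouten g) x)
     - endo g (bach g) x"


section \<open>Manifolds, functions and metrics\<close>

text \<open>A chart is a pair of its domain and its coordinate map.\<close>

type_synonym ('a, 'n) chart = "'a set \<times> ('a \<Rightarrow> real^'n)"

definition chart_image :: "('a, 'n::finite) chart \<Rightarrow> (real^'n) set" where
  "chart_image c = snd c ` fst c"

definition chart_inv :: "('a, 'n::finite) chart \<Rightarrow> real^'n \<Rightarrow> 'a" where
  "chart_inv c = inv_into (fst c) (snd c)"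

definition is_chart :: "'a topology \<Rightarrow> ('a, 'n::finite) chart \<Rightarrow> bool" where
  "is_chart M c \<longleftrightarrow> openin M (fst c) \<and> open (chart_image c) \<and>
     homeomorphic_map (subtopology M (fst c)) (top_of_set (chart_image c)) (snd c)"

definition smooth_manifold :: "'a topology \<Rightarrow> ('a, 'n::finite) chart set \<Rightarrow> bool" where
  "smooth_manifold M A \<longleftrightarrow> Hausdorff_space M \<and> second_countable M \<and>
     (\<forall>c\<in>A. is_chart M c) \<and> (\<Union>c\<in>A. fst c) = topspace M \<and>
     (\<forall>c\<in>A. \<forall>c'\<in>A. \<forall>i. smooth_on (snd c ` (fst c \<inter> fst c')) (\<lambda>x. snd c' (chart_inv c x) $ i))"

text \<open>Tensor fields on the manifold are given by their components in each chart.\<close>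

definition transform2 :: "('a, 'n::finite) chart \<Rightarrow> ('a, 'n::finite) chart \<Rightarrow> 'a \<Rightarrow> real^'n^'n \<Rightarrow> real^'n^'n \<Rightarrow> bool" where
  "transform2 c c' p S S' \<longleftrightarrow>
     (let D = jacobian (\<lambda>x. snd c' (chart_inv c x)) (at (snd c p)) in S = transpose D ** S' ** D)"

definition pos_def :: "real^'n^'n \<Rightarrow> bool" where
  "pos_def S \<longleftrightarrow> transpose S = S \<and> (\<forall>v. v \<noteq> 0 \<longrightarrow> v \<bullet> (S *v v) > 0)"

definition smooth_function :: "('a, 'n::finite) chart set \<Rightarrow> ('a \<Rightarrow> real) \<Rightarrow> bool" where
  "smooth_function A u \<longleftrightarrow> (\<forall>c\<in>A. smooth_on (chart_image c) (\<lambda>x. u (chart_inv c x)))"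

definition riemannian_metric ::
  "('a, 'n::finite) chart set \<Rightarrow> (('a, 'n::finite) chart \<Rightarrow> real^'n \<Rightarrow> real^'n^'n) \<Rightarrow> bool" where
  "riemannian_metric A g \<longleftrightarrow>
     (\<forall>c\<in>A. (\<forall>i j. smooth_on (chart_image c) (\<lambda>x. g c x $ i $ j)) \<and> (\<forall>x\<in>chart_image c. pos_def (g c x))) \<and>
     (\<forall>c\<in>A. \<forall>c'\<in>A. \<forall>p\<in>fst c \<inter> fst c'. transform2 c c' p (g c (snd c p)) (g c' (snd c' p)))"

text \<open>Coordinates \<open>(s, x)\<close> near \<open>s = 0\<close> on the product of a line and the manifold: the coordinate
  with index \<open>None\<close> is \<open>s\<close>, the one with index \<open>Some i\<close> is \<open>x\<^sub>i\<close>.\<close>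

definition base :: "real^('n option) \<Rightarrow> real^'n" where
  "base y = (\<chi> i. y $ Some i)"

definition adjoin :: "real \<Rightarrow> real^'n \<Rightarrow> real^('n option)" where
  "adjoin s x = (\<chi> a. case a of None \<Rightarrow> s | Some i \<Rightarrow> x $ i)"

definition collar :: "'a topology \<Rightarrow> ('a \<times> real) set \<Rightarrow> bool" where
  "collar M D \<longleftrightarrow> openin (prod_topology M euclideanreal) D \<and> topspace M \<times> {0} \<subseteq> D"

definition collar_image :: "('a, 'n::finite) chart \<Rightarrow> ('a \<times> real) set \<Rightarrow> (real^('n option)) set" where
  "collar_image c D = {y. base y \<in> chart_image c \<and> (chart_inv c (base y), y $ None) \<in> D}"

text \<open>Smooth one-parameter families of Riemannian metrics and of functions, defined for small
  parameters (how small may depend on the point). The family is one on all of \<open>M\<close>, with components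
  \<open>h c x s\<close> in the chart \<open>c\<close>.\<close>

definition metric_family ::
  "('a, 'n::finite) chart set \<Rightarrow> ('a \<times> real) set \<Rightarrow> (('a, 'n::finite) chart \<Rightarrow> real^'n \<Rightarrow> real \<Rightarrow> real^'n^'n) \<Rightarrow> bool" where
  "metric_family A D h \<longleftrightarrow>
     (\<forall>c\<in>A. (\<forall>i j. smooth_on (collar_image c D) (\<lambda>y. h c (base y) (y $ None) $ i $ j)) \<and>
            (\<forall>y\<in>collar_image c D. pos_def (h c (base y) (y $ None)))) \<and>
     (\<forall>c\<in>A. \<forall>c'\<in>A. \<forall>p\<in>fst c \<inter> fst c'. \<forall>s. (p, s) \<in> D \<longrightarrow>
        transform2 c c' p (h c (snd c p) s) (h c' (snd c' p) s))"

definition smooth_extension ::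
  "('a, 'n::finite) chart set \<Rightarrow> ('a \<times> real) set \<Rightarrow> ('a \<Rightarrow> real) \<Rightarrow> ('a \<Rightarrow> real \<Rightarrow> real) \<Rightarrow> bool" where
  "smooth_extension A D u ut \<longleftrightarrow>
     (\<forall>c\<in>A. smooth_on (collar_image c D) (\<lambda>y. ut (chart_inv c (base y)) (y $ None)) \<and>
            (\<forall>p\<in>fst c. ut p 0 = u p))"


section \<open>Poincare-Einstein and ambient metrics, GJMS-operators\<close>

text \<open>\<open>g\<^sub>+ = r\<^sup>-\<^sup>2 (dr\<^sup>2 + h\<^sub>r)\<close> in the coordinates \<open>(r, x)\<close>, with \<open>r\<close> at index \<open>None\<close>.\<close>

definition gplus :: "(real^'n \<Rightarrow> real \<Rightarrow> real^'n^'n) \<Rightarrow> real^('n option) \<Rightarrow> real^('n option)^('n option)" where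
  "gplus h y = (1 / (y $ None)\<^sup>2) *\<^sub>R
     (\<chi> a b. case (a, b) of (None, None) \<Rightarrow> 1
        | (Some i, Some j) \<Rightarrow> h (base y) (y $ None) $ i $ j
        | _ \<Rightarrow> 0)"

definition einstein_defect ::
  "(real^'n \<Rightarrow> real \<Rightarrow> real^'n^'n) \<Rightarrow> real^'n \<Rightarrow> real \<Rightarrow> real^('n option)^('n option)" where
  "einstein_defect h x r = ricci (gplus h) (adjoin r x) + real CARD('n) *\<^sub>R gplus h (adjoin r x)"

text \<open>For even \<open>n\<close> the defect is \<open>O(r\<^sup>n\<^sup>-\<^sup>2)\<close>, and the tangential part \<open>C\<close> of the coefficient of
  \<open>r\<^sup>n\<^sup>-\<^sup>2\<close> has vanishing trace; for odd \<open>n\<close> the defect vanishes to infinite order. The defect times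
  \<open>r\<^sup>2\<close> is smooth up to \<open>r = 0\<close>, so that the pointwise orders of vanishing suffice.\<close>

definition asymptotically_einstein ::
  "(real^'n \<Rightarrow> real^'n^'n) \<Rightarrow> (real^'n \<Rightarrow> real \<Rightarrow> real^'n^'n) \<Rightarrow> real^'n \<Rightarrow> bool" where
  "asymptotically_einstein g h x \<longleftrightarrow>
     (if even CARD('n) then
        (\<forall>a b. (\<lambda>r. einstein_defect h x r $ a $ b) \<in> O[at_right 0](\<lambda>r. r ^ (CARD('n) - 2))) \<and>
        (\<exists>C :: real^'n^'n.
           (\<forall>i j. ((\<lambda>r. einstein_defect h x r $ Some i $ Some j / r ^ (CARD('n) - 2)) \<longlongrightarrow> C $ i $ j) (at_right 0)) \<and>
           (\<Sum>i\<in>UNIV. \<Sum>j\<in>UNIV. matrix_inv (g x) $ i $ j * C $ i $ j) = 0)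
      else (\<forall>k a b. (\<lambda>r. einstein_defect h x r $ a $ b) \<in> O[at_right 0](\<lambda>r. r ^ k)))"

definition poincare_einstein ::
  "'a topology \<Rightarrow> ('a, 'n::finite) chart set \<Rightarrow> (('a, 'n::finite) chart \<Rightarrow> real^'n \<Rightarrow> real^'n^'n) \<Rightarrow>
   ('a \<times> real) set \<Rightarrow> (('a, 'n::finite) chart \<Rightarrow> real^'n \<Rightarrow> real \<Rightarrow> real^'n^'n) \<Rightarrow> bool" where
  "poincare_einstein M A g D gr \<longleftrightarrow> collar M D \<and> metric_family A D gr \<and>
     (\<forall>c\<in>A. \<forall>x\<in>chart_image c. gr c x 0 = g c x \<and> asymptotically_einstein (g c) (gr c) x \<and>
        (\<forall>r. (chart_inv c x, r) \<in> D \<and> (chart_inv c x, - r) \<in> D \<longrightarrow> gr c x (- r) = gr c x r))"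

text \<open>The family \<open>g(\<rho>)\<close> on a two-sided neighbourhood of \<open>\<rho> = 0\<close>; for \<open>\<rho> > 0\<close> it is an arbitrary
  smooth continuation.\<close>

definition ambient_family ::
  "'a topology \<Rightarrow> ('a, 'n::finite) chart set \<Rightarrow>
   ('a \<times> real) set \<Rightarrow> (('a, 'n::finite) chart \<Rightarrow> real^'n \<Rightarrow> real \<Rightarrow> real^'n^'n) \<Rightarrow>
   ('a \<times> real) set \<Rightarrow> (('a, 'n::finite) chart \<Rightarrow> real^'n \<Rightarrow> real \<Rightarrow> real^'n^'n) \<Rightarrow> bool" where
  "ambient_family M A D gr D' grho \<longleftrightarrow> collar M D' \<and> metric_family A D' grho \<and>
     (\<forall>c\<in>A. \<forall>x\<in>chart_image c. \<forall>r. (chart_inv c x, r) \<in> D \<and> (chart_inv c x, - r\<^sup>2 / 2) \<in> D' \<longrightarrow>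
        grho c x (- r\<^sup>2 / 2) = gr c x r)"

text \<open>\<open>2 t dt d\<rho> + 2 \<rho> dt\<^sup>2 + t\<^sup>2 g(\<rho>)\<close> in the coordinates \<open>(t, \<rho>, x)\<close>, at the indices \<open>None\<close>,
  \<open>Some None\<close> and \<open>Some (Some i)\<close>.\<close>

definition ambient_metric ::
  "(real^'n \<Rightarrow> real \<Rightarrow> real^'n^'n) \<Rightarrow> real^('n option option) \<Rightarrow> real^('n option option)^('n option option)" where
  "ambient_metric h y = (let t = y $ None; \<rho> = y $ Some None; x = base (base y) in
     (\<chi> a b. case (a, b) of
          (None, None) \<Rightarrow> 2 * \<rho>
        | (None, Some None) \<Rightarrow> t
        | (Some None, None) \<Rightarrow> t
        | (Some (Some i), Some (Some j)) \<Rightarrow> t\<^sup>2 * h x \<rho> $ i $ j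
        | _ \<Rightarrow> 0))"

definition ambient_domain :: "('a, 'n::finite) chart \<Rightarrow> ('a \<times> real) set \<Rightarrow> (real^('n option option)) set" where
  "ambient_domain c D = {y. y $ None > 0 \<and> base y \<in> collar_image c D}"

text \<open>\<open>P\<^sub>2\<^sub>N u\<close> in the chart \<open>c\<close>, computed from the family \<open>g(\<rho>)\<close> and the extension \<open>ut\<close> of \<open>u\<close>.\<close>

definition gjms ::
  "nat \<Rightarrow> ('a \<times> real) set \<Rightarrow> (('a, 'n::finite) chart \<Rightarrow> real^'n \<Rightarrow> real \<Rightarrow> real^'n^'n) \<Rightarrow> ('a \<Rightarrow> real \<Rightarrow> real) \<Rightarrow>
   ('a, 'n::finite) chart \<Rightarrow> real^'n \<Rightarrow> real" where
  "gjms N D grho ut c x =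
     (laplacian (ambient_domain c D) (ambient_metric (grho c)) ^^ N)
       (\<lambda>y. (y $ None) powr (real N - real CARD('n) / 2)
             * ut (chart_inv c (base (base y))) (y $ Some None))
       (adjoin 1 (adjoin 0 x))"

end

theory Submission
  imports Defs
begin

text \<open>Write the ambient metric as \<open>2t dt d\<rho> + 2\<rho> dt\<^sup>2 + t\<^sup>2 g(\<rho>)\<close>, denote the derivative in \<open>\<rho>\<close> by a prime, and put
  \<open>\<theta> = tr g\<^sup>-\<^sup>1 g'\<close>, the logarithmic derivative of \<open>det g(\<rho>)\<close>. On functions homogeneous in \<open>t\<close>, the ambient Laplacian is
  \<open>t\<^sup>a f \<mapsto> t\<^sup>a\<^sup>-\<^sup>2 (- 2\<rho> f'' + (2a + n - 2 - \<rho>\<theta>) f' + \<Delta>\<^sub>\<rho> f + a/2 \<theta> f)\<close> with the Laplacian \<open>\<Delta>\<^sub>\<rho>\<close> of \<open>g(\<rho>)\<close>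
  (lemma \<open>laplacian_ambient\<close>). For \<open>n = 6\<close> the operator is the product of the three factors with \<open>a = 0, -2, -4\<close> at
  \<open>\<rho> = 0\<close>. In this product all \<open>\<rho>\<close>-derivatives of the function cancel, and there remain (lemma
  \<open>homogeneous_laplacian_triple\<close>) the \<open>\<rho>\<close>-derivatives \<open>\<Delta>'\<close> and \<open>\<Delta>''\<close> of the Laplacian as an operator, and
  \<open>\<theta>\<close> and \<open>\<theta>'\<close>:
  \<open>\<Delta>\<^sup>3 - 4\<Delta>\<Delta>' - 4\<Delta>'\<Delta> + 8\<Delta>'' + 8\<theta>\<Delta>' + 4\<theta>'\<Delta> - \<Delta>\<theta>\<Delta> - 2\<theta>\<Delta>\<^sup>2 + 2\<theta>\<^sup>2\<Delta>\<close>.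

  With the volume density \<open>\<sigma>\<close> one has \<open>\<Delta> = \<sigma>\<^sup>-\<^sup>1 \<partial>\<^sub>i (\<sigma> g\<^sup>i\<^sup>j \<partial>\<^sub>j)\<close>. Hence \<open>\<Delta>' + \<theta>/2 \<Delta>\<close> is in divergence form with the matrix
  \<open>(\<sigma> g\<^sup>-\<^sup>1)'/\<sigma>\<close>, and the four terms \<open>8\<Delta>'' + 8\<theta>\<Delta>' + 4\<theta>'\<Delta> + 2\<theta>\<^sup>2\<Delta>\<close> are 8 times the operator with \<open>(\<sigma> g\<^sup>-\<^sup>1)''/\<sigma>\<close>
  (lemma \<open>homogeneous_laplacian_triple_divergence_form\<close>). So only \<open>g'\<close>, \<open>g''\<close>, \<open>\<theta>\<close> and \<open>\<theta>'\<close> at \<open>\<rho> = 0\<close> have to be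
  known.

  The Einstein equation for \<open>r\<^sup>-\<^sup>2 (dr\<^sup>2 + g(\<rho>))\<close>, \<open>\<rho> = - r\<^sup>2/2\<close>, provides them: its tangential part gives
  \<open>g' = 2P\<close> and \<open>\<theta> = 2J\<close>, its normal part \<open>\<theta>' = - 2\<bar>P\<bar>\<^sup>2\<close>, and its mixed part the contracted Bianchi identity
  \<open>\<nabla>\<^sup>l P\<^sub>k\<^sub>l = \<nabla>\<^sub>k J\<close>. The derivative of the tangential part contains the variation of the Ricci tensor in the
  direction \<open>2P\<close>, which is minus the Bach tensor up to terms quadratic in \<open>P\<close> (lemma \<open>linearized_ricci_schouten\<close>);
  this yields \<open>g'' = 2P\<^sup>2 - B\<close> (lemma \<open>second_coefficient\<close>). Inserting these values produces \<open>T\<^sub>2\<close> and \<open>T\<^sub>4\<close>.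

  The codifferential is characterized weakly, by integration against test functions. The first sections show
  that it is the usual expression in coordinates (lemma \<open>codifferential_eq_divg\<close>), and the rest of the proof
  works with that expression.\<close>

section \<open>Calculus of partial derivatives\<close>

lemma pd_unique:
  assumes "(f has_derivative f') (at x)"
  shows "pd i f x = f' (axis i 1)"
  using frechet_derivative_at[OF assms] by (simp add: pd_def)

lemma pd_cong:
  assumes "open U" "x \<in> U" "\<And>y. y \<in> U \<Longrightarrow> f y = g y"
  shows "pd i f x = pd i g x"
proof -
  have "(f has_derivative D) (at x) \<longleftrightarrow> (g has_derivative D) (at x)" for D
    using assms by (metis has_derivative_transform_within_open)
  thus ?thesis by (simp add: pd_def frechet_derivative_def)
qed

lemma differentiable_cong_open:
  assumes "open U" "x \<in> U" "\<And>y. y \<in> U \<Longrightarrow> f y = g y"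
  shows "f differentiable (at x) \<longleftrightarrow> g differentiable (at x)"
proof -
  have "(f has_derivative D) (at x) \<longleftrightarrow> (g has_derivative D) (at x)" for D
    using assms by (metis has_derivative_transform_within_open)
  thus ?thesis by (simp add: differentiable_def)
qed

lemma pd_const [simp]: "pd i (\<lambda>x. c) x = 0"
  by (simp add: pd_def)

lemma pd_coord: "pd i (\<lambda>x. x $ j) x = (if i = j then 1 else 0)"
proof -
  have "((\<lambda>x. x $ j) has_derivative (\<lambda>h. h $ j)) (at x)"
    by (rule bounded_linear_imp_has_derivative) (rule bounded_linear_vec_nth)
  from pd_unique[OF this, of i] show ?thesis by (simp add: axis_def)
qed

context
  fixes f g :: "real^'m \<Rightarrow> real" and x :: "real^'m"
  assumes f: "f differentiable (at x)" and g: "g differentiable (at x)"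
begin

lemma pd_add: "pd i (\<lambda>x. f x + g x) x = pd i f x + pd i g x"
  using pd_unique[OF has_derivative_add[OF f[unfolded frechet_derivative_works] g[unfolded frechet_derivative_works]]]
  by (simp add: pd_def)

lemma pd_diff: "pd i (\<lambda>x. f x - g x) x = pd i f x - pd i g x"
  using pd_unique[OF has_derivative_diff[OF f[unfolded frechet_derivative_works] g[unfolded frechet_derivative_works]]]
  by (simp add: pd_def)

lemma pd_mult: "pd i (\<lambda>x. f x * g x) x = f x * pd i g x + pd i f x * g x"
  using pd_unique[OF has_derivative_mult[OF f[unfolded frechet_derivative_works] g[unfolded frechet_derivative_works]]]
  by (simp add: pd_def)

end

lemma pd_cmult:
  assumes "f differentiable (at x)"
  shows "pd i (\<lambda>x. c * f x) x = c * pd i f x"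
  using pd_mult[of "\<lambda>x. c" x f i] assms by simp

lemma pd_minus:
  assumes "f differentiable (at x)"
  shows "pd i (\<lambda>x. - f x) x = - pd i f x"
  using pd_cmult[OF assms, of i "-1"] by simp

lemma pd_sum:
  assumes "finite I" "\<And>a. a \<in> I \<Longrightarrow> f a differentiable (at x)"
  shows "pd i (\<lambda>x. \<Sum>a\<in>I. f a x) x = (\<Sum>a\<in>I. pd i (f a) x)"
proof -
  have "((\<lambda>x. \<Sum>a\<in>I. f a x) has_derivative (\<lambda>h. \<Sum>a\<in>I. frechet_derivative (f a) (at x) h)) (at x)"
    using assms frechet_derivative_works by (intro has_derivative_sum) blast
  from pd_unique[OF this] show ?thesis by (simp add: pd_def)
qed

lemma frechet_derivative_expand:
  fixes f :: "real^'m \<Rightarrow> real"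
  assumes "f differentiable (at x)"
  shows "frechet_derivative f (at x) h = (\<Sum>i\<in>UNIV. h $ i * pd i f x)"
proof -
  have lin: "linear (frechet_derivative f (at x))"
    using assms by (rule linear_frechet_derivative)
  have "h = (\<Sum>i\<in>UNIV. h $ i *\<^sub>R axis i 1)"
    by (simp add: basis_expansion flip: scalar_mult_eq_scaleR)
  then have "frechet_derivative f (at x) h = frechet_derivative f (at x) (\<Sum>i\<in>UNIV. h $ i *\<^sub>R axis i 1)"
    by simp
  also have "\<dots> = (\<Sum>i\<in>UNIV. h $ i * pd i f x)"
    by (simp add: linear_sum[OF lin] linear_cmul[OF lin] pd_def)
  finally show ?thesis .
qed

lemma differentiable_vec:
  fixes \<phi> :: "real^'m \<Rightarrow> real^'k"
  assumes "\<And>j. (\<lambda>x. \<phi> x $ j) differentiable (at x)"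
  shows "(\<phi> has_derivative (\<lambda>h. \<chi> j. frechet_derivative (\<lambda>x. \<phi> x $ j) (at x) h)) (at x)"
  unfolding has_derivative_componentwise_within[of \<phi>]
proof
  fix b :: "real^'k" assume "b \<in> Basis"
  then obtain j where b: "b = axis j 1" by (auto simp: Basis_vec_def)
  have "((\<lambda>x. \<phi> x $ j) has_derivative frechet_derivative (\<lambda>x. \<phi> x $ j) (at x)) (at x)"
    using assms frechet_derivative_works by blast
  then show "((\<lambda>x. \<phi> x \<bullet> b) has_derivative (\<lambda>h. (\<chi> j. frechet_derivative (\<lambda>x. \<phi> x $ j) (at x) h) \<bullet> b)) (at x)"
    by (simp add: b inner_axis)
qed

lemma pd_compose:
  fixes \<phi> :: "real^'m \<Rightarrow> real^'k" and F :: "real^'k \<Rightarrow> real"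
  assumes \<phi>: "\<And>j. (\<lambda>x. \<phi> x $ j) differentiable (at x)" and F: "F differentiable (at (\<phi> x))"
  shows "(\<lambda>x. F (\<phi> x)) differentiable (at x)"
    and "pd i (\<lambda>x. F (\<phi> x)) x = (\<Sum>j\<in>UNIV. pd j F (\<phi> x) * pd i (\<lambda>x. \<phi> x $ j) x)"
proof -
  have *: "((\<lambda>x. F (\<phi> x)) has_derivative
     (\<lambda>h. frechet_derivative F (at (\<phi> x)) (\<chi> j. frechet_derivative (\<lambda>x. \<phi> x $ j) (at x) h))) (at x)"
    using has_derivative_compose[OF differentiable_vec[OF \<phi>] F[unfolded frechet_derivative_works]] .
  then show "(\<lambda>x. F (\<phi> x)) differentiable (at x)" using differentiable_def by blast
  show "pd i (\<lambda>x. F (\<phi> x)) x = (\<Sum>j\<in>UNIV. pd j F (\<phi> x) * pd i (\<lambda>x. \<phi> x $ j) x)"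
    using pd_unique[OF *, of i] by (simp add: frechet_derivative_expand[OF F] mult.commute flip: pd_def)
qed

lemma pd_compose_real:
  fixes f :: "real^'m \<Rightarrow> real"
  assumes f: "f differentiable (at x)" and \<phi>: "(\<phi> has_real_derivative d) (at (f x))"
  shows "(\<lambda>x. \<phi> (f x)) differentiable (at x)" and "pd i (\<lambda>x. \<phi> (f x)) x = d * pd i f x"
proof -
  have *: "((\<lambda>x. \<phi> (f x)) has_derivative (\<lambda>h. d * frechet_derivative f (at x) h)) (at x)"
    using has_derivative_compose[OF f[unfolded frechet_derivative_works]
        \<phi>[unfolded has_field_derivative_def]] .
  then show "(\<lambda>x. \<phi> (f x)) differentiable (at x)" using differentiable_def by blast
  show "pd i (\<lambda>x. \<phi> (f x)) x = d * pd i f x" using pd_unique[OF *, of i] by (simp add: pd_def)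
qed

lemma pd_along_line:
  fixes f :: "real^'m \<Rightarrow> real"
  assumes "f differentiable (at (x + s *\<^sub>R axis i 1))"
  shows "((\<lambda>s. f (x + s *\<^sub>R axis i 1)) has_real_derivative pd i f (x + s *\<^sub>R axis i 1)) (at s)"
proof -
  have l: "((\<lambda>s. x + s *\<^sub>R axis i 1) has_derivative (\<lambda>h. h *\<^sub>R axis i 1)) (at s)"
    by (auto intro!: derivative_eq_intros)
  have "((\<lambda>s. f (x + s *\<^sub>R axis i 1)) has_derivative
      (\<lambda>h. frechet_derivative f (at (x + s *\<^sub>R axis i 1)) (h *\<^sub>R axis i 1))) (at s)"
    using has_derivative_compose[OF l assms[unfolded frechet_derivative_works]] .
  moreover have "frechet_derivative f (at (x + s *\<^sub>R axis i 1)) (h *\<^sub>R axis i 1) = h * pd i f (x + s *\<^sub>R axis i 1)" for h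
    by (simp add: linear_cmul[OF linear_frechet_derivative[OF assms]] pd_def)
  ultimately show ?thesis
    by (simp add: has_field_derivative_def mult_commute_abs)
qed


section \<open>Smooth functions\<close>

lemma Ck_on_imp_continuous_on: "Ck_on k U f \<Longrightarrow> continuous_on U f"
proof (cases k)
  case (Suc l)
  assume "Ck_on k U f"
  then show ?thesis
    using Suc by (intro continuous_at_imp_continuous_on ballI differentiable_imp_continuous_within) simp
qed simp

lemma Ck_on_Suc_imp: "Ck_on (Suc k) U f \<Longrightarrow> Ck_on k U f"
proof (induction k arbitrary: f)
  case 0
  then show ?case using Ck_on_imp_continuous_on[of "Suc 0"] by simp
next
  case (Suc k)
  then show ?case by (metis Ck_on.simps(2))
qed

lemma Ck_on_cong:
  assumes "open U" "\<And>y. y \<in> U \<Longrightarrow> f y = g y"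
  shows "Ck_on k U f \<longleftrightarrow> Ck_on k U g"
  using assms(2)
proof (induction k arbitrary: f g)
  case 0
  then show ?case by (auto cong: continuous_on_cong)
next
  case (Suc k)
  have "Ck_on k U (pd i f) \<longleftrightarrow> Ck_on k U (pd i g)" for i
    by (rule Suc.IH) (rule pd_cong[OF assms(1) _ Suc.prems])
  moreover have "f differentiable (at x) \<longleftrightarrow> g differentiable (at x)" if "x \<in> U" for x
    using assms(1) Suc.prems that by (intro differentiable_cong_open[of U]) auto
  ultimately show ?case by auto
qed

lemma smooth_on_cong:
  assumes "open U" "\<And>y. y \<in> U \<Longrightarrow> f y = g y"
  shows "smooth_on U f \<longleftrightarrow> smooth_on U g"
  using Ck_on_cong[OF assms] by (simp add: smooth_on_def)

lemma smooth_on_pd: "smooth_on U f \<Longrightarrow> smooth_on U (pd i f)"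
  unfolding smooth_on_def by (metis Ck_on.simps(2))

lemma smooth_on_pd_fun: "smooth_on U (\<lambda>x. f x) \<Longrightarrow> smooth_on U (\<lambda>x. pd i (\<lambda>y. f y) x)"
  using smooth_on_pd[of U f i] by simp

lemma smooth_on_differentiable: "smooth_on U f \<Longrightarrow> x \<in> U \<Longrightarrow> f differentiable (at x)"
  unfolding smooth_on_def by (metis Ck_on.simps(2))

lemma smooth_on_continuous: "smooth_on U f \<Longrightarrow> continuous_on U f"
  unfolding smooth_on_def by (metis Ck_on.simps(1))

lemma smooth_on_subset: "smooth_on U f \<Longrightarrow> V \<subseteq> U \<Longrightarrow> smooth_on V f"
proof -
  assume V: "V \<subseteq> U"
  have "Ck_on k U f \<Longrightarrow> Ck_on k V f" for k
    by (induction k arbitrary: f) (use V continuous_on_subset in auto)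
  then show "smooth_on U f \<Longrightarrow> smooth_on V f" by (simp add: smooth_on_def)
qed

lemma smooth_on_local:
  assumes "\<And>x. x \<in> U \<Longrightarrow> \<exists>V. open V \<and> x \<in> V \<and> smooth_on V f"
  shows "smooth_on U f"
proof -
  have "Ck_on k U f" if "\<And>x. x \<in> U \<Longrightarrow> \<exists>V. open V \<and> x \<in> V \<and> Ck_on k V f" for k
    using that
  proof (induction k arbitrary: f)
    case 0
    have "isCont f x" if "x \<in> U" for x
    proof -
      obtain V where "open V" "x \<in> V" "continuous_on V f" using 0[OF \<open>x \<in> U\<close>] by (auto simp only: Ck_on.simps)
      then show ?thesis by (simp add: continuous_on_eq_continuous_at)
    qed
    then show ?case by (simp add: continuous_at_imp_continuous_on)
  next
    case (Suc k)
    have "f differentiable (at x)" if "x \<in> U" for x using Suc.prems[OF that] by auto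
    moreover have "Ck_on k U (pd i f)" for i
      by (rule Suc.IH) (use Suc.prems in fastforce)
    ultimately show ?case by simp
  qed
  then show ?thesis using assms unfolding smooth_on_def by blast
qed

lemma Ck_on_const: "Ck_on k U (\<lambda>x. c)"
proof (induction k arbitrary: c)
  case (Suc k)
  have "pd i (\<lambda>x. c) = (\<lambda>x. 0)" for i :: 'a by (simp add: fun_eq_iff)
  then show ?case using Suc by simp
qed simp

lemma smooth_on_const: "smooth_on U (\<lambda>x. c)"
  by (simp add: smooth_on_def Ck_on_const)

lemma smooth_on_coord: "smooth_on U (\<lambda>x. x $ j)"
proof -
  have "(\<lambda>x. x $ j) differentiable (at x)" for x :: "real^'a"
    by (metis bounded_linear_imp_differentiable bounded_linear_vec_nth)
  moreover have "pd i (\<lambda>x. x $ j) = (\<lambda>x. if i = j then 1 else 0)" for i by (simp add: pd_coord fun_eq_iff)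
  ultimately have "Ck_on (Suc k) U (\<lambda>x. x $ j)" for k by (simp add: Ck_on_const)
  then show ?thesis using Ck_on_Suc_imp smooth_on_def by blast
qed

lemma Ck_on_add:
  assumes "open U" shows "Ck_on k U f \<Longrightarrow> Ck_on k U g \<Longrightarrow> Ck_on k U (\<lambda>x. f x + g x)"
proof (induction k arbitrary: f g)
  case (Suc k)
  have "Ck_on k U (pd i (\<lambda>x. f x + g x)) \<longleftrightarrow> Ck_on k U (\<lambda>x. pd i f x + pd i g x)" for i
    using Suc.prems by (intro Ck_on_cong[OF assms] pd_add) auto
  then show ?case using Suc by auto
qed (auto intro: continuous_intros)

lemma Ck_on_mult:
  assumes "open U" shows "Ck_on k U f \<Longrightarrow> Ck_on k U g \<Longrightarrow> Ck_on k U (\<lambda>x. f x * g x)"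
proof (induction k arbitrary: f g)
  case (Suc k)
  have "Ck_on k U (pd i (\<lambda>x. f x * g x)) \<longleftrightarrow> Ck_on k U (\<lambda>x. f x * pd i g x + pd i f x * g x)" for i
    using Suc.prems by (intro Ck_on_cong[OF assms] pd_mult) auto
  moreover have "Ck_on k U (\<lambda>x. f x * pd i g x + pd i f x * g x)" for i
    using Suc.prems Suc.prems[THEN Ck_on_Suc_imp]
    by (intro Ck_on_add[OF assms] Suc.IH) (simp_all only: Ck_on.simps)
  ultimately show ?case using Suc.prems by auto
qed (auto intro: continuous_intros)

lemma smooth_on_add: "open U \<Longrightarrow> smooth_on U f \<Longrightarrow> smooth_on U g \<Longrightarrow> smooth_on U (\<lambda>x. f x + g x)"
  and smooth_on_mult: "open U \<Longrightarrow> smooth_on U f \<Longrightarrow> smooth_on U g \<Longrightarrow> smooth_on U (\<lambda>x. f x * g x)"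
  by (auto simp: smooth_on_def Ck_on_add Ck_on_mult)

lemma smooth_on_minus: "open U \<Longrightarrow> smooth_on U f \<Longrightarrow> smooth_on U (\<lambda>x. - f x)"
  using smooth_on_mult[OF _ smooth_on_const[of U "-1"], of f] by simp

lemma smooth_on_diff: "open U \<Longrightarrow> smooth_on U f \<Longrightarrow> smooth_on U g \<Longrightarrow> smooth_on U (\<lambda>x. f x - g x)"
  using smooth_on_add[OF _ _ smooth_on_minus[of U g], of f] by simp

lemma smooth_on_sum:
  assumes "open U" "\<And>a. a \<in> I \<Longrightarrow> smooth_on U (f a)"
  shows "smooth_on U (\<lambda>x. \<Sum>a\<in>I. f a x)"
  using assms(2) by (induction I rule: infinite_finite_induct) (auto intro: smooth_on_add smooth_on_const assms)

lemma smooth_on_prod: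
  assumes "open U" "\<And>a. a \<in> I \<Longrightarrow> smooth_on U (f a)"
  shows "smooth_on U (\<lambda>x. \<Prod>a\<in>I. f a x)"
  using assms(2) by (induction I rule: infinite_finite_induct) (auto intro: smooth_on_mult smooth_on_const assms)

lemma smooth_on_compose:
  fixes \<phi> :: "real^'m \<Rightarrow> real^'k" and F :: "real^'k \<Rightarrow> real"
  assumes F: "smooth_on W F" and U: "open U" and \<phi>: "\<And>j. smooth_on U (\<lambda>x. \<phi> x $ j)"
    and W: "\<And>x. x \<in> U \<Longrightarrow> \<phi> x \<in> W"
  shows "smooth_on U (\<lambda>x. F (\<phi> x))"
proof -
  have d: "(\<lambda>x. \<phi> x $ j) differentiable (at x)" if "x \<in> U" for j x
    using smooth_on_differentiable[OF \<phi> that] .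
  have "Ck_on k U (\<lambda>x. F (\<phi> x))" if "Ck_on k W F" for k
    using that
  proof (induction k arbitrary: F)
    case 0
    have "continuous_on U \<phi>"
      by (intro continuous_at_imp_continuous_on ballI has_derivative_continuous[OF differentiable_vec] d)
    moreover have "\<phi> ` U \<subseteq> W" using W by auto
    ultimately show ?case using 0 by (auto intro: continuous_on_compose2)
  next
    case (Suc k)
    have Fd: "F differentiable (at (\<phi> x))" if "x \<in> U" for x using Suc.prems W[OF that] by simp
    have "Ck_on k U (pd i (\<lambda>x. F (\<phi> x))) \<longleftrightarrow>
        Ck_on k U (\<lambda>x. \<Sum>j\<in>UNIV. pd j F (\<phi> x) * pd i (\<lambda>x. \<phi> x $ j) x)" for i
      by (intro Ck_on_cong[OF U] pd_compose(2) d Fd)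
    moreover have "Ck_on k U (\<lambda>x. pd j F (\<phi> x) * pd i (\<lambda>x. \<phi> x $ j) x)" for i j
      using Suc.prems Suc.IH smooth_on_pd[OF \<phi>] by (intro Ck_on_mult[OF U]) (auto simp: smooth_on_def)
    then have "Ck_on k U (\<lambda>x. \<Sum>j\<in>J. pd j F (\<phi> x) * pd i (\<lambda>x. \<phi> x $ j) x)" for i J
      by (induction J rule: infinite_finite_induct) (auto intro: Ck_on_add[OF U] Ck_on_const)
    ultimately show ?case using pd_compose(1)[OF d Fd] by auto
  qed
  then show ?thesis using F by (simp add: smooth_on_def)
qed

text \<open>A class of functions of one real variable that is closed under differentiation consists of
  smooth functions. The powers and the functions \<open>p (1/t) * exp (-1/t)\<close> are such classes.\<close>

lemma smooth_on_compose_real: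
  fixes f :: "real^'m \<Rightarrow> real"
  assumes C: "\<And>\<psi>. \<psi> \<in> C \<Longrightarrow> \<exists>\<psi>'\<in>C. \<forall>t\<in>S. (\<psi> has_real_derivative \<psi>' t) (at t)"
    and "\<psi> \<in> C" and U: "open U" and f: "smooth_on U f" and S: "\<And>x. x \<in> U \<Longrightarrow> f x \<in> S"
  shows "smooth_on U (\<lambda>x. \<psi> (f x))"
proof -
  have "Ck_on k U (\<lambda>x. \<psi> (f x))" if "\<psi> \<in> C" for k
    using that
  proof (induction k arbitrary: \<psi>)
    case 0
    obtain \<psi>' where "\<forall>t\<in>S. (\<psi> has_real_derivative \<psi>' t) (at t)" using C[OF 0] by blast
    then have "\<forall>x\<in>U. (\<lambda>x. \<psi> (f x)) differentiable (at x)"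
      using pd_compose_real(1) smooth_on_differentiable[OF f] S by blast
    then show ?case
      unfolding Ck_on.simps
      by (intro continuous_at_imp_continuous_on ballI differentiable_imp_continuous_within) blast
  next
    case (Suc k)
    obtain \<psi>' where \<psi>': "\<psi>' \<in> C" "\<forall>t\<in>S. (\<psi> has_real_derivative \<psi>' t) (at t)"
      using C[OF Suc.prems] by blast
    have "Ck_on k U (pd i (\<lambda>x. \<psi> (f x))) \<longleftrightarrow> Ck_on k U (\<lambda>x. \<psi>' (f x) * pd i f x)" for i
      using \<psi>' S smooth_on_differentiable[OF f] by (intro Ck_on_cong[OF U] pd_compose_real(2)) auto
    moreover have "Ck_on k U (\<lambda>x. \<psi>' (f x) * pd i f x)" for i
      using Suc.IH[OF \<psi>'(1)] smooth_on_pd[OF f] by (intro Ck_on_mult[OF U]) (auto simp: smooth_on_def)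
    moreover have "\<forall>x\<in>U. (\<lambda>x. \<psi> (f x)) differentiable (at x)"
      using \<psi>'(2) S smooth_on_differentiable[OF f] by (blast intro: pd_compose_real(1))
    ultimately show ?case by simp
  qed
  then show ?thesis using \<open>\<psi> \<in> C\<close> by (simp add: smooth_on_def)
qed

lemma smooth_on_powr:
  assumes "open U" "smooth_on U f" "\<And>x. x \<in> U \<Longrightarrow> f x > 0"
  shows "smooth_on U (\<lambda>x. f x powr a)"
proof -
  let ?C = "{\<psi>. \<exists>c a. \<psi> = (\<lambda>t::real. c * t powr a)}"
  have "(\<lambda>t. t powr a) = (\<lambda>t. 1 * t powr a)" by simp
  then have 1: "(\<lambda>t. t powr a) \<in> ?C" by blast
  show ?thesis
  proof (rule smooth_on_compose_real[where C = ?C and S = "{0<..}", OF _ 1 assms(1,2)])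
    fix \<psi> assume "\<psi> \<in> ?C"
    then obtain c a where "\<psi> = (\<lambda>t. c * t powr a)" by blast
    then have "\<forall>t\<in>{0<..}. (\<psi> has_real_derivative (c * a) * t powr (a - 1)) (at t)"
      by (auto intro!: derivative_eq_intros)
    moreover have "(\<lambda>t. (c * a) * t powr (a - 1)) \<in> ?C" by blast
    ultimately show "\<exists>\<psi>'\<in>?C. \<forall>t\<in>{0<..}. (\<psi> has_real_derivative \<psi>' t) (at t)"
      by (intro bexI[of _ "\<lambda>t. (c * a) * t powr (a - 1)"])
  qed (use assms in auto)
qed

text \<open>For a function \<open>f\<close> of either sign, \<open>1/f = f * (f\<^sup>2)\<^sup>-\<^sup>1\<close> and \<open>\<bar>f\<bar>\<^sup>1\<^sup>/\<^sup>2 = (f\<^sup>2)\<^sup>1\<^sup>/\<^sup>4\<close>, so that the case of powers of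
  positive functions suffices.\<close>

lemma smooth_on_inverse:
  assumes "open U" "smooth_on U f" "\<And>x. x \<in> U \<Longrightarrow> f x \<noteq> 0"
  shows "smooth_on U (\<lambda>x. inverse (f x))"
proof -
  have "smooth_on U (\<lambda>x. f x * (f x * f x) powr (- 1))"
    using assms by (intro smooth_on_mult smooth_on_powr) (auto simp: zero_less_mult_iff linorder_neq_iff)
  moreover have "f x * (f x * f x) powr (- 1) = inverse (f x)" if "x \<in> U" for x
    using assms(3)[OF that] by (simp add: powr_minus field_simps)
  ultimately show ?thesis using smooth_on_cong[OF assms(1)] by (metis (no_types, lifting))
qed

lemma smooth_on_divide:
  assumes "open U" "smooth_on U f" "smooth_on U h" "\<And>x. x \<in> U \<Longrightarrow> h x \<noteq> 0"
  shows "smooth_on U (\<lambda>x. f x / h x)"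
  using smooth_on_mult[OF assms(1,2) smooth_on_inverse[OF assms(1,3,4)]] by (simp add: divide_inverse)

lemma smooth_on_sqrt_abs:
  assumes "open U" "smooth_on U f" "\<And>x. x \<in> U \<Longrightarrow> f x \<noteq> 0"
  shows "smooth_on U (\<lambda>x. sqrt \<bar>f x\<bar>)"
proof -
  have "smooth_on U (\<lambda>x. (f x * f x) powr (1/4))"
    using assms by (intro smooth_on_mult smooth_on_powr) (auto simp: zero_less_mult_iff linorder_neq_iff)
  moreover have "(f x * f x) powr (1/4) = sqrt \<bar>f x\<bar>" if "x \<in> U" for x
  proof -
    have "(f x * f x) powr (1/4) = (\<bar>f x\<bar> * \<bar>f x\<bar>) powr (1/4)" by simp
    also have "\<dots> = \<bar>f x\<bar> powr (1/4) * \<bar>f x\<bar> powr (1/4)" by (rule powr_mult)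
    also have "\<dots> = \<bar>f x\<bar> powr (1/2)" by (simp flip: powr_add)
    finally show ?thesis by (simp add: powr_half_sqrt)
  qed
  ultimately show ?thesis using smooth_on_cong[OF assms(1)] by (metis (no_types, lifting))
qed

lemma smooth_on_power:
  assumes "open U" "smooth_on U f" shows "smooth_on U (\<lambda>x. f x ^ k)"
  by (induction k) (auto intro: smooth_on_const smooth_on_mult assms)

lemmas smooth_intros = smooth_on_const smooth_on_coord smooth_on_add smooth_on_diff smooth_on_minus
  smooth_on_mult smooth_on_sum smooth_on_prod smooth_on_power smooth_on_pd_fun

text \<open>Symmetry of second derivatives: the mixed second difference of \<open>f\<close> over a square of side \<open>h\<close>
  is, by the mean value theorem applied twice in either order, \<open>h\<^sup>2\<close> times either mixed derivative at
  some point of the square.\<close>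

lemma mixed_difference:
  fixes f :: "real^'m \<Rightarrow> real"
  assumes sm: "smooth_on (ball x e) f" and h: "0 < h" "2 * h < e"
  shows "\<exists>z. dist z x \<le> 2 * h \<and>
    f (x + h *\<^sub>R axis i 1 + h *\<^sub>R axis j 1) - f (x + h *\<^sub>R axis i 1) - f (x + h *\<^sub>R axis j 1) + f x
      = h\<^sup>2 * pd j (pd i f) z"
proof -
  let ?a = "axis i (1::real)" and ?b = "axis j (1::real)"
  have near: "dist (x + s *\<^sub>R ?a + t *\<^sub>R ?b) x \<le> 2 * h" if "0 \<le> s" "s \<le> h" "0 \<le> t" "t \<le> h" for s t
  proof -
    have "norm (s *\<^sub>R ?a + t *\<^sub>R ?b) \<le> \<bar>s\<bar> + \<bar>t\<bar>"
      using norm_triangle_ineq[of "s *\<^sub>R ?a" "t *\<^sub>R ?b"] by (simp add: norm_axis_1)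
    then show ?thesis using that by (simp add: dist_norm add.assoc)
  qed
  have inb: "x + s *\<^sub>R ?a + t *\<^sub>R ?b \<in> ball x e" if "0 \<le> s" "s \<le> h" "0 \<le> t" "t \<le> h" for s t
    using near[OF that] h by (simp add: dist_commute)
  have d0: "((\<lambda>s. f (x + s *\<^sub>R ?a + h *\<^sub>R ?b) - f (x + s *\<^sub>R ?a)) has_real_derivative
       (pd i f (x + s *\<^sub>R ?a + h *\<^sub>R ?b) - pd i f (x + s *\<^sub>R ?a))) (at s)" if "0 \<le> s" "s \<le> h" for s
  proof -
    have "x + h *\<^sub>R ?b + s *\<^sub>R ?a \<in> ball x e" "x + s *\<^sub>R ?a \<in> ball x e"
      using inb[OF that, of h] inb[OF that, of 0] h by (auto simp: algebra_simps)
    from this[THEN smooth_on_differentiable[OF sm], THEN pd_along_line]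
    have "((\<lambda>s. f (x + h *\<^sub>R ?b + s *\<^sub>R ?a) - f (x + s *\<^sub>R ?a)) has_real_derivative
       (pd i f (x + h *\<^sub>R ?b + s *\<^sub>R ?a) - pd i f (x + s *\<^sub>R ?a))) (at s)"
      by (rule DERIV_diff)
    then show ?thesis by (simp add: algebra_simps)
  qed
  obtain s where s: "0 < s" "s < h" and
    1: "(f (x + h *\<^sub>R ?a + h *\<^sub>R ?b) - f (x + h *\<^sub>R ?a)) - (f (x + 0 *\<^sub>R ?a + h *\<^sub>R ?b) - f (x + 0 *\<^sub>R ?a))
      = (h - 0) * (pd i f (x + s *\<^sub>R ?a + h *\<^sub>R ?b) - pd i f (x + s *\<^sub>R ?a))"
    using MVT2[OF h(1) d0] by blast
  have d1: "((\<lambda>t. pd i f (x + s *\<^sub>R ?a + t *\<^sub>R ?b)) has_real_derivative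
       pd j (pd i f) (x + s *\<^sub>R ?a + t *\<^sub>R ?b)) (at t)" if "0 \<le> t" "t \<le> h" for t
    using inb[of s t] s that by (intro pd_along_line smooth_on_differentiable[OF smooth_on_pd[OF sm]]) auto
  obtain t where t: "0 < t" "t < h" and
    2: "pd i f (x + s *\<^sub>R ?a + h *\<^sub>R ?b) - pd i f (x + s *\<^sub>R ?a + 0 *\<^sub>R ?b) = (h - 0) * pd j (pd i f) (x + s *\<^sub>R ?a + t *\<^sub>R ?b)"
    using MVT2[OF h(1) d1] by blast
  show ?thesis
    using 1 2 near[of s t] s t by (intro exI[of _ "x + s *\<^sub>R ?a + t *\<^sub>R ?b"]) (simp add: power2_eq_square algebra_simps)
qed

lemma pd_commute:
  fixes f :: "real^'m \<Rightarrow> real"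
  assumes "open U" "smooth_on U f" "x \<in> U"
  shows "pd i (pd j f) x = pd j (pd i f) x"
proof -
  obtain e where e: "e > 0" "ball x e \<subseteq> U" using assms openE by blast
  have sm: "smooth_on (ball x e) f" using assms(2) e(2) smooth_on_subset by blast
  define h where "h n = e / (4 * (real n + 1))" for n :: nat
  have h: "0 < h n" "2 * h n < e" for n
  proof -
    show "0 < h n" using e(1) by (simp add: h_def)
    have "2 * h n = (e / 2) / (real n + 1)" by (simp add: h_def field_simps)
    also have "\<dots> \<le> (e / 2) / 1" using e(1) by (intro divide_left_mono) auto
    finally show "2 * h n < e" using e(1) by simp
  qed
  have lim: "h \<longlonglongrightarrow> 0"
    using tendsto_mult_right_zero[OF LIMSEQ_inverse_real_of_nat, of "e / 4"]
    by (simp add: h_def[abs_def] field_simps)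
  have key: "\<exists>z. (\<forall>n. dist (z n) x \<le> 2 * h n \<and>
    f (x + h n *\<^sub>R axis i 1 + h n *\<^sub>R axis j 1) - f (x + h n *\<^sub>R axis i 1) - f (x + h n *\<^sub>R axis j 1) + f x
      = (h n)\<^sup>2 * pd j (pd i f) (z n))" for i j
    using mixed_difference[OF sm h] by (intro choice) blast
  obtain z where z: "\<And>n. dist (z n) x \<le> 2 * h n" "\<And>n. 
    f (x + h n *\<^sub>R axis i 1 + h n *\<^sub>R axis j 1) - f (x + h n *\<^sub>R axis i 1) - f (x + h n *\<^sub>R axis j 1) + f x
      = (h n)\<^sup>2 * pd j (pd i f) (z n)" using key[of i j] by blast
  obtain w where w: "\<And>n. dist (w n) x \<le> 2 * h n" "\<And>n. 
    f (x + h n *\<^sub>R axis j 1 + h n *\<^sub>R axis i 1) - f (x + h n *\<^sub>R axis j 1) - f (x + h n *\<^sub>R axis i 1) + f x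
      = (h n)\<^sup>2 * pd i (pd j f) (w n)" using key[of j i] by blast
  have l2: "(\<lambda>n. 2 * h n) \<longlonglongrightarrow> 0" using tendsto_mult_right_zero[OF lim, of 2] by simp
  have "z \<longlonglongrightarrow> x" "w \<longlonglongrightarrow> x"
    by (rule Lim_transform_bound[OF _ l2, THEN LIM_zero_cancel]; use z(1) w(1) h(1) in \<open>auto simp: dist_norm less_imp_le\<close>)+
  moreover have "isCont (pd j (pd i f)) x" "isCont (pd i (pd j f)) x"
    using sm e(1) by (auto intro!: differentiable_imp_continuous_within smooth_on_differentiable[of "ball x e"] smooth_on_pd)
  ultimately have "(\<lambda>n. pd j (pd i f) (z n)) \<longlonglongrightarrow> pd j (pd i f) x" "(\<lambda>n. pd i (pd j f) (w n)) \<longlonglongrightarrow> pd i (pd j f) x"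
    by (auto intro: isCont_tendsto_compose)
  moreover have "pd j (pd i f) (z n) = pd i (pd j f) (w n)" for n
  proof -
    have "(h n)\<^sup>2 * pd j (pd i f) (z n) = (h n)\<^sup>2 * pd i (pd j f) (w n)"
      unfolding z(2)[symmetric] w(2)[symmetric] by (simp add: algebra_simps)
    then show ?thesis using h(1)[of n] by simp
  qed
  ultimately show ?thesis using LIMSEQ_unique by simp
qed


section \<open>Bump functions and integration by parts\<close>

lemma exp_inverse_vanishes:
  "((\<lambda>t. poly p (inverse t) * exp (- inverse t)) \<longlongrightarrow> (0::real)) (at_right 0)"
proof -
  have "((\<lambda>x. \<Sum>k\<le>degree p. coeff p k * (x ^ k / exp x)) \<longlongrightarrow> (\<Sum>k\<le>degree p. coeff p k * 0)) at_top"
    by (intro tendsto_sum tendsto_mult tendsto_const tendsto_power_div_exp_0)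
  then have "((\<lambda>x. poly p x * exp (- x)) \<longlongrightarrow> 0) at_top"
    by (simp add: poly_altdef sum_distrib_right exp_minus divide_inverse mult.assoc)
  then show ?thesis
    using filterlim_compose[OF _ filterlim_inverse_at_top_right] by blast
qed

definition flat_exp :: "real \<Rightarrow> real" where
  "flat_exp t = (if t > 0 then exp (- inverse t) else 0)"

lemma smooth_on_flat_exp:
  assumes "open U" "smooth_on U f"
  shows "smooth_on U (\<lambda>x. flat_exp (f x))"
proof -
  let ?h = "\<lambda>(p::real poly) t. if t > 0 then poly p (inverse t) * exp (- inverse t) else 0"
  have 1: "flat_exp \<in> range ?h" by (intro image_eqI[of _ _ 1]) (auto simp: flat_exp_def)
  show ?thesis
  proof (rule smooth_on_compose_real[OF _ 1 assms, where S = UNIV])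
    fix \<psi> assume "\<psi> \<in> range ?h"
    then obtain p where \<psi>: "\<psi> = ?h p" by blast
    \<comment> \<open>With \<open>x = 1/t\<close>, the derivative of \<open>p (1/t) * exp (-1/t)\<close> is \<open>x\<^sup>2 (p x - p' x) * exp (-x)\<close>.\<close>
    let ?q = "[:0, 0, 1:] * (p - pderiv p)"
    have "(\<psi> has_real_derivative ?h ?q t) (at t)" for t
    proof -
      consider "t > 0" | "t < 0" | "t = 0" by linarith
      then show ?thesis
      proof cases
        case 1
        have "((\<lambda>t. poly p (inverse t) * exp (- inverse t)) has_real_derivative ?h ?q t) (at t)"
          using 1 by (auto intro!: derivative_eq_intros simp: power2_eq_square field_simps)
        then show ?thesis
          by (rule DERIV_cong_ev[THEN iffD1, rotated -1])
            (use 1 in \<open>auto simp: \<psi> intro!: eventually_mono[OF eventually_nhds_in_open[of "{0<..}"]]\<close>)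
      next
        case 2
        have "((\<lambda>t. 0) has_real_derivative ?h ?q t) (at t)" using 2 by auto
        then show ?thesis
          by (rule DERIV_cong_ev[THEN iffD1, rotated -1])
            (use 2 in \<open>auto simp: \<psi> intro!: eventually_mono[OF eventually_nhds_in_open[of "{..<0}"]]\<close>)
      next
        case 3
        \<comment> \<open>The difference quotient at \<open>0\<close> from the right is of the same form with \<open>x p x\<close> instead of \<open>p x\<close>.\<close>
        have "((\<lambda>t. poly ([:0, 1:] * p) (inverse t) * exp (- inverse t)) \<longlongrightarrow> 0) (at_right 0)"
          by (rule exp_inverse_vanishes)
        then have r: "((\<lambda>s. (\<psi> (0 + s) - \<psi> 0) / s) \<longlongrightarrow> 0) (at_right 0)"
          by (rule Lim_transform_eventually)
            (auto simp: eventually_at_right_field \<psi> field_simps intro!: exI[of _ 1])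
        have l: "((\<lambda>s. (\<psi> (0 + s) - \<psi> 0) / s) \<longlongrightarrow> 0) (at_left 0)"
          by (rule Lim_transform_eventually[OF tendsto_const])
            (auto simp: eventually_at_left_field \<psi> intro!: exI[of _ "-1"])
        have "((\<lambda>s. (\<psi> (0 + s) - \<psi> 0) / s) \<longlongrightarrow> 0) (at 0)"
          using l r by (simp add: filterlim_at_split)
        then show ?thesis using 3 by (simp add: DERIV_def)
      qed
    qed
    then show "\<exists>\<psi>'\<in>range ?h. \<forall>t\<in>UNIV. (\<psi> has_real_derivative \<psi>' t) (at t)"
      by (intro bexI[of _ "?h ?q"]) auto
  qed auto
qed

lemma exists_bump:
  fixes a :: "real^'m"
  assumes "open U" "a \<in> U"
  obtains b where "test_function U b" "\<And>x. b x \<ge> 0" "b a > 0"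
proof -
  obtain e where e: "e > 0" "cball a e \<subseteq> U" using assms open_contains_cball by blast
  define b where "b x = flat_exp (e\<^sup>2 - (\<Sum>i\<in>UNIV. (x $ i - a $ i)\<^sup>2))" for x
  have "smooth_on UNIV b"
    unfolding b_def by (intro smooth_on_flat_exp smooth_intros open_UNIV)
  moreover have "b x = 0" if "x \<notin> cball a e" for x
  proof -
    have "e < dist x a" using that by (simp add: dist_commute)
    then have "e\<^sup>2 < (dist x a)\<^sup>2" using e by (simp add: power_strict_mono)
    also have "(dist x a)\<^sup>2 = (\<Sum>i\<in>UNIV. (x $ i - a $ i)\<^sup>2)"
      by (simp add: dist_vec_def L2_set_def sum_nonneg dist_real_def)
    finally show ?thesis by (simp add: b_def flat_exp_def)
  qed
  ultimately have "test_function U b"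
    unfolding test_function_def using e compact_cball by blast
  moreover have "b x \<ge> 0" "b a > 0" for x using e by (auto simp: b_def flat_exp_def)
  ultimately show ?thesis using that by blast
qed

lemma integrable_compact_support:
  fixes f :: "real^'m \<Rightarrow> real"
  assumes "continuous_on UNIV f" "compact K" "\<And>x. x \<notin> K \<Longrightarrow> f x = 0"
  shows "integrable lborel f"
proof -
  have "integrable lborel (\<lambda>x. indicator K x *\<^sub>R f x)"
    using borel_integrable_compact[OF assms(2) continuous_on_subset[OF assms(1)]] by simp
  moreover have "(\<lambda>x. indicator K x *\<^sub>R f x) = f"
    using assms(3) by (auto simp: indicator_def fun_eq_iff)
  ultimately show ?thesis by simp
qed

text \<open>The integral of a partial derivative of a compactly supported function is the limit of the
  integrals of its difference quotients, and these vanish by translation invariance.\<close>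

lemma integral_pd_compact_support:
  fixes F :: "real^'m \<Rightarrow> real"
  assumes F: "smooth_on UNIV F" and K: "compact K" "\<And>x. x \<notin> K \<Longrightarrow> F x = 0"
  shows "(LINT x|lborel. pd i F x) = 0"
proof -
  let ?e = "axis i (1::real)"
  define h where "h n = 1 / (real n + 1)" for n :: nat
  have h: "0 < h n" "h n \<le> 1" for n by (auto simp: h_def)
  have h0: "h \<longlonglongrightarrow> 0" using LIMSEQ_inverse_real_of_nat by (simp add: h_def[abs_def] field_simps)
  have d: "F differentiable (at x)" for x using smooth_on_differentiable[OF F] by simp
  have pd0: "pd i F x = 0" if "x \<notin> K" for x
    using pd_cong[of "- K" x F "\<lambda>x. 0"] that K compact_imp_closed by (auto simp: open_Compl)
  have cont: "continuous_on UNIV (pd i F)" "continuous_on UNIV F"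
    using F smooth_on_pd smooth_on_continuous by blast+
  obtain B0 where B0: "\<And>x. x \<in> K \<Longrightarrow> \<bar>pd i F x\<bar> \<le> B0"
    using compact_imp_bounded[OF compact_continuous_image[OF continuous_on_subset[OF cont(1)] K(1)]]
    by (auto simp: bounded_iff)
  define B where "B = max B0 0"
  have B: "\<bar>pd i F x\<bar> \<le> B" for x
    using B0[of x] pd0[of x] by (cases "x \<in> K") (auto simp: B_def)
  obtain R where R: "\<And>x. x \<in> K \<Longrightarrow> norm x \<le> R"
    using compact_imp_bounded[OF K(1)] by (auto simp: bounded_iff)
  define q where "q n x = (F (h n *\<^sub>R ?e + x) - F x) / h n" for n x
  have line: "((\<lambda>s. F (x + s *\<^sub>R ?e)) has_real_derivative pd i F (x + s *\<^sub>R ?e)) (at s)" for x s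
    by (rule pd_along_line[OF d])
  have intF: "integrable lborel F" by (rule integrable_compact_support[OF cont(2) K])
  have shift: "integrable lborel (\<lambda>x. F (c + x))" "(LINT x|lborel. F (c + x)) = (LINT x|lborel. F x)" for c
  proof -
    have m: "(+) c \<in> measurable lborel borel" by simp
    have Fm: "F \<in> borel_measurable borel" using cont(2) by (rule borel_measurable_continuous_onI)
    show "integrable lborel (\<lambda>x. F (c + x))"
      using integrable_distr_eq[OF m Fm] intF by (simp add: lborel_distr_plus)
    show "(LINT x|lborel. F (c + x)) = (LINT x|lborel. F x)"
      using integral_distr[OF m Fm] by (simp add: lborel_distr_plus)
  qed
  have q0: "(LINT x|lborel. q n x) = 0" for n
    using shift[of "h n *\<^sub>R ?e"] intF by (simp add: q_def)
  have "(\<lambda>n. LINT x|lborel. q n x) \<longlonglongrightarrow> (LINT x|lborel. pd i F x)"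
  proof (rule integral_dominated_convergence)
    show "pd i F \<in> borel_measurable lborel"
      using borel_measurable_continuous_onI[OF cont(1)] by simp
    have "integrable lborel (q n)" for n
      unfolding q_def using shift[of "h n *\<^sub>R ?e"] intF by simp
    then show "q n \<in> borel_measurable lborel" for n by auto
    show "integrable lborel (\<lambda>x. B * indicator (cball 0 (R + 1)) x :: real)"
      by (intro integrable_mult_right integrable_real_indicator emeasure_bounded_finite bounded_cball) simp
    show "AE x in lborel. (\<lambda>n. q n x) \<longlonglongrightarrow> pd i F x"
    proof (rule AE_I2)
      fix x
      have "((\<lambda>s. (F (x + s *\<^sub>R ?e) - F x) / s) \<longlongrightarrow> pd i F x) (at 0)"
        using line[of x 0] by (simp add: DERIV_def)
      moreover have "filterlim h (at 0) sequentially"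
        using h0 h(1) by (auto simp: filterlim_at intro!: always_eventually) (metis less_irrefl)
      ultimately show "(\<lambda>n. q n x) \<longlonglongrightarrow> pd i F x"
        unfolding q_def by (subst add.commute) (rule filterlim_compose)
    qed
    show "AE x in lborel. norm (q n x) \<le> B * indicator (cball 0 (R + 1)) x" for n
    proof (rule AE_I2)
      fix x
      obtain s where s: "F (x + h n *\<^sub>R ?e) - F (x + 0 *\<^sub>R ?e) = (h n - 0) * pd i F (x + s *\<^sub>R ?e)"
        using MVT2[OF h(1) line, of n x] by blast
      then have "q n x = pd i F (x + s *\<^sub>R ?e)" using h(1)[of n] by (simp add: q_def add.commute)
      then have b: "\<bar>q n x\<bar> \<le> B" using B by simp
      show "norm (q n x) \<le> B * indicator (cball 0 (R + 1)) x"
      proof (cases "x \<in> cball 0 (R + 1)")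
        case False
        then have "norm x > R + 1" by simp
        moreover have "norm (h n *\<^sub>R ?e + x) \<ge> norm x - norm (h n *\<^sub>R ?e)"
          by (metis add.commute norm_diff_ineq)
        moreover have "norm (h n *\<^sub>R ?e) \<le> 1" using h[of n] by (simp add: norm_axis_1)
        ultimately have "x \<notin> K" "h n *\<^sub>R ?e + x \<notin> K" using R by fastforce+
        then show ?thesis by (simp add: q_def K B_def)
      qed (use b in auto)
    qed
  qed
  then show ?thesis unfolding q0 using LIMSEQ_unique tendsto_const by blast
qed

text \<open>The fundamental lemma of the calculus of variations: near a point at which \<open>v\<close> does not vanish it has a
  constant sign, and a bump function supported there has a non-zero integral against \<open>v\<close>.\<close>

lemma test_functions_separate:
  fixes v :: "real^'m \<Rightarrow> real"
  assumes U: "open U" and v: "continuous_on U v"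
    and 0: "\<And>f. test_function U f \<Longrightarrow> (LINT x:U|lborel. f x * v x) = 0" and a: "a \<in> U"
  shows "v a = 0"
proof (rule ccontr)
  assume va: "v a \<noteq> 0"
  define s where "s = sgn (v a)"
  define V where "V = {x\<in>U. s * v x > 0}"
  have "continuous_on U (\<lambda>x. s * v x)" by (intro continuous_intros v)
  then have "open V"
    unfolding V_def using continuous_open_preimage[OF _ U, of "\<lambda>x. s * v x" "{0<..}"]
    by (auto simp: vimage_def Int_def)
  moreover have "a \<in> V" using a va by (auto simp: V_def s_def sgn_if)
  ultimately obtain b where b: "test_function V b" "\<And>x. b x \<ge> 0" "b a > 0" using exists_bump by metis
  obtain K where K: "compact K" "K \<subseteq> V" "\<And>x. x \<notin> K \<Longrightarrow> b x = 0" and bs: "smooth_on UNIV b"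
    using b(1) unfolding test_function_def by blast
  have "V \<subseteq> U" by (auto simp: V_def)
  then have bU: "test_function U b" using b(1) unfolding test_function_def by blast
  define \<phi> where "\<phi> x = indicator U x * (b x * (s * v x))" for x
  have \<phi>0: "\<phi> x = 0" if "x \<notin> K" for x using K that by (simp add: \<phi>_def)
  have "continuous_on V \<phi>"
  proof -
    have "continuous_on V (\<lambda>x. b x * (s * v x))"
      using \<open>V \<subseteq> U\<close> v smooth_on_continuous[OF bs]
      by (auto intro!: continuous_intros intro: continuous_on_subset)
    then show ?thesis using \<open>V \<subseteq> U\<close> by (auto simp: \<phi>_def subset_iff cong: continuous_on_cong_simp)
  qed
  moreover have "continuous_on (- K) \<phi>"
    using continuous_on_cong[of "- K" "- K" \<phi> "\<lambda>x. 0"] \<phi>0 by simp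
  moreover have "UNIV = V \<union> - K" using K by auto
  ultimately have cont: "continuous_on UNIV \<phi>"
    using continuous_on_open_Un[OF \<open>open V\<close>, of "- K" \<phi>] K(1) by (simp add: open_Compl compact_imp_closed)
  have nn: "\<phi> x \<ge> 0" for x
    using b(2) K \<phi>0[of x] by (cases "x \<in> K") (auto simp: \<phi>_def V_def subset_iff less_imp_le)
  have int: "integrable lborel \<phi>" by (rule integrable_compact_support[OF cont K(1) \<phi>0])
  have "(LINT x|lborel. \<phi> x) = s * (LINT x:U|lborel. b x * v x)"
    unfolding set_lebesgue_integral_def \<phi>_def
    by (subst integral_mult_right_zero[symmetric]) (simp add: mult_ac)
  then have "(LINT x|lborel. \<phi> x) = 0" using 0[OF bU] by simp
  then have "AE x in lborel. \<phi> x = 0"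
    using integral_nonneg_eq_0_iff_AE[OF int] nn by simp
  moreover have pos: "{x\<in>space lborel. \<not> \<phi> x = 0} = {x. \<phi> x > 0}"
    using nn by (auto simp: less_le)
  moreover have op: "open {x. \<phi> x > 0}" using open_Collect_less[OF continuous_on_const cont] by simp
  ultimately have "{x. \<phi> x > 0} \<in> null_sets lborel"
    using AE_iff_null[of lborel "\<lambda>x. \<phi> x = 0"] by simp
  then have "negligible {x. \<phi> x > 0}"
    by (simp add: negligible_iff_null_sets null_sets_completionI)
  moreover have "\<phi> a > 0" using a va b(3) by (auto simp: \<phi>_def s_def sgn_if)
  ultimately show False using open_not_negligible[OF op] by blast
qed


section \<open>Metrics in coordinates\<close>

lemma invertible_matrix_inv:
  fixes A :: "real^'n^'n"
  assumes "det A \<noteq> 0"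
  shows "A ** matrix_inv A = mat 1" "matrix_inv A ** A = mat 1"
proof -
  have "\<exists>B. A ** B = mat 1 \<and> B ** A = mat 1"
    using assms by (simp add: invertible_det_nz flip: invertible_def)
  then show "A ** matrix_inv A = mat 1" "matrix_inv A ** A = mat 1"
    unfolding matrix_inv_def by (auto intro: someI2_ex)
qed

lemma matrix_inv_unique:
  fixes A B :: "real^'n^'n"
  assumes "A ** B = mat 1"
  shows "matrix_inv A = B" "det A \<noteq> 0"
proof -
  have "det A * det B = 1" using assms by (metis det_mul det_I)
  then show d: "det A \<noteq> 0" by auto
  have "matrix_inv A = matrix_inv A ** (A ** B)" using assms by simp
  also have "\<dots> = (matrix_inv A ** A) ** B" by (simp only: matrix_mul_assoc)
  finally show "matrix_inv A = B" using invertible_matrix_inv(2)[OF d] by simp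
qed

text \<open>Cramer's rule exhibits the entries of the inverse matrix as quotients of determinants, hence as smooth
  functions of the entries.\<close>

lemma matrix_inv_component:
  fixes A :: "real^'n^'n"
  assumes "det A \<noteq> 0"
  shows "matrix_inv A $ k $ j = det (\<chi> a b. if b = k then mat 1 $ a $ j else A $ a $ b) / det A"
proof -
  have "A *v (matrix_inv A *v axis j 1) = axis j 1"
    by (simp add: matrix_vector_mul_assoc invertible_matrix_inv[OF assms])
  then have "matrix_inv A *v axis j 1
      = (\<chi> k. det (\<chi> a b. if b = k then axis j 1 $ a else A $ a $ b) / det A)"
    by (simp only: cramer[OF assms])
  moreover have "(matrix_inv A *v axis j 1) $ k = matrix_inv A $ k $ j"
    by (simp add: matrix_vector_mult_def axis_def if_distrib cong: if_cong)
  ultimately have "matrix_inv A $ k $ j = det (\<chi> a b. if b = k then axis j 1 $ a else A $ a $ b) / det A"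
    by simp
  moreover have "axis j 1 $ a = (mat 1 :: real^'n^'n) $ a $ j" for a
    by (auto simp: axis_def mat_def)
  ultimately show ?thesis by (simp only:)
qed

lemma smooth_on_det:
  fixes g :: "real^'m \<Rightarrow> real^'n^'n"
  assumes "open U" "\<And>i j. smooth_on U (\<lambda>x. g x $ i $ j)"
  shows "smooth_on U (\<lambda>x. det (g x))"
  unfolding det_def by (intro smooth_intros assms)

lemma smooth_on_matrix_inv:
  fixes g :: "real^'m \<Rightarrow> real^'n^'n"
  assumes "open U" "\<And>i j. smooth_on U (\<lambda>x. g x $ i $ j)" "\<And>x. x \<in> U \<Longrightarrow> det (g x) \<noteq> 0"
  shows "smooth_on U (\<lambda>x. matrix_inv (g x) $ k $ l)"
proof -
  have "smooth_on U (\<lambda>x. det (\<chi> a b. if b = k then mat 1 $ a $ l else g x $ a $ b) / det (g x))"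
  proof (intro smooth_on_divide smooth_on_det assms)
    show "smooth_on U (\<lambda>x. (\<chi> a b. if b = k then mat 1 $ a $ l else g x $ a $ b) $ i $ j)" for i j
      using assms(2)[of i j] by (cases "j = k") (auto simp: smooth_on_const)
  qed
  then show ?thesis
    by (rule smooth_on_cong[OF assms(1), THEN iffD1, rotated])
      (rule matrix_inv_component[OF assms(3), symmetric])
qed

text \<open>Only the identity permutation contributes to the derivative of the determinant at the
  identity matrix, since any other permutation moves at least two indices.\<close>

lemma pd_det_at_identity:
  fixes B :: "real^'m \<Rightarrow> real^'n^'n"
  assumes d: "\<And>k l. (\<lambda>x. B x $ k $ l) differentiable (at x)" and 1: "B x = mat 1"
  shows "pd i (\<lambda>x. det (B x)) x = (\<Sum>k\<in>UNIV. pd i (\<lambda>x. B x $ k $ k) x)"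
proof -
  let ?d = "\<lambda>k l. frechet_derivative (\<lambda>x. B x $ k $ l) (at x)"
  have D: "((\<lambda>x. B x $ k $ l) has_derivative ?d k l) (at x)" for k l
    using d frechet_derivative_works by blast
  let ?P = "{p. p permutes (UNIV :: 'n set)}"
  let ?t = "\<lambda>p. of_int (sign p) * (\<Sum>k\<in>UNIV. ?d k (p k) (axis i 1) * (\<Prod>j\<in>UNIV - {k}. B x $ j $ p j))"
  have "((\<lambda>x. det (B x)) has_derivative (\<lambda>h. \<Sum>p\<in>?P. of_int (sign p) *
      (\<Sum>k\<in>UNIV. ?d k (p k) h * (\<Prod>j\<in>UNIV - {k}. B x $ j $ p j)))) (at x)"
    unfolding det_def
    by (intro has_derivative_sum has_derivative_mult_right has_derivative_prod D)
  from pd_unique[OF this, of i] have "pd i (\<lambda>x. det (B x)) x = (\<Sum>p\<in>?P. ?t p)" .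
  also have "\<dots> = ?t id + (\<Sum>p\<in>?P - {id}. ?t p)"
    by (rule sum.remove) (auto simp: finite_permutations permutes_id)
  also have "(\<Sum>p\<in>?P - {id}. ?t p) = 0"
  proof (rule sum.neutral, rule ballI)
    fix p assume p: "p \<in> ?P - {id}"
    then obtain a where a: "p a \<noteq> a" by fastforce
    have "inj p" using p by (auto dest: permutes_inj)
    then have "p (p a) \<noteq> p a" using a by (simp add: inj_eq)
    have z: "(\<Prod>j\<in>UNIV - {k}. B x $ j $ p j) = 0" for k
    proof -
      obtain j where j: "j \<noteq> k" "j \<noteq> p j" using a \<open>p (p a) \<noteq> p a\<close> by metis
      then have "B x $ j $ p j = 0" by (simp add: 1 mat_def)
      with j(1) show ?thesis by (intro prod_zero bexI[of _ j]) auto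
    qed
    show "?t p = 0" by (simp only: z mult_zero_right sum.neutral_const)
  qed
  also have "?t id + 0 = (\<Sum>k\<in>UNIV. pd i (\<lambda>x. B x $ k $ k) x)"
    by (simp add: sign_id 1 mat_def pd_def)
  finally show ?thesis .
qed

text \<open>The coordinate derivative of \<open>ln \<bar>det g\<bar>\<close>.\<close>

definition dlogdet :: "(real^'m \<Rightarrow> real^'n^'n) \<Rightarrow> 'm \<Rightarrow> real^'m \<Rightarrow> real" where
  "dlogdet g i x = (\<Sum>k\<in>UNIV. \<Sum>l\<in>UNIV. matrix_inv (g x) $ k $ l * pd i (\<lambda>y. g y $ l $ k) x)"

text \<open>Jacobi's formula. Multiplication by the constant matrix \<open>g x\<^sup>-\<^sup>1\<close> reduces it to the derivative at the
  identity matrix.\<close>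

lemma pd_det:
  fixes g :: "real^'m \<Rightarrow> real^'n^'n"
  assumes U: "open U" "x \<in> U" and g: "\<And>i j. smooth_on U (\<lambda>x. g x $ i $ j)" and nz: "det (g x) \<noteq> 0"
  shows "pd i (\<lambda>x. det (g x)) x = det (g x) * dlogdet g i x"
proof -
  let ?B = "\<lambda>y. matrix_inv (g x) ** g y"
  note d = smooth_on_differentiable[OF g U(2)]
  have sB: "smooth_on U (\<lambda>y. ?B y $ k $ l)" for k l
    unfolding matrix_matrix_mult_def vec_lambda_beta by (intro smooth_intros U(1) g)
  note dB = smooth_on_differentiable[OF sB U(2)]
  have dd: "(\<lambda>y. det (?B y)) differentiable (at x)"
    by (rule smooth_on_differentiable[OF smooth_on_det[OF U(1) sB] U(2)])
  have "det (g x) * det (matrix_inv (g x)) = 1"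
    by (metis det_I det_mul invertible_matrix_inv(1) nz)
  then have "det (g y) = det (g x) * det (?B y)" for y
    by (simp add: det_mul flip: mult.assoc)
  then have "(\<lambda>y. det (g y)) = (\<lambda>y. det (g x) * det (?B y))" by (rule ext)
  then have "pd i (\<lambda>x. det (g x)) x = pd i (\<lambda>y. det (g x) * det (?B y)) x" by (rule arg_cong)
  also have "\<dots> = det (g x) * pd i (\<lambda>y. det (?B y)) x"
    by (rule pd_cmult[OF dd])
  also have "pd i (\<lambda>y. det (?B y)) x = (\<Sum>k\<in>UNIV. pd i (\<lambda>y. ?B y $ k $ k) x)"
    by (rule pd_det_at_identity[OF dB invertible_matrix_inv(2)[OF nz]])
  also have "\<dots> = dlogdet g i x"
    unfolding dlogdet_def matrix_matrix_mult_def
    by (simp add: pd_sum pd_cmult d)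
  finally show ?thesis .
qed

text \<open>Symmetric and non-degenerate, of any signature: both the Riemannian metrics of a family and the Lorentzian
  ambient metric are instances.\<close>

definition metric_on :: "(real^'m) set \<Rightarrow> (real^'m \<Rightarrow> real^'n^'n) \<Rightarrow> bool" where
  "metric_on U g \<longleftrightarrow> open U \<and> (\<forall>i j. smooth_on U (\<lambda>x. g x $ i $ j)) \<and>
     (\<forall>x\<in>U. det (g x) \<noteq> 0 \<and> (\<forall>i j. g x $ i $ j = g x $ j $ i))"

text \<open>The derivative of the volume density is written out by means of \<open>dlogdet\<close>. Thus the divergence, and with it
  every codifferential, can be computed without a determinant.\<close>

definition divg :: "(real^'m \<Rightarrow> real^'m^'m) \<Rightarrow> (real^'m \<Rightarrow> real^'m) \<Rightarrow> real^'m \<Rightarrow> real" where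
  "divg g X x = (\<Sum>i\<in>UNIV. pd i (\<lambda>y. X y $ i) x + dlogdet g i x * X x $ i / 2)"

context
  fixes U :: "(real^'m) set" and g :: "real^'m \<Rightarrow> real^'n^'n"
  assumes g: "metric_on U g"
begin

lemma metric_onD:
  shows "open U" "smooth_on U (\<lambda>x. g x $ i $ j)" "x \<in> U \<Longrightarrow> det (g x) \<noteq> 0"
    "x \<in> U \<Longrightarrow> g x $ i $ j = g x $ j $ i"
  using g by (auto simp: metric_on_def)

lemma smooth_on_inverse_metric: "smooth_on U (\<lambda>x. matrix_inv (g x) $ i $ j)"
  by (rule smooth_on_matrix_inv) (use g in \<open>auto simp: metric_on_def\<close>)

lemma smooth_on_dlogdet: "smooth_on U (dlogdet g i)"
proof -
  have "dlogdet g i = (\<lambda>x. \<Sum>k\<in>UNIV. \<Sum>l\<in>UNIV. matrix_inv (g x) $ k $ l * pd i (\<lambda>y. g y $ l $ k) x)"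
    by (simp add: dlogdet_def fun_eq_iff)
  then show ?thesis
    using metric_onD(1,2) smooth_on_inverse_metric by (simp add: smooth_intros)
qed

lemma smooth_on_volume: "smooth_on U (\<lambda>x. sqrt \<bar>det (g x)\<bar>)"
  by (intro smooth_on_sqrt_abs smooth_on_det metric_onD)

lemma pd_volume:
  assumes "x \<in> U"
  shows "pd i (\<lambda>x. sqrt \<bar>det (g x)\<bar>) x = sqrt \<bar>det (g x)\<bar> * dlogdet g i x / 2"
proof -
  have nz: "det (g x) \<noteq> 0" using metric_onD(3) assms .
  have dd: "(\<lambda>x. det (g x)) differentiable (at x)"
    by (rule smooth_on_differentiable[OF smooth_on_det assms]) (rule metric_onD)+
  define s where "s = sgn (det (g x))"
  have *: "((\<lambda>t. sqrt \<bar>t\<bar>) has_real_derivative s * (inverse (sqrt \<bar>det (g x)\<bar>) / 2)) (at (det (g x)))"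
  proof -
    have "((\<lambda>t. sqrt (s * t)) has_real_derivative s * (inverse (sqrt \<bar>det (g x)\<bar>) / 2)) (at (det (g x)))"
      using nz by (auto intro!: derivative_eq_intros simp: s_def abs_sgn[of "det (g x)"] mult.commute zero_less_mult_iff sgn_if)
    moreover have "\<forall>\<^sub>F t in nhds (det (g x)). sqrt (s * t) = sqrt \<bar>t\<bar>"
    proof (rule eventually_mono[OF eventually_nhds_in_open[of "{t. 0 < s * t}"]])
      show "open {t. 0 < s * t}" by (intro open_Collect_less continuous_intros)
      show "det (g x) \<in> {t. 0 < s * t}" using nz by (auto simp: s_def sgn_if)
    qed (auto simp: s_def sgn_if split: if_splits)
    ultimately show ?thesis by (rule DERIV_cong_ev[THEN iffD1, OF refl _ refl, rotated])
  qed
  have "pd i (\<lambda>x. sqrt \<bar>det (g x)\<bar>) x = s * (inverse (sqrt \<bar>det (g x)\<bar>) / 2) * (det (g x) * dlogdet g i x)"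
    using pd_compose_real(2)[OF dd *, of i] pd_det[OF metric_onD(1) assms metric_onD(2) nz, of i] by simp
  also have "\<dots> = (\<bar>det (g x)\<bar> * inverse (sqrt \<bar>det (g x)\<bar>)) * dlogdet g i x / 2"
    by (simp add: s_def abs_sgn mult_ac)
  also have "\<bar>det (g x)\<bar> * inverse (sqrt \<bar>det (g x)\<bar>) = sqrt \<bar>det (g x)\<bar>"
    by (metis abs_ge_zero divide_inverse real_div_sqrt)
  finally show ?thesis .
qed

end

context
  fixes U :: "(real^'m) set" and g :: "real^'m \<Rightarrow> real^'m^'m"
  assumes g: "metric_on U g"
begin

lemma smooth_on_divg:
  assumes X: "\<And>i. smooth_on U (\<lambda>x. X x $ i)"
  shows "smooth_on U (divg g X)"
proof -
  have "divg g X = (\<lambda>x. \<Sum>i\<in>UNIV. pd i (\<lambda>y. X y $ i) x + (1 / 2) * (dlogdet g i x * X x $ i))"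
    by (simp add: divg_def fun_eq_iff)
  then show ?thesis using metric_onD(1)[OF g] smooth_on_dlogdet[OF g] X by (simp only: smooth_intros)
qed

text \<open>The difference of the integrands is the sum of the partial derivatives of the functions
  \<open>f * X\<^sub>i * sqrt \<bar>det g\<bar>\<close>, which are smooth on the whole space and have compact support.\<close>

lemma divergence_theorem:
  assumes X: "\<And>i. smooth_on U (\<lambda>x. X x $ i)" and f: "test_function U f"
  shows "(LINT x:U|lborel. f x * - divg g X x * sqrt \<bar>det (g x)\<bar>)
      = (LINT x:U|lborel. (grad_form f x \<bullet> X x) * sqrt \<bar>det (g x)\<bar>)"
proof -
  let ?\<sigma> = "\<lambda>x. sqrt \<bar>det (g x)\<bar>"
  have U: "open U" using g metric_onD by blast
  obtain K where K: "compact K" "K \<subseteq> U" "\<And>x. x \<notin> K \<Longrightarrow> f x = 0" and fs: "smooth_on UNIV f"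
    using f unfolding test_function_def by blast
  have fU: "smooth_on U f" using fs smooth_on_subset by blast
  note \<sigma> = smooth_on_volume[OF g]
  define F where "F i x = indicator U x * (f x * (X x $ i * ?\<sigma> x))" for i x
  have F0: "F i x = 0" if "x \<notin> K" for x i using K that by (simp add: F_def)
  have oK: "open (- K)" using K by (simp add: open_Compl compact_imp_closed)
  have FU: "smooth_on U (\<lambda>x. f x * (X x $ i * ?\<sigma> x))" for i
    by (intro smooth_intros U X fU \<sigma>)
  have zero_ext: "smooth_on UNIV h" if h: "smooth_on U h" "\<And>x. x \<notin> K \<Longrightarrow> h x = 0" for h :: "real^'m \<Rightarrow> real"
  proof (rule smooth_on_local)
    fix x
    show "\<exists>V. open V \<and> x \<in> V \<and> smooth_on V h"
    proof (cases "x \<in> U")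
      case False
      then have "x \<in> - K" using K by auto
      moreover have "smooth_on (- K) h"
        using smooth_on_cong[OF oK, of h "\<lambda>x. 0"] h(2) by (simp add: smooth_on_const)
      ultimately show ?thesis using oK by blast
    qed (use U h in blast)
  qed
  have Fs: "smooth_on UNIV (F i)" for i
    using FU[of i] smooth_on_cong[OF U, of "F i" "\<lambda>x. f x * (X x $ i * ?\<sigma> x)"] F0
    by (intro zero_ext) (auto simp: F_def)
  have pdF: "pd i (F i) x = f x * (pd i (\<lambda>y. X y $ i) x + dlogdet g i x * X x $ i / 2) * ?\<sigma> x
      + pd i f x * X x $ i * ?\<sigma> x" if x: "x \<in> U" for i x
  proof -
    note d = smooth_on_differentiable[OF _ x]
    have "pd i (F i) x = pd i (\<lambda>x. f x * (X x $ i * ?\<sigma> x)) x"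
      by (rule pd_cong[OF U x]) (simp add: F_def)
    also have "\<dots> = f x * (X x $ i * (?\<sigma> x * dlogdet g i x / 2) + pd i (\<lambda>y. X y $ i) x * ?\<sigma> x) + pd i f x * (X x $ i * ?\<sigma> x)"
      by (subst pd_mult, (intro d fU smooth_intros X \<sigma> U)+)
         (subst pd_mult, (intro d smooth_intros X \<sigma> U)+, simp add: pd_volume[OF g x])
    finally show ?thesis by (simp add: algebra_simps)
  qed
  have pdF0: "pd i (F i) x = 0" if "x \<notin> K" for i x
    using pd_cong[OF oK, of x "F i" "\<lambda>x. 0"] F0 that by simp
  have intF: "integrable lborel (pd i (F i))" for i
    using Fs smooth_on_pd smooth_on_continuous pdF0 by (intro integrable_compact_support[OF _ K(1)]) blast+
  let ?a = "\<lambda>x. indicator U x * (f x * divg g X x * ?\<sigma> x)"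
  let ?b = "\<lambda>x. indicator U x * ((grad_form f x \<bullet> X x) * ?\<sigma> x)"
  have ab: "?a x + ?b x = (\<Sum>i\<in>UNIV. pd i (F i) x)" for x
  proof (cases "x \<in> U")
    case True
    then show ?thesis
      by (simp add: pdF divg_def inner_vec_def grad_form_def sum.distrib sum_distrib_left sum_distrib_right algebra_simps)
  next
    case False
    then have "x \<notin> K" using K by auto
    then show ?thesis using False by (simp add: pdF0)
  qed
  have "integrable lborel ?a"
  proof (rule integrable_compact_support[OF _ K(1)])
    have "smooth_on U (\<lambda>x. f x * divg g X x * ?\<sigma> x)"
      by (intro smooth_intros U fU \<sigma> smooth_on_divg X)
    then have "smooth_on U ?a"
      by (rule smooth_on_cong[OF U, THEN iffD1, rotated]) simp
    then show "continuous_on UNIV ?a" using K(3) by (intro smooth_on_continuous zero_ext) auto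
  qed (use K in auto)
  moreover have "integrable lborel (\<lambda>x. ?a x + ?b x)" using intF ab by simp
  ultimately have "integrable lborel ?b" using Bochner_Integration.integrable_diff[of lborel "\<lambda>x. ?a x + ?b x" ?a] by simp
  have "(LINT x|lborel. ?a x) + (LINT x|lborel. ?b x) = (LINT x|lborel. (\<Sum>i\<in>UNIV. pd i (F i) x))"
    using \<open>integrable lborel ?a\<close> \<open>integrable lborel ?b\<close> by (subst Bochner_Integration.integral_add[symmetric]) (simp_all add: ab)
  also have "\<dots> = (\<Sum>i\<in>UNIV. (LINT x|lborel. pd i (F i) x))" using intF by (rule Bochner_Integration.integral_sum)
  also have "\<dots> = 0" by (simp add: integral_pd_compact_support[OF Fs K(1) F0])
  finally have "(LINT x|lborel. ?b x) = - (LINT x|lborel. ?a x)" by simp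
  moreover have "(LINT x|lborel. indicator U x * (f x * - divg g X x * ?\<sigma> x)) = - (LINT x|lborel. ?a x)"
    by (simp flip: Bochner_Integration.integral_minus)
  ultimately show ?thesis by (simp add: set_lebesgue_integral_def)
qed

text \<open>By the divergence theorem, minus the divergence satisfies the weak characterization of the codifferential.
  Since test functions separate continuous functions, any other choice agrees with it on \<open>U\<close>.\<close>

lemma codifferential_eq_divg:
  assumes \<omega>: "\<And>i. smooth_on U (\<lambda>x. \<omega> x $ i)" and x: "x \<in> U"
  shows "codifferential U g \<omega> x = - divg g (\<lambda>y. matrix_inv (g y) *v \<omega> y) x"
proof -
  let ?X = "\<lambda>y. matrix_inv (g y) *v \<omega> y"
  let ?\<sigma> = "\<lambda>x. sqrt \<bar>det (g x)\<bar>"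
  have U: "open U" using g metric_onD by blast
  have X: "smooth_on U (\<lambda>x. ?X x $ i)" for i
    by (simp add: matrix_vector_mult_def, intro smooth_intros U smooth_on_inverse_metric[OF g] \<omega>)
  have ex: "is_codifferential U g \<omega> (\<lambda>x. - divg g ?X x)"
    unfolding is_codifferential_def
    using divergence_theorem[OF X] smooth_on_minus[OF U smooth_on_divg[OF X]] by simp
  then have v: "is_codifferential U g \<omega> (codifferential U g \<omega>)"
    unfolding codifferential_def by (rule someI[of "is_codifferential U g \<omega>"])
  let ?v = "codifferential U g \<omega>"
  let ?w = "\<lambda>x. (?v x + divg g ?X x) * ?\<sigma> x"
  have sm: "smooth_on U ?v" "smooth_on U (divg g ?X)" "smooth_on U ?\<sigma>"
    using v smooth_on_divg[OF X] smooth_on_volume[OF g] by (auto simp: is_codifferential_def)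
  have "?w x = 0"
  proof (rule test_functions_separate[OF U _ _ x])
    show "continuous_on U ?w" by (intro smooth_on_continuous smooth_intros sm U)
    fix f assume f: "test_function U f"
    obtain K where K: "compact K" "K \<subseteq> U" "\<And>x. x \<notin> K \<Longrightarrow> f x = 0" and fs: "smooth_on UNIV f"
      using f unfolding test_function_def by blast
    have int: "set_integrable lborel U (\<lambda>x. f x * h x * ?\<sigma> x)" if h: "smooth_on U h" for h
    proof -
      have "continuous_on K (\<lambda>x. f x * h x * ?\<sigma> x)"
        using K(2) smooth_on_subset[OF fs, of U] smooth_on_subset
        by (intro smooth_on_continuous[THEN continuous_on_subset[OF _ K(2)]] smooth_intros sm U h) auto
      then have "integrable lborel (\<lambda>x. indicator K x *\<^sub>R (f x * h x * ?\<sigma> x))"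
        by (rule borel_integrable_compact[OF K(1)])
      moreover have "(\<lambda>x. indicator K x *\<^sub>R (f x * h x * ?\<sigma> x)) = (\<lambda>x. indicator U x *\<^sub>R (f x * h x * ?\<sigma> x))"
        using K by (force simp: fun_eq_iff indicator_def)
      ultimately show ?thesis by (simp add: set_integrable_def)
    qed
    have "(LINT x:U|lborel. f x * ?v x * ?\<sigma> x) = (LINT x:U|lborel. f x * - divg g ?X x * ?\<sigma> x)"
      using v ex f unfolding is_codifferential_def by simp
    moreover have "(LINT x:U|lborel. f x * ?w x) = (LINT x:U|lborel. f x * ?v x * ?\<sigma> x - f x * - divg g ?X x * ?\<sigma> x)"
      by (simp add: algebra_simps)
    ultimately show "(LINT x:U|lborel. f x * ?w x) = 0"
      using set_integral_diff(2)[OF int[OF sm(1)] int[OF smooth_on_minus[OF U sm(2)]]] by linarith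
  qed
  then show ?thesis using metric_onD(3)[OF g x] by simp
qed

end


section \<open>Matrix-valued functions\<close>

lemma matrix_diff_ldistrib: "(A :: real^'n^'m) ** (B - C) = A ** B - A ** (C :: real^'k^'n)"
  by (simp add: matrix_matrix_mult_def vec_eq_iff algebra_simps sum_subtractf)

lemma matrix_diff_rdistrib: "((A :: real^'n^'m) - B) ** C = A ** C - B ** (C :: real^'k^'n)"
  by (simp add: matrix_matrix_mult_def vec_eq_iff algebra_simps sum_subtractf)

lemma matrix_add_rdistrib: "((A :: real^'n^'m) + B) ** C = A ** C + B ** (C :: real^'k^'n)"
  by (simp add: matrix_matrix_mult_def vec_eq_iff algebra_simps sum.distrib)

lemma matrix_minus_left: "(- (A :: real^'n^'m)) ** C = - (A ** (C :: real^'k^'n))"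
  by (simp add: matrix_matrix_mult_def vec_eq_iff sum_negf)

lemma matrix_minus_right: "(A :: real^'n^'m) ** (- C) = - (A ** (C :: real^'k^'n))"
  by (simp add: matrix_matrix_mult_def vec_eq_iff sum_negf)

lemma matrix_scaleR_left: "(c *\<^sub>R (A :: real^'n^'m)) ** C = c *\<^sub>R (A ** (C :: real^'k^'n))"
  by (simp add: matrix_matrix_mult_def vec_eq_iff sum_distrib_left mult.assoc)

lemma matrix_scaleR_right: "(A :: real^'n^'m) ** (c *\<^sub>R C) = c *\<^sub>R (A ** (C :: real^'k^'n))"
  by (simp add: matrix_matrix_mult_def vec_eq_iff sum_distrib_left mult_ac)

lemma matrix_sum_right: "(C :: real^'n^'m) ** (\<Sum>a\<in>I. (A a :: real^'k^'n)) = (\<Sum>a\<in>I. C ** A a)"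
  by (induction I rule: infinite_finite_induct) (simp_all add: matrix_add_ldistrib)

lemmas matrix_algebra = matrix_diff_ldistrib matrix_diff_rdistrib matrix_add_ldistrib matrix_add_rdistrib
  matrix_minus_left matrix_minus_right matrix_scaleR_left matrix_scaleR_right matrix_mul_assoc

lemma transpose_add: "transpose (A + B) = transpose A + transpose (B :: real^'n^'m)"
  and transpose_diff: "transpose (A - B) = transpose A - transpose (B :: real^'n^'m)"
  and transpose_uminus: "transpose (- A) = - transpose (A :: real^'n^'m)"
  and transpose_scale: "transpose (c *\<^sub>R A) = c *\<^sub>R transpose (A :: real^'n^'m)"
  by (simp_all add: transpose_def vec_eq_iff)

lemmas transpose_algebra = transpose_add transpose_diff transpose_uminus transpose_scale matrix_transpose_mul

lemma trace_scale: "trace (c *\<^sub>R (A :: real^'n^'n)) = c * trace A"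
  by (simp add: trace_def sum_distrib_left)

lemma trace_uminus: "trace (- (A :: real^'n^'n)) = - trace A"
  by (simp add: trace_def sum_negf)

lemma trace_sum: "trace (\<Sum>a\<in>I. (A a :: real^'n^'n)) = (\<Sum>a\<in>I. trace (A a))"
  by (induction I rule: infinite_finite_induct) (simp_all add: trace_add trace_0[unfolded mat_0])

lemma trace_mult: "trace ((A :: real^'n^'n) ** B) = (\<Sum>i\<in>UNIV. \<Sum>j\<in>UNIV. A $ i $ j * B $ j $ i)"
  by (simp add: trace_def matrix_matrix_mult_def)

lemma trace_cyclic: "trace ((A :: real^'n^'n) ** B ** C) = trace (B ** C ** A)"
  by (metis matrix_mul_assoc trace_mul_sym)

text \<open>With the product rule for matrices of functions, the identities between tensors with two free indices become
  calculations in the non-commutative algebra of matrices, without sums over indices.\<close>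

definition mpd :: "'m \<Rightarrow> (real^'m \<Rightarrow> real^'n^'k) \<Rightarrow> real^'m \<Rightarrow> real^'n^'k" where
  "mpd i A x = (\<chi> a b. pd i (\<lambda>y. A y $ a $ b) x)"

definition smooth_mat :: "(real^'m) set \<Rightarrow> (real^'m \<Rightarrow> real^'n^'k) \<Rightarrow> bool" where
  "smooth_mat U A \<longleftrightarrow> (\<forall>a b. smooth_on U (\<lambda>x. A x $ a $ b))"

lemma mpd_component: "mpd i A x $ a $ b = pd i (\<lambda>y. A y $ a $ b) x"
  by (simp add: mpd_def)

lemma smooth_matD: "smooth_mat U A \<Longrightarrow> smooth_on U (\<lambda>x. A x $ a $ b)"
  by (simp add: smooth_mat_def)

lemma smooth_mat_component_differentiable:
  "smooth_mat U A \<Longrightarrow> x \<in> U \<Longrightarrow> (\<lambda>y. A y $ a $ b) differentiable (at x)"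
  using smooth_on_differentiable smooth_matD by blast

lemma mpd_cong:
  assumes "open U" "x \<in> U" "\<And>y. y \<in> U \<Longrightarrow> A y = B y"
  shows "mpd i A x = mpd i B x"
  unfolding mpd_def vec_eq_iff by (auto intro!: pd_cong[OF assms(1,2)] simp: assms(3))

lemma smooth_mat_cong:
  assumes "open U" "\<And>y. y \<in> U \<Longrightarrow> A y = B y" "smooth_mat U A"
  shows "smooth_mat U B"
  unfolding smooth_mat_def
proof (intro allI)
  fix a b
  show "smooth_on U (\<lambda>x. B x $ a $ b)"
    using assms by (intro smooth_on_cong[OF assms(1), THEN iffD1, OF _ smooth_matD[OF assms(3)]]) auto
qed

lemma smooth_mat_mpd: "smooth_mat U A \<Longrightarrow> smooth_mat U (mpd i A)"
  by (simp add: smooth_mat_def mpd_def smooth_intros)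

context
  fixes U :: "(real^'m) set"
  assumes U: "open U"
begin

lemma smooth_mat_const: "smooth_mat U (\<lambda>x. M)"
  by (simp add: smooth_mat_def smooth_on_const)

lemma smooth_mat_add: "smooth_mat U A \<Longrightarrow> smooth_mat U B \<Longrightarrow> smooth_mat U (\<lambda>x. A x + B x)"
  by (simp add: smooth_mat_def smooth_on_add U)

lemma smooth_mat_diff: "smooth_mat U A \<Longrightarrow> smooth_mat U B \<Longrightarrow> smooth_mat U (\<lambda>x. A x - B x)"
  by (simp add: smooth_mat_def smooth_on_diff U)

lemma smooth_mat_uminus: "smooth_mat U A \<Longrightarrow> smooth_mat U (\<lambda>x. - A x)"
  by (simp add: smooth_mat_def smooth_on_minus U)

lemma smooth_mat_scale: "smooth_on U f \<Longrightarrow> smooth_mat U A \<Longrightarrow> smooth_mat U (\<lambda>x. f x *\<^sub>R A x)"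
  by (simp add: smooth_mat_def smooth_on_mult U)

lemma smooth_mat_transpose: "smooth_mat U A \<Longrightarrow> smooth_mat U (\<lambda>x. transpose (A x))"
  by (simp add: smooth_mat_def transpose_def)

lemma smooth_mat_mult: "smooth_mat U A \<Longrightarrow> smooth_mat U B \<Longrightarrow> smooth_mat U (\<lambda>x. A x ** B x)"
  unfolding smooth_mat_def matrix_matrix_mult_def vec_lambda_beta by (intro allI smooth_intros U) auto

lemma smooth_mat_trace: "smooth_mat U A \<Longrightarrow> smooth_on U (\<lambda>x. trace (A x))"
  unfolding trace_def by (intro smooth_intros U smooth_matD)

end

lemmas smooth_mat_intros = smooth_mat_const smooth_mat_add smooth_mat_diff smooth_mat_uminus
  smooth_mat_scale smooth_mat_transpose smooth_mat_mult smooth_mat_mpd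

lemma mpd_const: "mpd i (\<lambda>x. M) x = 0"
  by (simp add: mpd_def vec_eq_iff)

lemma mpd_transpose: "mpd i (\<lambda>x. transpose (A x)) x = transpose (mpd i A x)"
  by (simp add: mpd_def vec_eq_iff transpose_def)

context
  fixes U :: "(real^'m) set" and x :: "real^'m"
  assumes x: "x \<in> U"
begin

lemma mpd_diff: "smooth_mat U A \<Longrightarrow> smooth_mat U B \<Longrightarrow> mpd i (\<lambda>x. A x - B x) x = mpd i A x - mpd i B x"
  by (simp add: mpd_def vec_eq_iff pd_diff smooth_mat_component_differentiable[OF _ x])

lemma mpd_uminus: "smooth_mat U A \<Longrightarrow> mpd i (\<lambda>x. - A x) x = - mpd i A x"
  by (simp add: mpd_def vec_eq_iff pd_minus smooth_mat_component_differentiable[OF _ x])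

lemma mpd_cmult: "smooth_mat U A \<Longrightarrow> mpd i (\<lambda>x. c *\<^sub>R A x) x = c *\<^sub>R mpd i A x"
  by (simp add: mpd_def vec_eq_iff pd_cmult smooth_mat_component_differentiable[OF _ x])

lemma mpd_mult:
  assumes U: "open U" and A: "smooth_mat U A" and B: "smooth_mat U B"
  shows "mpd i (\<lambda>x. A x ** B x) x = A x ** mpd i B x + mpd i A x ** B x"
proof -
  have "pd i (\<lambda>x. A x $ a $ c * B x $ c $ b) x
      = A x $ a $ c * pd i (\<lambda>x. B x $ c $ b) x + pd i (\<lambda>x. A x $ a $ c) x * B x $ c $ b" for a b c
    by (intro pd_mult smooth_mat_component_differentiable[OF _ x] A B)
  moreover have "(\<lambda>x. A x $ a $ c * B x $ c $ b) differentiable (at x)" for a b c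
    by (intro smooth_on_differentiable[OF _ x] smooth_intros U smooth_matD A B)
  ultimately show ?thesis
    by (simp add: mpd_def vec_eq_iff matrix_matrix_mult_def pd_sum sum.distrib)
qed

lemma pd_trace:
  assumes "smooth_mat U A" shows "pd i (\<lambda>x. trace (A x)) x = trace (mpd i A x)"
  unfolding trace_def mpd_def
  by (simp add: pd_sum smooth_mat_component_differentiable[OF assms x])

lemma mpd_commute:
  assumes U: "open U" and A: "smooth_mat U A"
  shows "mpd i (mpd j A) x = mpd j (mpd i A) x"
  by (simp add: mpd_def vec_eq_iff pd_commute[OF U smooth_matD[OF A] x])

end

lemma metric_on_smooth_mat: "metric_on U g \<Longrightarrow> smooth_mat U g"
  by (simp add: metric_on_def smooth_mat_def)

lemma metric_on_inverse_smooth_mat: "metric_on U g \<Longrightarrow> smooth_mat U (\<lambda>x. matrix_inv (g x))"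
  by (simp add: smooth_mat_def smooth_on_inverse_metric)

lemma metric_on_symmetric: "metric_on U g \<Longrightarrow> x \<in> U \<Longrightarrow> transpose (g x) = g x"
  by (simp add: metric_on_def vec_eq_iff transpose_def)

lemma metric_on_inverse:
  assumes "metric_on U g" "x \<in> U"
  shows "g x ** matrix_inv (g x) = mat 1" "matrix_inv (g x) ** g x = mat 1"
  using invertible_matrix_inv metric_onD(3)[OF assms] by auto

lemma metric_on_inverse_symmetric:
  assumes "metric_on U g" "x \<in> U"
  shows "transpose (matrix_inv (g x)) = matrix_inv (g x)"
proof -
  have "g x ** transpose (matrix_inv (g x)) = mat 1"
    using metric_on_inverse(2)[OF assms] metric_on_symmetric[OF assms]
    by (metis matrix_transpose_mul transpose_mat)
  then show ?thesis using matrix_inv_unique(1) by metis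
qed

lemma mpd_matrix_inv:
  assumes g: "metric_on U g" and x: "x \<in> U"
  shows "mpd i (\<lambda>y. matrix_inv (g y)) x = - (matrix_inv (g x) ** mpd i g x ** matrix_inv (g x))"
proof -
  let ?h = "\<lambda>y. matrix_inv (g y)"
  have "mpd i (\<lambda>y. g y ** ?h y) x = mpd i (\<lambda>y. mat 1) x"
    by (rule mpd_cong[OF metric_onD(1)[OF g] x]) (simp add: metric_on_inverse[OF g])
  then have "g x ** mpd i ?h x + mpd i g x ** ?h x = 0"
    by (simp add: mpd_const mpd_mult[OF x metric_onD(1)[OF g] metric_on_smooth_mat[OF g] metric_on_inverse_smooth_mat[OF g]])
  then have "?h x ** (g x ** mpd i ?h x + mpd i g x ** ?h x) = 0" by simp
  then have "(?h x ** g x) ** mpd i ?h x + ?h x ** mpd i g x ** ?h x = 0"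
    by (simp only: matrix_add_ldistrib matrix_mul_assoc)
  then show ?thesis by (simp add: metric_on_inverse[OF g x] eq_neg_iff_add_eq_0)
qed

lemma dlogdet_eq_trace: "dlogdet g i x = trace (matrix_inv (g x) ** mpd i g x)"
  by (simp add: dlogdet_def trace_mult mpd_def)


section \<open>The Levi-Civita connection and its curvature\<close>

text \<open>The connection matrices are \<open>\<Gamma>\<^sub>k = (\<Gamma>\<^sup>m\<^sub>k\<^sub>i)\<close> with row index \<open>m\<close>. In terms of them, \<open>covm\<close> is the covariant
  derivative of a 2-tensor, and \<open>curvm\<close> the curvature with its first two indices as those of a matrix.\<close>

definition conn :: "(real^'n \<Rightarrow> real^'n^'n) \<Rightarrow> 'n \<Rightarrow> real^'n \<Rightarrow> real^'n^'n" where
  "conn g k x = (\<chi> m i. christoffel g m k i x)"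

definition covm :: "(real^'n \<Rightarrow> real^'n^'n) \<Rightarrow> (real^'n \<Rightarrow> real^'n^'n) \<Rightarrow> 'n \<Rightarrow> real^'n \<Rightarrow> real^'n^'n" where
  "covm g S k x = mpd k S x - transpose (conn g k x) ** S x - S x ** conn g k x"

definition curvm :: "(real^'n \<Rightarrow> real^'n^'n) \<Rightarrow> 'n \<Rightarrow> 'n \<Rightarrow> real^'n \<Rightarrow> real^'n^'n" where
  "curvm g k l x = mpd l (conn g k) x - mpd k (conn g l) x + conn g l x ** conn g k x - conn g k x ** conn g l x"

lemma cov1_eq_covm: "cov1 g S k i j x = covm g S k x $ i $ j"
  by (simp add: cov1_def covm_def conn_def mpd_def matrix_matrix_mult_def transpose_def sum.distrib mult.commute)

lemma cov1_fun: "cov1 g S k i j = (\<lambda>x. covm g S k x $ i $ j)"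
  by (simp add: cov1_eq_covm fun_eq_iff)

lemma cov2_eq_covm:
  "cov2 g S l k i j x = (mpd l (covm g S k) x - transpose (conn g l x) ** covm g S k x - covm g S k x ** conn g l x) $ i $ j
     - (\<Sum>m\<in>UNIV. conn g l x $ m $ k * covm g S m x $ i $ j)"
  by (simp add: cov2_def cov1_fun conn_def mpd_def matrix_matrix_mult_def transpose_def sum.distrib mult.commute)

lemma riemann_up_eq_curvm: "riemann_up g i j k l x = curvm g k l x $ i $ j"
  by (simp add: riemann_up_def curvm_def conn_def mpd_def matrix_matrix_mult_def sum_subtractf)

lemma riemann_eq_curvm: "riemann g i j k l x = (g x ** curvm g k l x) $ i $ j"
  by (simp add: riemann_def riemann_up_eq_curvm matrix_matrix_mult_def)

lemma curvm_antisym: "curvm g k l x = - curvm g l k x"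
  by (simp add: curvm_def)

context
  fixes V :: "(real^'n) set" and g :: "real^'n \<Rightarrow> real^'n^'n"
  assumes g: "metric_on V g"
begin

private lemma openV_conn: "open V"
  using g by (rule metric_onD)

private lemmas smooth_g_conn = metric_on_smooth_mat[OF g]
private lemmas smooth_ginv_conn = metric_on_inverse_smooth_mat[OF g]

lemma smooth_on_christoffel: "smooth_on V (christoffel g m k i)"
proof -
  have *: "christoffel g m k i = (\<lambda>x. \<Sum>l\<in>UNIV. (1/2) * (matrix_inv (g x) $ m $ l *
     (pd k (\<lambda>y. g y $ i $ l) x + pd i (\<lambda>y. g y $ k $ l) x - pd l (\<lambda>y. g y $ k $ i) x)))"
    by (simp add: christoffel_def fun_eq_iff sum_divide_distrib)
  show ?thesis unfolding *
    by (intro smooth_intros openV_conn smooth_matD[OF smooth_g_conn] smooth_matD[OF smooth_ginv_conn])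
qed

lemma smooth_mat_conn: "smooth_mat V (conn g k)"
  by (simp add: smooth_mat_def conn_def smooth_on_christoffel)

lemma pd_metric_sym: "x \<in> V \<Longrightarrow> pd l (\<lambda>y. g y $ i $ j) x = pd l (\<lambda>y. g y $ j $ i) x"
  by (rule pd_cong[OF openV_conn]) (auto simp: metric_onD(4)[OF g])

lemma christoffel_sym: "x \<in> V \<Longrightarrow> christoffel g m k i x = christoffel g m i k x"
  unfolding christoffel_def by (intro arg_cong[of _ _ "\<lambda>t. t / 2"] sum.cong) (auto simp: pd_metric_sym[of x _ k i])

lemma conn_sym: "x \<in> V \<Longrightarrow> conn g k x $ m $ i = conn g i x $ m $ k"
  by (simp add: conn_def christoffel_sym)

lemma metric_conn:
  assumes "x \<in> V"
  shows "(g x ** conn g m x) $ a $ b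
    = (pd m (\<lambda>y. g y $ b $ a) x + pd b (\<lambda>y. g y $ m $ a) x - pd a (\<lambda>y. g y $ m $ b) x) / 2"
proof -
  let ?X = "\<chi> l b. (pd m (\<lambda>y. g y $ b $ l) x + pd b (\<lambda>y. g y $ m $ l) x - pd l (\<lambda>y. g y $ m $ b) x) / 2"
  have "conn g m x = matrix_inv (g x) ** ?X"
    by (simp add: vec_eq_iff conn_def christoffel_def matrix_matrix_mult_def sum_divide_distrib)
  then have "g x ** conn g m x = ?X"
    by (simp add: matrix_mul_assoc metric_on_inverse[OF g assms])
  then show ?thesis by simp
qed

lemma metric_compatible:
  assumes x: "x \<in> V"
  shows "mpd m g x = transpose (conn g m x) ** g x + g x ** conn g m x"
proof -
  have "transpose (conn g m x) ** g x = transpose (g x ** conn g m x)"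
    by (simp add: matrix_transpose_mul metric_on_symmetric[OF g x])
  then have "(transpose (conn g m x) ** g x) $ a $ b = (g x ** conn g m x) $ b $ a" for a b
    by (simp add: transpose_def)
  then have "(transpose (conn g m x) ** g x) $ a $ b
      = (pd m (\<lambda>y. g y $ a $ b) x + pd a (\<lambda>y. g y $ m $ b) x - pd b (\<lambda>y. g y $ m $ a) x) / 2" for a b
    by (simp only: metric_conn[OF x])
  then have "mpd m g x $ a $ b = (transpose (conn g m x) ** g x + g x ** conn g m x) $ a $ b" for a b
    using pd_metric_sym[OF x, of m a b] by (simp only: metric_conn[OF x] mpd_def vector_add_component vec_lambda_beta)
      (simp add: field_simps)
  then show ?thesis by (simp add: vec_eq_iff)
qed

lemma inverse_metric_compatible:
  assumes x: "x \<in> V"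
  shows "mpd m (\<lambda>y. matrix_inv (g y)) x
    = - (matrix_inv (g x) ** transpose (conn g m x)) - conn g m x ** matrix_inv (g x)"
proof -
  let ?h = "matrix_inv (g x)"
  have "mpd m (\<lambda>y. matrix_inv (g y)) x = - (?h ** transpose (conn g m x) ** (g x ** ?h)) - (?h ** g x) ** conn g m x ** ?h"
    by (simp add: mpd_matrix_inv[OF g x] metric_compatible[OF x] matrix_algebra)
  then show ?thesis by (simp add: metric_on_inverse[OF g x])
qed

text \<open>The inverse metric is parallel: the connection terms in its derivative are those that complete \<open>\<partial>A\<close> to \<open>\<nabla>A\<close>,
  up to a cyclic permutation under the trace.\<close>

lemma pd_contraction:
  assumes x: "x \<in> V" and A: "smooth_mat V A"
  shows "pd m (\<lambda>y. trace (matrix_inv (g y) ** A y)) x = trace (matrix_inv (g x) ** covm g A m x)"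
proof -
  let ?h = "matrix_inv (g x)" and ?G = "conn g m x"
  have "pd m (\<lambda>y. trace (matrix_inv (g y) ** A y)) x
      = trace (?h ** mpd m A x - ?h ** transpose ?G ** A x - ?G ** ?h ** A x)"
    by (simp add: pd_trace[OF x smooth_mat_mult[OF openV_conn smooth_ginv_conn A]] mpd_mult[OF x openV_conn smooth_ginv_conn A]
        inverse_metric_compatible[OF x] matrix_algebra add_diff_eq)
  also have "trace (?G ** ?h ** A x) = trace (?h ** A x ** ?G)"
    by (rule trace_cyclic)
  then have "trace (?h ** mpd m A x - ?h ** transpose ?G ** A x - ?G ** ?h ** A x)
      = trace (?h ** covm g A m x)"
    by (simp add: covm_def matrix_algebra trace_sub)
  finally show ?thesis .
qed

lemma smooth_mat_covm: "smooth_mat V S \<Longrightarrow> smooth_mat V (covm g S k)"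
  unfolding covm_def[abs_def] by (intro smooth_mat_intros openV_conn smooth_mat_conn)

text \<open>The Ricci identity for 2-tensors. The terms with a first derivative of \<open>S\<close> are symmetric in \<open>k\<close> and \<open>l\<close>, and so is
  the term with the derivative index, as the connection is torsion-free; the rest is the curvature matrix
  acting on either index.\<close>

lemma ricci_identity:
  assumes x: "x \<in> V" and S: "smooth_mat V S"
  shows "cov2 g S l k i j x - cov2 g S k l i j x
    = - (transpose (curvm g k l x) ** S x + S x ** curvm g k l x) $ i $ j"
proof -
  note C = smooth_mat_conn
  have m: "mpd l (covm g S k) x = mpd l (mpd k S) x
      - (transpose (conn g k x) ** mpd l S x + transpose (mpd l (conn g k) x) ** S x)
      - (S x ** mpd l (conn g k) x + mpd l S x ** conn g k x)" for k l
    unfolding covm_def[abs_def]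
    by (subst mpd_diff[OF x] mpd_mult[OF x openV_conn] mpd_transpose, (intro smooth_mat_intros openV_conn C S)+)+ (simp add: mpd_transpose)
  have t: "conn g l x $ m $ k = conn g k x $ m $ l" for m by (rule conn_sym[OF x])
  show ?thesis
    unfolding cov2_eq_covm t m curvm_def covm_def
    by (simp add: mpd_commute[OF x openV_conn S, of k l] matrix_algebra transpose_algebra)
qed

lemma covm_metric: "x \<in> V \<Longrightarrow> covm g g k x = 0"
  by (simp add: covm_def metric_compatible)

text \<open>The Ricci identity for the metric itself, whose second covariant derivatives vanish.\<close>

lemma riemann_antisym12:
  assumes x: "x \<in> V"
  shows "riemann g i j k l x = - riemann g j i k l x"
proof -
  have m: "mpd l (covm g g k) x = 0" for k l
    using mpd_cong[OF openV_conn x, of "covm g g k" "\<lambda>x. 0" l] by (simp add: covm_metric mpd_const)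
  have "cov2 g g l k i j x = 0" for l k i j
    by (simp add: cov2_eq_covm covm_metric[OF x] m)
  then have "(transpose (curvm g k l x) ** g x + g x ** curvm g k l x) $ i $ j = 0"
    using ricci_identity[OF x smooth_g_conn, of l k i j] by simp
  moreover have "transpose (curvm g k l x) ** g x = transpose (g x ** curvm g k l x)"
    by (simp add: matrix_transpose_mul metric_on_symmetric[OF g x])
  ultimately show ?thesis by (simp add: riemann_eq_curvm transpose_def)
qed

lemma riemann_antisym34: "riemann g i j k l x = - riemann g i j l k x"
  unfolding riemann_eq_curvm by (subst curvm_antisym) (simp add: matrix_minus_right)

lemma riemann_up_bianchi:
  assumes x: "x \<in> V"
  shows "riemann_up g i j k l x + riemann_up g i k l j x + riemann_up g i l j k x = 0"
proof -
  have d: "pd a (christoffel g i b c) x = pd a (christoffel g i c b) x" for a b c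
    by (rule pd_cong[OF openV_conn x]) (rule christoffel_sym)
  show ?thesis
    unfolding riemann_up_def
    by (simp add: d[of _ j] d[of _ l k] christoffel_sym[OF x, of _ j] christoffel_sym[OF x, of _ l k]
        sum_subtractf)
qed

lemma riemann_bianchi:
  assumes x: "x \<in> V"
  shows "riemann g i j k l x + riemann g i k l j x + riemann g i l j k x = 0"
proof -
  have "riemann g i j k l x + riemann g i k l j x + riemann g i l j k x
     = (\<Sum>m\<in>UNIV. g x $ i $ m * (riemann_up g m j k l x + riemann_up g m k l j x + riemann_up g m l j k x))"
    by (simp add: riemann_def sum.distrib algebra_simps)
  then show ?thesis by (simp add: riemann_up_bianchi[OF x])
qed

text \<open>The four cyclic identities that start with the cyclic permutations of \<open>i, j, k, l\<close>, combined with the two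
  antisymmetries.\<close>

lemma riemann_pair_sym:
  assumes x: "x \<in> V"
  shows "riemann g i j k l x = riemann g k l i j x"
  using riemann_bianchi[OF x, of i j k l] riemann_bianchi[OF x, of j k l i]
    riemann_bianchi[OF x, of k l i j] riemann_bianchi[OF x, of l i j k]
    riemann_antisym12[OF x, of i j k l] riemann_antisym12[OF x, of k l i j]
    riemann_antisym12[OF x, of i k l j] riemann_antisym12[OF x, of j l i k]
    riemann_antisym12[OF x, of i l j k] riemann_antisym12[OF x, of j k l i]
    riemann_antisym34[of i j k l x] riemann_antisym34[of k l i j x]
    riemann_antisym34[of k i l j x] riemann_antisym34[of l j i k x] riemann_antisym34[of i k l j x]
    riemann_antisym34[of l i j k x] riemann_antisym34[of k j l i x] riemann_antisym34[of j l k i x]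
    riemann_antisym34[of i l j k x] riemann_antisym34[of j k l i x] riemann_antisym34[of j i k l x]
    riemann_antisym34[of j l i k x] riemann_antisym34[of l k i j x]
  by linarith

lemma ricci_eq_contraction:
  assumes x: "x \<in> V"
  shows "(\<Sum>i\<in>UNIV. \<Sum>l\<in>UNIV. matrix_inv (g x) $ i $ l * riemann g l p j i x) = ricci g x $ p $ j"
proof -
  have "(\<Sum>l\<in>UNIV. matrix_inv (g x) $ i $ l * riemann g l p j i x) = riemann_up g i p j i x" for i
  proof -
    have "(\<Sum>l\<in>UNIV. matrix_inv (g x) $ i $ l * riemann g l p j i x)
        = (matrix_inv (g x) ** (g x ** curvm g j i x)) $ i $ p"
      by (simp add: riemann_eq_curvm matrix_matrix_mult_def)
    then show ?thesis
      by (simp add: matrix_mul_assoc metric_on_inverse[OF g x] riemann_up_eq_curvm)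
  qed
  then show ?thesis by (simp add: ricci_def)
qed

end


section \<open>The first variation of the Ricci tensor in the direction of the Schouten tensor\<close>

lemma sum_swap3: "(\<Sum>i\<in>A. \<Sum>j\<in>B. \<Sum>k\<in>C. f i j k) = (\<Sum>k\<in>C. \<Sum>i\<in>A. \<Sum>j\<in>B. f i j k)"
proof -
  have "(\<Sum>i\<in>A. \<Sum>j\<in>B. \<Sum>k\<in>C. f i j k) = (\<Sum>i\<in>A. \<Sum>k\<in>C. \<Sum>j\<in>B. f i j k)"
    by (intro sum.cong refl sum.swap)
  also have "\<dots> = (\<Sum>k\<in>C. \<Sum>i\<in>A. \<Sum>j\<in>B. f i j k)" by (rule sum.swap)
  finally show ?thesis .
qed

lemma scal_eq_trace:
  assumes "metric_on V g" "x \<in> V"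
  shows "scal g x = trace (matrix_inv (g x) ** ricci g x)"
proof -
  have "scal g x = trace (transpose (matrix_inv (g x)) ** ricci g x)"
    by (simp add: scal_def trace_mult transpose_def) (rule sum.swap)
  then show ?thesis by (simp add: metric_on_inverse_symmetric[OF assms])
qed

lemma matrix_mult_component: "(A ** B) $ i $ j = (\<Sum>k\<in>UNIV. A $ i $ k * B $ k $ j)"
  by (simp add: matrix_matrix_mult_def)

lemma transpose_component: "transpose A $ i $ j = A $ j $ i"
  by (simp add: transpose_def)

context
  fixes V :: "(real^'n) set" and g :: "real^'n \<Rightarrow> real^'n^'n"
  assumes g: "metric_on V g"
begin

private lemma openV_bach: "open V"
  using g by (rule metric_onD)

text \<open>The identity \<open>\<nabla>\<^sup>l S\<^sub>k\<^sub>l = \<nabla>\<^sub>k J\<close> can be differentiated covariantly, as contractions commute with covariant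
  derivatives. The connection term of the free index \<open>k\<close> is what turns \<open>\<partial>\<^sub>j\<partial>\<^sub>k J\<close> into the Hessian.\<close>

lemma contraction_cov2_hessian:
  assumes S: "smooth_mat V S" and x: "x \<in> V"
    and div: "\<And>x k. x \<in> V \<Longrightarrow> (\<Sum>i\<in>UNIV. \<Sum>l\<in>UNIV. matrix_inv (g x) $ i $ l * cov1 g S i k l x) = pd k J x"
  shows "(\<Sum>i\<in>UNIV. \<Sum>l\<in>UNIV. matrix_inv (g x) $ i $ l * cov2 g S j i k l x)
    = pd j (pd k J) x - (\<Sum>m\<in>UNIV. christoffel g m j k x * pd m J x)"
proof -
  let ?A = "\<lambda>k x. \<chi> l i. cov1 g S i k l x"
  let ?h = "matrix_inv (g x)"
  have sA: "smooth_mat V (?A k)" for k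
    using smooth_mat_covm[OF g S] by (simp add: smooth_mat_def cov1_eq_covm)
  have tr: "trace (matrix_inv (g x) ** ?A k x) = pd k J x" if "x \<in> V" for x k
    using div[OF that, of k] by (simp add: trace_mult)
  have "pd j (pd k J) x = pd j (\<lambda>y. trace (matrix_inv (g y) ** ?A k y)) x"
    by (rule pd_cong[OF openV_bach x]) (simp only: tr)
  also have "\<dots> = trace (?h ** covm g (?A k) j x)"
    by (rule pd_contraction[OF g x sA])
  also have "covm g (?A k) j x = (\<chi> l i. cov2 g S j i k l x) + (\<Sum>m\<in>UNIV. christoffel g m j k x *\<^sub>R ?A m x)"
    by (simp add: vec_eq_iff covm_def mpd_def conn_def cov2_def matrix_matrix_mult_def transpose_def sum.distrib algebra_simps)
  also have "trace (?h ** \<dots>) = trace (?h ** (\<chi> l i. cov2 g S j i k l x))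
      + (\<Sum>m\<in>UNIV. christoffel g m j k x * trace (?h ** ?A m x))"
    by (simp add: matrix_algebra matrix_sum_right trace_add trace_sum trace_scale)
  also have "\<dots> = (\<Sum>i\<in>UNIV. \<Sum>l\<in>UNIV. ?h $ i $ l * cov2 g S j i k l x)
      + (\<Sum>m\<in>UNIV. christoffel g m j k x * pd m J x)"
    by (simp only: tr[OF x]) (simp add: trace_mult)
  finally show ?thesis by simp
qed

lemma cov_sym:
  assumes S: "\<And>x. x \<in> V \<Longrightarrow> transpose (S x) = S x" and x: "x \<in> V"
  shows "transpose (covm g S k x) = covm g S k x" "cov1 g S k i j x = cov1 g S k j i x"
    "cov2 g S l k i j x = cov2 g S l k j i x"
proof -
  have m: "transpose (covm g S k x) = covm g S k x" if "x \<in> V" for x k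
  proof -
    have "mpd k (\<lambda>y. transpose (S y)) x = mpd k S x"
      by (rule mpd_cong[OF openV_bach that]) (rule S)
    then have "transpose (mpd k S x) = mpd k S x" by (simp add: mpd_transpose)
    then show ?thesis by (simp add: covm_def transpose_algebra S[OF that])
  qed
  then show "transpose (covm g S k x) = covm g S k x" using x .
  have 1: "cov1 g S k i j x = cov1 g S k j i x" if "x \<in> V" for x k i j
    using m[OF that] unfolding cov1_eq_covm by (metis transpose_component)
  then show "cov1 g S k i j x = cov1 g S k j i x" using x .
  have "pd l (cov1 g S k i j) x = pd l (cov1 g S k j i) x"
    by (rule pd_cong[OF openV_bach x]) (rule 1)
  then show "cov2 g S l k i j x = cov2 g S l k j i x"
    unfolding cov2_def
  proof (intro arg_cong2[where f = "(-)"] sum.cong refl)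
    fix m
    show "christoffel g m l k x * cov1 g S m i j x + christoffel g m l i x * cov1 g S k m j x
        + christoffel g m l j x * cov1 g S k i m x
      = christoffel g m l k x * cov1 g S m j i x + christoffel g m l j x * cov1 g S k m i x
        + christoffel g m l i x * cov1 g S k j m x"
      unfolding 1[OF x, of m i j] 1[OF x, of k m j] 1[OF x, of k i m] by simp
  qed
qed

text \<open>Commuting the covariant derivatives in \<open>\<nabla>\<^sup>l\<nabla>\<^sub>j S\<^sub>k\<^sub>l\<close> produces a Ricci term and a curvature term.\<close>

lemma contracted_ricci_identity:
  assumes S: "smooth_mat V S" and sym: "transpose (S x) = S x" and x: "x \<in> V"
  defines "h \<equiv> matrix_inv (g x)"
  shows "(\<Sum>i\<in>UNIV. \<Sum>l\<in>UNIV. h $ i $ l * (cov2 g S i j k l x - cov2 g S j i k l x))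
    = (S x ** h ** ricci g x) $ k $ j
      - (\<Sum>i\<in>UNIV. \<Sum>p\<in>UNIV. (h ** S x ** h) $ i $ p * riemann g p k j i x)"
proof -
  let ?R = "\<lambda>i. curvm g j i x"
  have hs: "transpose h = h" unfolding h_def by (rule metric_on_inverse_symmetric[OF g x])
  have up: "?R i = h ** (g x ** ?R i)" for i
    unfolding h_def by (simp add: matrix_mul_assoc metric_on_inverse[OF g x])
  have 1: "(transpose (?R i) ** S x) $ k $ l = (\<Sum>p\<in>UNIV. (h ** S x) $ p $ l * riemann g p k j i x)" for i l
  proof -
    have "transpose (?R i) ** S x = transpose (g x ** ?R i) ** (h ** S x)"
      by (subst up, subst matrix_transpose_mul) (simp add: hs matrix_mul_assoc)
    then show ?thesis
      by (simp add: matrix_mult_component[of "transpose (g x ** ?R i)"] transpose_component riemann_eq_curvm mult.commute)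
  qed
  have 2: "(S x ** ?R i) $ k $ l = - (\<Sum>p\<in>UNIV. (S x ** h) $ k $ p * riemann g l p j i x)" for i l
  proof -
    have "S x ** ?R i = (S x ** h) ** (g x ** ?R i)"
      by (subst up) (simp add: matrix_mul_assoc)
    then have "(S x ** ?R i) $ k $ l = (\<Sum>p\<in>UNIV. (S x ** h) $ k $ p * riemann g p l j i x)"
      by (simp add: matrix_mult_component[of "S x ** h"] riemann_eq_curvm)
    then show ?thesis
      by (simp add: riemann_antisym12[OF g x, of _ l] sum_negf)
  qed
  have "(\<Sum>i\<in>UNIV. \<Sum>l\<in>UNIV. h $ i $ l * (cov2 g S i j k l x - cov2 g S j i k l x))
    = (\<Sum>i\<in>UNIV. \<Sum>l\<in>UNIV. \<Sum>p\<in>UNIV. (S x ** h) $ k $ p * (h $ i $ l * riemann g l p j i x))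
      - (\<Sum>i\<in>UNIV. \<Sum>l\<in>UNIV. \<Sum>p\<in>UNIV. (h ** S x) $ p $ l * h $ i $ l * riemann g p k j i x)"
    by (simp add: ricci_identity[OF g x S] 1 2 right_diff_distrib sum_subtractf sum_distrib_left mult_ac)
  also have "(\<Sum>i\<in>UNIV. \<Sum>l\<in>UNIV. \<Sum>p\<in>UNIV. (S x ** h) $ k $ p * (h $ i $ l * riemann g l p j i x))
    = (\<Sum>p\<in>UNIV. (S x ** h) $ k $ p * ricci g x $ p $ j)"
    unfolding ricci_eq_contraction[OF g x, symmetric] h_def
    by (subst sum_swap3) (simp add: sum_distrib_left)
  also have "\<dots> = (S x ** h ** ricci g x) $ k $ j"
    by (simp add: matrix_mult_component[of "S x ** h"])
  also have "(\<Sum>i\<in>UNIV. \<Sum>l\<in>UNIV. \<Sum>p\<in>UNIV. (h ** S x) $ p $ l * h $ i $ l * riemann g p k j i x)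
    = (\<Sum>i\<in>UNIV. \<Sum>p\<in>UNIV. (\<Sum>l\<in>UNIV. (h ** S x) $ p $ l * h $ i $ l) * riemann g p k j i x)"
    by (simp add: sum_distrib_right) (intro sum.cong refl sum.swap)
  also have "\<dots> = (\<Sum>i\<in>UNIV. \<Sum>p\<in>UNIV. (h ** S x ** h) $ i $ p * riemann g p k j i x)"
  proof -
    have "(\<Sum>l\<in>UNIV. (h ** S x) $ p $ l * h $ i $ l) = (h ** S x ** h) $ i $ p" for i p
    proof -
      have "(\<Sum>l\<in>UNIV. (h ** S x) $ p $ l * h $ i $ l) = ((h ** S x) ** transpose h) $ p $ i"
        by (simp add: matrix_mult_component[of "h ** S x"] transpose_component)
      also have "\<dots> = transpose (h ** S x ** h) $ i $ p" by (simp add: hs transpose_component)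
      also have "transpose (h ** S x ** h) = h ** S x ** h"
        by (simp add: matrix_transpose_mul hs sym matrix_mul_assoc)
      finally show ?thesis .
    qed
    then show ?thesis by simp
  qed
  finally show ?thesis .
qed

lemma schouten_decomposition:
  assumes "CARD('n) > 2"
  shows "ricci g x = (real CARD('n) - 2) *\<^sub>R schouten g x + schouten_J g x *\<^sub>R g x"
proof -
  have "real CARD('n) - 2 \<noteq> 0" using assms by simp
  then show ?thesis by (simp add: schouten_def)
qed

lemma trace_schouten:
  assumes n: "CARD('n) > 2" and x: "x \<in> V"
  shows "trace (matrix_inv (g x) ** schouten g x) = schouten_J g x"
proof -
  let ?h = "matrix_inv (g x)" and ?n = "real CARD('n)"
  have n2: "?n - 2 > 0" using n by simp
  have "scal g x = trace (?h ** ricci g x)" by (rule scal_eq_trace[OF g x])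
  also have "\<dots> = (?n - 2) * trace (?h ** schouten g x) + schouten_J g x * ?n"
    unfolding schouten_decomposition[OF n]
    by (simp add: matrix_algebra trace_add trace_scale metric_on_inverse[OF g x] trace_I)
  finally have "2 * (?n - 1) * schouten_J g x = (?n - 2) * trace (?h ** schouten g x) + schouten_J g x * ?n"
    using n by (simp add: schouten_J_def)
  then have "(?n - 2) * trace (?h ** schouten g x) = (?n - 2) * schouten_J g x" by (simp add: algebra_simps)
  then show ?thesis using n2 by simp
qed

lemma schouten_norm2_eq:
  assumes sym: "transpose (schouten g x) = schouten g x" and x: "x \<in> V"
  defines "h \<equiv> matrix_inv (g x)"
  shows "schouten_norm2 g x = trace (h ** schouten g x ** h ** schouten g x)"
proof -
  let ?S = "schouten g x"
  have hs: "h $ j $ l = h $ l $ j" for j l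
    using metric_on_inverse_symmetric[OF g x] unfolding h_def by (metis transpose_component)
  have Ss: "?S $ j $ l = ?S $ l $ j" for j l
    using sym by (metis transpose_component)
  have E: "(h ** ?S ** h) $ i $ j = (\<Sum>k\<in>UNIV. \<Sum>l\<in>UNIV. h $ i $ k * h $ j $ l * ?S $ k $ l)" for i j
  proof -
    have "(h ** ?S ** h) $ i $ j = (\<Sum>l\<in>UNIV. \<Sum>k\<in>UNIV. h $ i $ k * ?S $ k $ l * h $ l $ j)"
      by (simp only: matrix_mult_component sum_distrib_right)
    also have "\<dots> = (\<Sum>k\<in>UNIV. \<Sum>l\<in>UNIV. h $ i $ k * ?S $ k $ l * h $ l $ j)" by (rule sum.swap)
    also have "\<dots> = (\<Sum>k\<in>UNIV. \<Sum>l\<in>UNIV. h $ i $ k * h $ j $ l * ?S $ k $ l)"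
      by (intro sum.cong refl) (subst hs[of _ j], simp)
    finally show ?thesis .
  qed
  have "trace (h ** ?S ** h ** ?S) = trace (h ** ?S ** h ** transpose ?S)" by (simp add: sym)
  also have "\<dots> = (\<Sum>i\<in>UNIV. \<Sum>j\<in>UNIV. (h ** ?S ** h) $ i $ j * ?S $ i $ j)"
    by (simp only: trace_mult transpose_component)
  also have "\<dots> = schouten_norm2 g x"
    unfolding schouten_norm2_def h_def[symmetric] E by (simp add: sum_distrib_right sum_distrib_left mult_ac)
  finally show ?thesis by simp
qed

text \<open>Of the four Schouten terms in the Weyl tensor, two contract with \<open>P\<^sup>k\<^sup>l\<close> to \<open>P\<^sup>2\<close> and two to the traces \<open>\<bar>P\<bar>\<^sup>2\<close> and \<open>J\<close>.
  What remains is the contraction with the full curvature tensor, which the Ricci identity produces as well.\<close>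

lemma schouten_weyl_contraction:
  assumes sym: "transpose (schouten g x) = schouten g x" and n: "CARD('n) > 2" and x: "x \<in> V"
  defines "h \<equiv> matrix_inv (g x)" and "S \<equiv> schouten g x"
  shows "(\<Sum>a\<in>UNIV. \<Sum>b\<in>UNIV. (h ** S ** h) $ a $ b * weyl g a j k b x)
    = (\<Sum>a\<in>UNIV. \<Sum>b\<in>UNIV. (h ** S ** h) $ a $ b * riemann g a j k b x)
      + 2 * (S ** h ** S) $ j $ k - schouten_norm2 g x * g x $ j $ k - schouten_J g x * S $ j $ k"
proof -
  let ?E = "h ** S ** h"
  have hs: "transpose h = h" unfolding h_def by (rule metric_on_inverse_symmetric[OF g x])
  have gsym: "transpose (g x) = g x" by (rule metric_on_symmetric[OF g x])
  have Ss: "transpose S = S" unfolding S_def by (rule sym)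
  have Es: "transpose ?E = ?E" by (simp add: matrix_transpose_mul hs Ss matrix_mul_assoc)
  have gh: "g x ** h = mat 1" "h ** g x = mat 1" unfolding h_def by (rule metric_on_inverse[OF g x])+
  have c: "(\<Sum>a\<in>UNIV. \<Sum>b\<in>UNIV. ?E $ a $ b * (A $ a $ k * B $ j $ b)) = (B ** transpose ?E ** A) $ j $ k" for A B :: "real^'n^'n"
  proof -
    have "(\<Sum>a\<in>UNIV. \<Sum>b\<in>UNIV. E $ a $ b * (A $ a $ k * B $ j $ b)) = (B ** transpose E ** A) $ j $ k" for E
      by (simp add: matrix_mult_component transpose_component sum_distrib_right sum_distrib_left mult_ac)
    then show ?thesis .
  qed
  have 1: "(\<Sum>a\<in>UNIV. \<Sum>b\<in>UNIV. ?E $ a $ b * (S $ a $ k * g x $ j $ b)) = (S ** h ** S) $ j $ k"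
    unfolding c Es by (simp add: matrix_mul_assoc gh)
  have 2: "(\<Sum>a\<in>UNIV. \<Sum>b\<in>UNIV. ?E $ a $ b * (g x $ a $ k * S $ j $ b)) = (S ** h ** S) $ j $ k"
  proof -
    have "S ** ?E ** g x = S ** h ** S ** (h ** g x)" by (simp only: matrix_mul_assoc)
    then show ?thesis unfolding c Es by (simp add: gh)
  qed
  have d: "(\<Sum>a\<in>UNIV. \<Sum>b\<in>UNIV. ?E $ a $ b * A $ a $ b) = trace (?E ** transpose A)" for A :: "real^'n^'n"
    by (simp add: trace_mult transpose_component)
  have 3: "(\<Sum>a\<in>UNIV. \<Sum>b\<in>UNIV. ?E $ a $ b * S $ a $ b) = schouten_norm2 g x"
    unfolding d Ss schouten_norm2_eq[OF sym x] unfolding h_def S_def ..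
  have 4: "(\<Sum>a\<in>UNIV. \<Sum>b\<in>UNIV. ?E $ a $ b * g x $ a $ b) = schouten_J g x"
  proof -
    have "?E ** g x = h ** S ** (h ** g x)" by (simp only: matrix_mul_assoc)
    then have "?E ** g x = h ** S" by (simp only: gh matrix_mul_rid)
    then show ?thesis unfolding d gsym using trace_schouten[OF n x] by (simp add: h_def S_def)
  qed
  have "(\<Sum>a\<in>UNIV. \<Sum>b\<in>UNIV. ?E $ a $ b * weyl g a j k b x)
    = (\<Sum>a\<in>UNIV. \<Sum>b\<in>UNIV. ?E $ a $ b * riemann g a j k b x)
      + (\<Sum>a\<in>UNIV. \<Sum>b\<in>UNIV. ?E $ a $ b * (S $ a $ k * g x $ j $ b))
      - (\<Sum>a\<in>UNIV. \<Sum>b\<in>UNIV. ?E $ a $ b * S $ a $ b) * g x $ j $ k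
      - (\<Sum>a\<in>UNIV. \<Sum>b\<in>UNIV. ?E $ a $ b * g x $ a $ b) * S $ j $ k
      + (\<Sum>a\<in>UNIV. \<Sum>b\<in>UNIV. ?E $ a $ b * (g x $ a $ k * S $ j $ b))"
    unfolding weyl_def S_def[symmetric]
    by (simp only: sum_distrib_right sum.distrib[symmetric] sum_subtractf[symmetric]) (simp add: algebra_simps)
  then show ?thesis unfolding 1 2 3 4 by simp
qed

lemma bach_eq:
  assumes sym: "transpose (schouten g x) = schouten g x" and n: "CARD('n) > 2" and x: "x \<in> V"
  defines "h \<equiv> matrix_inv (g x)" and "S \<equiv> schouten g x"
  shows "bach g x $ j $ k
    = (\<Sum>i\<in>UNIV. \<Sum>l\<in>UNIV. h $ i $ l * (cov2 g (schouten g) i l j k x - cov2 g (schouten g) i k j l x))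
      + (\<Sum>a\<in>UNIV. \<Sum>b\<in>UNIV. (h ** S ** h) $ a $ b * riemann g a j k b x)
      + 2 * (S ** h ** S) $ j $ k - schouten_norm2 g x * g x $ j $ k - schouten_J g x * S $ j $ k"
proof -
  have hs: "h $ a $ b = h $ b $ a" for a b
    using metric_on_inverse_symmetric[OF g x] unfolding h_def by (metis transpose_component)
  have E: "(\<Sum>p\<in>UNIV. \<Sum>q\<in>UNIV. h $ a $ p * h $ b $ q * S $ p $ q * w) = (h ** S ** h) $ a $ b * w" for a b w
  proof -
    have "(h ** S ** h) $ a $ b = (\<Sum>q\<in>UNIV. \<Sum>p\<in>UNIV. h $ a $ p * S $ p $ q * h $ q $ b)"
      by (simp only: matrix_mult_component sum_distrib_right)
    also have "\<dots> = (\<Sum>p\<in>UNIV. \<Sum>q\<in>UNIV. h $ a $ p * S $ p $ q * h $ q $ b)" by (rule sum.swap)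
    also have "\<dots> = (\<Sum>p\<in>UNIV. \<Sum>q\<in>UNIV. h $ a $ p * h $ b $ q * S $ p $ q)"
      by (intro sum.cong refl) (subst hs[of _ b], simp)
    finally show ?thesis by (simp only: sum_distrib_right)
  qed
  have "(\<Sum>a\<in>UNIV. \<Sum>b\<in>UNIV. h $ a $ b * (cov2 g (schouten g) b a j k x - cov2 g (schouten g) b k j a x))
      = (\<Sum>b\<in>UNIV. \<Sum>a\<in>UNIV. h $ b $ a * (cov2 g (schouten g) b a j k x - cov2 g (schouten g) b k j a x))"
    by (subst sum.swap) (intro sum.cong refl, subst hs, rule refl)
  then show ?thesis
    using schouten_weyl_contraction[OF sym n x, of j k]
    by (simp add: bach_def E flip: h_def S_def)
qed

text \<open>For \<open>\<nabla>\<^sup>l P\<^sub>k\<^sub>l = \<nabla>\<^sub>k J\<close>, commuting two covariant derivatives turns one of the terms into the Hessian of \<open>J\<close>, which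
  cancels, and the other two are the derivative terms of minus the Bach tensor. The curvature terms of the
  Ricci identity and of the Bach tensor cancel by the pair symmetry, up to the contractions of the
  Schouten tensor with itself.\<close>

lemma linearized_ricci_schouten:
  assumes S: "smooth_mat V (schouten g)" and sym: "\<And>x. x \<in> V \<Longrightarrow> transpose (schouten g x) = schouten g x"
    and n: "CARD('n) > 2" and x: "x \<in> V"
    and div: "\<And>x k. x \<in> V \<Longrightarrow> (\<Sum>i\<in>UNIV. \<Sum>l\<in>UNIV. matrix_inv (g x) $ i $ l * cov1 g (schouten g) i k l x)
        = pd k (schouten_J g) x"
  defines "h \<equiv> matrix_inv (g x)" and "P \<equiv> schouten g x"
  shows "(\<Sum>i\<in>UNIV. \<Sum>l\<in>UNIV. h $ i $ l * (cov2 g (schouten g) i k j l x + cov2 g (schouten g) i j k l x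
        - cov2 g (schouten g) i l j k x))
      - (pd j (pd k (schouten_J g)) x - (\<Sum>m\<in>UNIV. christoffel g m j k x * pd m (schouten_J g) x))
    = real CARD('n) * (P ** h ** P) $ j $ k - schouten_norm2 g x * g x $ j $ k - bach g x $ j $ k"
proof -
  let ?c = "cov2 g (schouten g)"
  have hs: "transpose h = h" unfolding h_def by (rule metric_on_inverse_symmetric[OF g x])
  have Ps: "transpose P = P" unfolding P_def by (rule sym[OF x])
  have E: "(h ** P ** h) $ a $ b = (h ** P ** h) $ b $ a" for a b
  proof -
    have "transpose (h ** P ** h) = h ** P ** h" by (simp add: matrix_transpose_mul hs Ps matrix_mul_assoc)
    then show ?thesis by (metis transpose_component)
  qed
  have rho_domain: "(P ** h ** P) $ k $ j = (P ** h ** P) $ j $ k"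
  proof -
    have "transpose (P ** h ** P) = P ** h ** P" by (simp add: matrix_transpose_mul hs Ps matrix_mul_assoc)
    then show ?thesis by (metis transpose_component)
  qed
  have Pjk: "P $ k $ j = P $ j $ k" using Ps by (metis transpose_component)
  have hess: "(\<Sum>i\<in>UNIV. \<Sum>l\<in>UNIV. h $ i $ l * ?c j i k l x)
    = pd j (pd k (schouten_J g)) x - (\<Sum>m\<in>UNIV. christoffel g m j k x * pd m (schouten_J g) x)"
    unfolding h_def by (rule contraction_cov2_hessian[OF S x div])
  have pair: "(\<Sum>i\<in>UNIV. \<Sum>p\<in>UNIV. (h ** P ** h) $ i $ p * riemann g p k j i x)
      = (\<Sum>a\<in>UNIV. \<Sum>b\<in>UNIV. (h ** P ** h) $ a $ b * riemann g a j k b x)"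
  proof (intro sum.cong refl)
    fix i p
    have "riemann g p k j i x = riemann g i j k p x"
      using riemann_pair_sym[OF g x, of p k j i] riemann_antisym12[OF g x, of j i p k] riemann_antisym34[OF g, of i j p k x]
      by simp
    then show "(h ** P ** h) $ i $ p * riemann g p k j i x = (h ** P ** h) $ i $ p * riemann g i j k p x" by simp
  qed
  have ric: "(P ** h ** ricci g x) $ k $ j = (real CARD('n) - 2) * (P ** h ** P) $ j $ k + schouten_J g x * P $ j $ k"
    using metric_on_inverse(2)[OF g x]
    by (simp add: schouten_decomposition[OF n] matrix_add_ldistrib matrix_scaleR_right h_def[symmetric] P_def[symmetric] rho_domain Pjk
        flip: matrix_mul_assoc) (simp add: matrix_mul_assoc rho_domain)
  have "(\<Sum>i\<in>UNIV. \<Sum>l\<in>UNIV. h $ i $ l * (?c i k j l x + ?c i j k l x - ?c i l j k x))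
      = (\<Sum>i\<in>UNIV. \<Sum>l\<in>UNIV. h $ i $ l * (?c i j k l x - ?c j i k l x))
       + (\<Sum>i\<in>UNIV. \<Sum>l\<in>UNIV. h $ i $ l * ?c j i k l x)
       - (\<Sum>i\<in>UNIV. \<Sum>l\<in>UNIV. h $ i $ l * (?c i l j k x - ?c i k j l x))"
    by (simp only: sum.distrib[symmetric] sum_subtractf[symmetric]) (simp add: algebra_simps)
  then show ?thesis
    using contracted_ricci_identity[OF S sym[OF x] x, of j k, folded h_def P_def] bach_eq[OF sym[OF x] n x, of j k, folded h_def P_def]
    unfolding hess pair ric by (simp add: algebra_simps)
qed

end


text \<open>The difference tensor of two connections to first order: \<open>\<Gamma>\<close> varies by this tensor, with \<open>l\<close> raised, when the
  metric varies by \<open>2S\<close>.\<close>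

definition conn_variation :: "(real^'n \<Rightarrow> real^'n^'n) \<Rightarrow> (real^'n \<Rightarrow> real^'n^'n) \<Rightarrow> 'n \<Rightarrow> 'n \<Rightarrow> 'n \<Rightarrow> real^'n \<Rightarrow> real" where
  "conn_variation g S l i j x = cov1 g S i j l x + cov1 g S j i l x - cov1 g S l i j x"

context
  fixes V :: "(real^'n) set" and g :: "real^'n \<Rightarrow> real^'n^'n"
  assumes g: "metric_on V g"
begin

private lemma openV_fam: "open V"
  using g by (rule metric_onD)

text \<open>The linearization of the expression of the Ricci tensor by the Christoffel symbols: the
  derivatives of \<open>g\<^sup>i\<^sup>l\<close> supply the connection terms that complete the coordinate derivatives to
  covariant ones.\<close>

lemma linearized_ricci:
  assumes S: "smooth_mat V S" and sym: "\<And>x. x \<in> V \<Longrightarrow> transpose (S x) = S x"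
    and \<gamma>: "\<And>x i k j. x \<in> V \<Longrightarrow> \<gamma> i k j x = (\<Sum>l\<in>UNIV. matrix_inv (g x) $ i $ l * conn_variation g S l k j x)"
    and J: "\<And>x. x \<in> V \<Longrightarrow> trace (matrix_inv (g x) ** S x) = J x"
    and x: "x \<in> V"
  defines "\<Gamma> \<equiv> \<lambda>m k i. christoffel g m k i x" and "h \<equiv> matrix_inv (g x)"
  shows "(\<Sum>i\<in>UNIV. pd i (\<gamma> i k j) x - pd k (\<gamma> i i j) x
      + (\<Sum>m\<in>UNIV. \<gamma> i i m x * \<Gamma> m k j + \<Gamma> i i m * \<gamma> m k j x - (\<gamma> i k m x * \<Gamma> m i j + \<Gamma> i k m * \<gamma> m i j x)))
    = (\<Sum>i\<in>UNIV. \<Sum>l\<in>UNIV. h $ i $ l * (cov2 g S i k j l x + cov2 g S i j k l x - cov2 g S i l k j x))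
      - (pd k (pd j J) x - (\<Sum>m\<in>UNIV. \<Gamma> m k j * pd m J x))"
proof -
  let ?C = "conn_variation g S"
  have sT: "smooth_on V (cov1 g S k i j)" for k i j
    using smooth_matD[OF smooth_mat_covm[OF g S]] by (simp add: cov1_fun)
  have sC: "smooth_on V (?C l i j)" for l i j
    unfolding conn_variation_def[abs_def] by (intro smooth_intros openV_fam sT)
  have sh: "smooth_on V (\<lambda>x. matrix_inv (g x) $ i $ l)" for i l
    by (rule smooth_on_inverse_metric[OF g])
  have s\<gamma>: "smooth_on V (\<gamma> i k j)" for i k j
    by (rule smooth_on_cong[OF openV_fam \<gamma>, THEN iffD2]) (auto intro!: smooth_intros openV_fam sh sC)
  note d = smooth_on_differentiable[OF _ x]
  have hs: "matrix_inv (g y) $ a $ b = matrix_inv (g y) $ b $ a" if "y \<in> V" for y a b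
    using metric_on_inverse_symmetric[OF g that] by (metis transpose_component)
  have tr: "(\<Sum>i\<in>UNIV. \<gamma> i i j y) = pd j J y" if y: "y \<in> V" for y j
  proof -
    let ?h = "matrix_inv (g y)"
    have a: "(\<Sum>i\<in>UNIV. \<Sum>l\<in>UNIV. ?h $ i $ l * cov1 g S l i j y) = (\<Sum>i\<in>UNIV. \<Sum>l\<in>UNIV. ?h $ i $ l * cov1 g S i j l y)"
    proof -
      have "(\<Sum>i\<in>UNIV. \<Sum>l\<in>UNIV. ?h $ i $ l * cov1 g S l i j y) = (\<Sum>l\<in>UNIV. \<Sum>i\<in>UNIV. ?h $ i $ l * cov1 g S l i j y)"
        by (rule sum.swap)
      also have "\<dots> = (\<Sum>l\<in>UNIV. \<Sum>i\<in>UNIV. ?h $ l $ i * cov1 g S l j i y)"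
        by (intro sum.cong refl arg_cong2[where f = "(*)"] hs[OF y] cov_sym(2)[OF g sym y])
      finally show ?thesis .
    qed
    have "(\<Sum>i\<in>UNIV. \<gamma> i i j y) = (\<Sum>i\<in>UNIV. \<Sum>l\<in>UNIV. ?h $ i $ l * cov1 g S j i l y)"
      using a by (simp add: \<gamma>[OF y] conn_variation_def algebra_simps sum.distrib sum_subtractf)
    also have "\<dots> = trace (?h ** covm g S j y)"
      by (simp add: trace_mult cov1_eq_covm[symmetric] cov_sym(2)[where S = S and k = j, OF g sym y])
    also have "\<dots> = pd j (\<lambda>y. trace (matrix_inv (g y) ** S y)) y"
      by (rule pd_contraction[OF g y S, symmetric])
    also have "\<dots> = pd j J y" by (rule pd_cong[OF openV_fam y J])
    finally show ?thesis .
  qed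
  have B1: "(\<Sum>i\<in>UNIV. pd k (\<gamma> i i j) x) = pd k (pd j J) x"
  proof -
    have "(\<Sum>i\<in>UNIV. pd k (\<gamma> i i j) x) = pd k (\<lambda>y. \<Sum>i\<in>UNIV. \<gamma> i i j y) x"
      by (rule pd_sum[symmetric]) (auto intro!: d s\<gamma>)
    also have "\<dots> = pd k (pd j J) x" by (rule pd_cong[OF openV_fam x tr])
    finally show ?thesis .
  qed
  have B2: "(\<Sum>i\<in>UNIV. \<Sum>m\<in>UNIV. \<gamma> i i m x * \<Gamma> m k j) = (\<Sum>m\<in>UNIV. \<Gamma> m k j * pd m J x)"
    by (subst sum.swap) (simp add: tr[OF x, symmetric] sum_distrib_left mult.commute)
  have ph: "pd i (\<lambda>y. matrix_inv (g y) $ i $ l) x = - (\<Sum>p\<in>UNIV. h $ i $ p * \<Gamma> l i p) - (\<Sum>p\<in>UNIV. \<Gamma> i i p * h $ p $ l)" for i l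
    using inverse_metric_compatible[OF g x, of i]
    by (simp add: vec_eq_iff mpd_component matrix_mult_component transpose_component conn_def \<Gamma>_def h_def)
  \<comment> \<open>Summed over \<open>i\<close>, the last term cancels the product \<open>\<Gamma>\<^sup>i\<^sub>i\<^sub>m \<gamma>\<^sup>m\<^sub>k\<^sub>j\<close>.\<close>
  have p\<gamma>: "pd i (\<gamma> i k j) x = (\<Sum>l\<in>UNIV. h $ i $ l * pd i (?C l k j) x) - (\<Sum>l\<in>UNIV. \<Sum>p\<in>UNIV. h $ i $ p * \<Gamma> l i p * ?C l k j x)
      - (\<Sum>p\<in>UNIV. \<Gamma> i i p * \<gamma> p k j x)" for i
  proof -
    have "pd i (\<gamma> i k j) x = pd i (\<lambda>x. \<Sum>l\<in>UNIV. matrix_inv (g x) $ i $ l * ?C l k j x) x"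
      by (rule pd_cong[OF openV_fam x \<gamma>])
    also have "\<dots> = (\<Sum>l\<in>UNIV. pd i (\<lambda>x. matrix_inv (g x) $ i $ l * ?C l k j x) x)"
      by (rule pd_sum) (auto intro!: d smooth_intros openV_fam sh sC)
    also have "\<dots> = (\<Sum>l\<in>UNIV. h $ i $ l * pd i (?C l k j) x + pd i (\<lambda>y. matrix_inv (g y) $ i $ l) x * ?C l k j x)"
      unfolding h_def by (intro sum.cong refl pd_mult d sh sC)
    also have "\<dots> = (\<Sum>l\<in>UNIV. h $ i $ l * pd i (?C l k j) x) - (\<Sum>l\<in>UNIV. \<Sum>p\<in>UNIV. h $ i $ p * \<Gamma> l i p * ?C l k j x)
      - (\<Sum>l\<in>UNIV. \<Sum>p\<in>UNIV. \<Gamma> i i p * (h $ p $ l * ?C l k j x))"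
      by (simp add: ph algebra_simps sum.distrib sum_subtractf sum_distrib_left sum_distrib_right)
    also have "(\<Sum>l\<in>UNIV. \<Sum>p\<in>UNIV. \<Gamma> i i p * (h $ p $ l * ?C l k j x)) = (\<Sum>p\<in>UNIV. \<Gamma> i i p * \<gamma> p k j x)"
      by (subst sum.swap) (simp add: \<gamma>[OF x] h_def sum_distrib_left)
    finally show ?thesis .
  qed
  have A2: "(\<Sum>i\<in>UNIV. \<Sum>l\<in>UNIV. \<Sum>p\<in>UNIV. h $ i $ p * \<Gamma> l i p * ?C l k j x) = (\<Sum>i\<in>UNIV. \<Sum>l\<in>UNIV. h $ i $ l * (\<Sum>p\<in>UNIV. \<Gamma> p i l * ?C p k j x))"
    by (rule sum.cong[OF refl], subst sum.swap) (simp add: sum_distrib_left mult.assoc)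
  have A4: "(\<Sum>i\<in>UNIV. \<Sum>m\<in>UNIV. \<gamma> i k m x * \<Gamma> m i j) = (\<Sum>i\<in>UNIV. \<Sum>l\<in>UNIV. h $ i $ l * (\<Sum>m\<in>UNIV. \<Gamma> m i j * ?C l k m x))"
  proof (rule sum.cong[OF refl])
    fix i
    have "(\<Sum>m\<in>UNIV. \<gamma> i k m x * \<Gamma> m i j) = (\<Sum>m\<in>UNIV. \<Sum>l\<in>UNIV. h $ i $ l * (\<Gamma> m i j * ?C l k m x))"
      by (simp add: \<gamma>[OF x] h_def sum_distrib_left sum_distrib_right mult_ac)
    then show "(\<Sum>m\<in>UNIV. \<gamma> i k m x * \<Gamma> m i j) = (\<Sum>l\<in>UNIV. h $ i $ l * (\<Sum>m\<in>UNIV. \<Gamma> m i j * ?C l k m x))"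
      by (subst (asm) sum.swap) (simp add: sum_distrib_left)
  qed
  have A5: "(\<Sum>i\<in>UNIV. \<Sum>m\<in>UNIV. \<Gamma> i k m * \<gamma> m i j x) = (\<Sum>i\<in>UNIV. \<Sum>l\<in>UNIV. h $ i $ l * (\<Sum>m\<in>UNIV. \<Gamma> m i k * ?C l m j x))"
  proof -
    have "(\<Sum>i\<in>UNIV. \<Sum>m\<in>UNIV. \<Gamma> i k m * \<gamma> m i j x) = (\<Sum>m\<in>UNIV. \<Sum>i\<in>UNIV. \<Gamma> i k m * \<gamma> m i j x)" by (rule sum.swap)
    also have "\<dots> = (\<Sum>m\<in>UNIV. \<Sum>i\<in>UNIV. \<Sum>l\<in>UNIV. h $ m $ l * (\<Gamma> i m k * ?C l i j x))"
      by (simp add: \<gamma>[OF x] h_def sum_distrib_left mult_ac \<Gamma>_def christoffel_sym[where k = k, OF g x])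
    also have "\<dots> = (\<Sum>m\<in>UNIV. \<Sum>l\<in>UNIV. \<Sum>i\<in>UNIV. h $ m $ l * (\<Gamma> i m k * ?C l i j x))"
      by (rule sum.cong[OF refl sum.swap])
    finally show ?thesis by (simp add: sum_distrib_left)
  qed
  have cov: "cov2 g S i k j l x + cov2 g S i j k l x - cov2 g S i l k j x = pd i (?C l k j) x
      - (\<Sum>p\<in>UNIV. \<Gamma> p i l * ?C p k j x) - (\<Sum>m\<in>UNIV. \<Gamma> m i j * ?C l k m x) - (\<Sum>m\<in>UNIV. \<Gamma> m i k * ?C l m j x)" for i l
  proof -
    have "pd i (?C l k j) x = pd i (\<lambda>x. cov1 g S k j l x + cov1 g S j k l x) x - pd i (cov1 g S l k j) x"
      unfolding conn_variation_def[abs_def] by (intro pd_diff d smooth_intros openV_fam sT)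
    also have "pd i (\<lambda>x. cov1 g S k j l x + cov1 g S j k l x) x = pd i (cov1 g S k j l) x + pd i (cov1 g S j k l) x"
      by (intro pd_add d sT)
    finally show ?thesis
      unfolding cov2_def conn_variation_def \<Gamma>_def by (simp add: algebra_simps sum.distrib sum_subtractf)
  qed
  show ?thesis
    unfolding cov
    by (simp add: p\<gamma> sum.distrib sum_subtractf sum_negf B1 B2 A2 A4 A5 right_diff_distrib)
qed

end


section \<open>One-parameter families\<close>

lemma sum_option: "(\<Sum>a\<in>(UNIV :: 'n::finite option set). f a) = f None + (\<Sum>i\<in>UNIV. f (Some i))"
  by (simp add: UNIV_option_conv sum.reindex)

lemma adjoin_component [simp]: "adjoin s x $ None = s" "adjoin s x $ Some i = x $ i"
  by (simp_all add: adjoin_def)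

lemma base_adjoin [simp]: "base (adjoin s x) = x"
  by (simp add: base_def vec_eq_iff)

lemma base_component [simp]: "base y $ i = y $ Some i"
  by (simp add: base_def)

lemma adjoin_base [simp]: "adjoin (y $ None) (base y) = y"
  by (auto simp: adjoin_def base_def vec_eq_iff split: option.split)

lemma smooth_on_base_component: "smooth_on U (\<lambda>y. base y $ i)"
  by (simp add: smooth_on_coord)

lemma smooth_on_adjoin_component: "smooth_on U (\<lambda>x. adjoin s x $ a)"
  by (cases a) (simp_all add: smooth_on_coord smooth_on_const)

lemma continuous_on_base: "continuous_on S base"
  unfolding base_def by (intro continuous_intros continuous_on_component continuous_on_vec_lambda)

lemma continuous_on_adjoin: "continuous_on S (\<lambda>x::real^'n. adjoin s x)"
proof -
  have "(\<lambda>x. adjoin s x $ a) differentiable (at x)" for x :: "real^'n" and a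
    using smooth_on_differentiable[OF smooth_on_adjoin_component[of UNIV]] by simp
  then show ?thesis
    by (intro continuous_at_imp_continuous_on ballI has_derivative_continuous[OF differentiable_vec])
qed

lemma pd_base:
  assumes "F differentiable (at (base y))"
  shows "(\<lambda>y. F (base y)) differentiable (at y)"
    "pd (Some i) (\<lambda>y. F (base y)) y = pd i F (base y)" "pd None (\<lambda>y. F (base y)) y = 0"
proof -
  have d: "(\<lambda>y. base y $ j) differentiable (at y)" for j
    using smooth_on_differentiable[OF smooth_on_base_component[of UNIV]] by simp
  show "(\<lambda>y. F (base y)) differentiable (at y)" by (rule pd_compose(1)[OF d assms])
  show "pd (Some i) (\<lambda>y. F (base y)) y = pd i F (base y)" "pd None (\<lambda>y. F (base y)) y = 0"
    unfolding pd_compose(2)[OF d assms] by (simp_all add: pd_coord if_distrib cong: if_cong)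
qed

lemma pd_slice:
  assumes "F differentiable (at (adjoin s x))"
  shows "pd i (\<lambda>x. F (adjoin s x)) x = pd (Some i) F (adjoin s x)"
proof -
  have d: "(\<lambda>x. adjoin s x $ a) differentiable (at x)" for a
    using smooth_on_differentiable[OF smooth_on_adjoin_component[of UNIV]] by simp
  show ?thesis
    unfolding pd_compose(2)[OF d assms] by (simp add: sum_option pd_coord if_distrib cong: if_cong)
qed

definition slice :: "(real^('n option)) set \<Rightarrow> real \<Rightarrow> (real^'n) set" where
  "slice W s = {x. adjoin s x \<in> W}"

lemma open_slice: "open W \<Longrightarrow> open (slice W s)"
  unfolding slice_def using open_vimage[OF _ continuous_on_adjoin[of UNIV s], of W] by (simp add: vimage_def)

lemma smooth_on_slice:
  assumes "open W" "smooth_on W F" shows "smooth_on (slice W s) (\<lambda>x. F (adjoin s x))"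
  by (rule smooth_on_compose[OF assms(2) open_slice[OF assms(1)] smooth_on_adjoin_component]) (simp add: slice_def)

lemma metric_on_slice: "metric_on W G \<Longrightarrow> metric_on (slice W s) (\<lambda>x. G (adjoin s x))"
  unfolding metric_on_def using open_slice[of W s] smooth_on_slice[of W "\<lambda>y. G y $ _ $ _" s] by (auto simp: slice_def)

lemma smooth_mat_slice: "open W \<Longrightarrow> smooth_mat W A \<Longrightarrow> smooth_mat (slice W s) (\<lambda>x. A (adjoin s x))"
  using smooth_on_slice[of W "\<lambda>y. A y $ _ $ _" s] by (simp add: smooth_mat_def)

text \<open>The Christoffel symbols and the Ricci tensors of all metrics of the family at once, so that they can be
  differentiated with respect to the parameter.\<close>

definition family_conn :: "(real^('n option) \<Rightarrow> real^'n^'n) \<Rightarrow> 'n \<Rightarrow> 'n \<Rightarrow> 'n \<Rightarrow> real^('n option) \<Rightarrow> real" where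
  "family_conn G k i j y = (\<Sum>l\<in>UNIV. matrix_inv (G y) $ k $ l *
     (pd (Some i) (\<lambda>y. G y $ j $ l) y + pd (Some j) (\<lambda>y. G y $ i $ l) y - pd (Some l) (\<lambda>y. G y $ i $ j) y)) / 2"

definition family_ricci :: "(real^('n option) \<Rightarrow> real^'n^'n) \<Rightarrow> 'n \<Rightarrow> 'n \<Rightarrow> real^('n option) \<Rightarrow> real" where
  "family_ricci G j k y = (\<Sum>i\<in>UNIV. pd (Some i) (family_conn G i k j) y - pd (Some k) (family_conn G i i j) y
     + (\<Sum>m\<in>UNIV. family_conn G i i m y * family_conn G m k j y - family_conn G i k m y * family_conn G m i j y))"

context
  fixes W :: "(real^('n::finite option)) set" and G :: "real^('n option) \<Rightarrow> real^'n^'n"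
  assumes G: "metric_on W G"
begin

private lemma openW_fam: "open W"
  using G by (rule metric_onD)

private lemmas smooth_G_fam = metric_on_smooth_mat[OF G]
private lemmas smooth_Ginv_fam = metric_on_inverse_smooth_mat[OF G]

lemma smooth_on_family_conn: "smooth_on W (family_conn G m k i)"
proof -
  have *: "family_conn G m k i = (\<lambda>y. \<Sum>l\<in>UNIV. (1/2) * (matrix_inv (G y) $ m $ l *
     (pd (Some k) (\<lambda>y. G y $ i $ l) y + pd (Some i) (\<lambda>y. G y $ k $ l) y - pd (Some l) (\<lambda>y. G y $ k $ i) y)))"
    by (simp add: family_conn_def fun_eq_iff sum_divide_distrib)
  show ?thesis unfolding *
    by (intro smooth_intros openW_fam smooth_matD[OF smooth_G_fam] smooth_matD[OF smooth_Ginv_fam])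
qed

lemma smooth_on_family_ricci: "smooth_on W (family_ricci G j k)"
  unfolding family_ricci_def[abs_def] by (intro smooth_intros openW_fam smooth_on_family_conn)

lemma christoffel_slice:
  assumes "adjoin s x \<in> W"
  shows "christoffel (\<lambda>x. G (adjoin s x)) k i j x = family_conn G k i j (adjoin s x)"
  unfolding christoffel_def family_conn_def
  by (simp add: pd_slice smooth_mat_component_differentiable[OF smooth_G_fam assms] pd_slice[of "\<lambda>y. G y $ _ $ _"])

lemma ricci_slice:
  assumes x: "adjoin s x \<in> W"
  shows "ricci (\<lambda>x. G (adjoin s x)) x $ j $ k = family_ricci G j k (adjoin s x)"
proof -
  have xs: "x \<in> slice W s" using x by (simp add: slice_def)
  have "pd l (christoffel (\<lambda>x. G (adjoin s x)) i k j) x = pd (Some l) (family_conn G i k j) (adjoin s x)" for l i k j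
  proof -
    have "pd l (christoffel (\<lambda>x. G (adjoin s x)) i k j) x = pd l (\<lambda>x. family_conn G i k j (adjoin s x)) x"
      by (rule pd_cong[OF open_slice[OF openW_fam] xs]) (simp add: christoffel_slice slice_def)
    also have "\<dots> = pd (Some l) (family_conn G i k j) (adjoin s x)"
      by (rule pd_slice[OF smooth_on_differentiable[OF smooth_on_family_conn x]])
    finally show ?thesis .
  qed
  then show ?thesis
    by (simp add: ricci_def riemann_up_def family_ricci_def christoffel_slice[OF x])
qed

lemma mpd_slice:
  assumes A: "smooth_mat W A" and "adjoin s x \<in> W"
  shows "mpd i (\<lambda>x. A (adjoin s x)) x = mpd (Some i) A (adjoin s x)"
  unfolding mpd_def
  by (simp add: vec_eq_iff pd_slice[of "\<lambda>y. A y $ _ $ _"] smooth_mat_component_differentiable[OF A assms(2)])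

text \<open>Differentiate \<open>2 g\<^sub>k\<^sub>l \<Gamma>\<^sup>k\<^sub>i\<^sub>j = \<partial>\<^sub>i g\<^sub>j\<^sub>l + \<partial>\<^sub>j g\<^sub>i\<^sub>l - \<partial>\<^sub>l g\<^sub>i\<^sub>j\<close> with respect to the parameter: the derivative of the metric on the
  left provides the connection terms of the covariant derivatives of \<open>S = g'/2\<close>.\<close>

lemma pd_None_family_conn:
  assumes xs: "adjoin s x \<in> W"
  defines "g \<equiv> \<lambda>x. G (adjoin s x)" and "S \<equiv> \<lambda>x. (1/2) *\<^sub>R mpd None G (adjoin s x)"
  shows "pd None (family_conn G k i j) (adjoin s x)
    = (\<Sum>l\<in>UNIV. matrix_inv (g x) $ k $ l * conn_variation g S l i j x)"
proof -
  let ?y = "adjoin s x"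
  let ?X = "\<lambda>y. \<chi> l j. (pd (Some i) (\<lambda>y. G y $ j $ l) y + pd (Some j) (\<lambda>y. G y $ i $ l) y - pd (Some l) (\<lambda>y. G y $ i $ j) y) / 2"
  let ?c = "\<lambda>y. \<chi> k j. family_conn G k i j y"
  have x: "x \<in> slice W s" using xs by (simp add: slice_def)
  have gm: "metric_on (slice W s) g" unfolding g_def by (rule metric_on_slice[OF G])
  have sX: "smooth_mat W ?X"
    unfolding smooth_mat_def using smooth_matD[OF smooth_G_fam]
    by (auto intro!: smooth_on_divide[OF openW_fam] smooth_intros openW_fam)
  have dG: "(\<lambda>y. G y $ a $ b) differentiable (at ?y)" "pd c (\<lambda>y. G y $ a $ b) differentiable (at ?y)" for a b c
    by (intro smooth_on_differentiable[OF _ xs] smooth_matD[OF smooth_G_fam] smooth_on_pd)+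
  have cX: "?c y = matrix_inv (G y) ** ?X y" for y
    by (simp add: vec_eq_iff matrix_mult_component family_conn_def sum_divide_distrib)
  have conn: "?c ?y = conn g i x"
    by (simp add: conn_def g_def christoffel_slice[OF xs])
  have "mpd None ?c ?y = matrix_inv (G ?y) ** mpd None ?X ?y + mpd None (\<lambda>y. matrix_inv (G y)) ?y ** ?X ?y"
    unfolding cX by (rule mpd_mult[OF xs openW_fam smooth_Ginv_fam sX])
  also have "\<dots> = matrix_inv (g x) ** (mpd None ?X ?y - 2 *\<^sub>R (S x ** ?c ?y))"
    unfolding cX mpd_matrix_inv[OF G xs]
    by (simp add: matrix_algebra g_def S_def)
  finally have m: "mpd None ?c ?y = matrix_inv (g x) ** (mpd None ?X ?y - 2 *\<^sub>R (S x ** conn g i x))"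
    unfolding conn .
  have Ss: "S x $ a $ b = S x $ b $ a" for a b
    unfolding S_def using pd_cong[OF openW_fam xs, of "\<lambda>y. G y $ a $ b" "\<lambda>y. G y $ b $ a" None] metric_onD(4)[OF G]
    by (simp add: mpd_component)
  have pS: "pd c (\<lambda>x. S x $ a $ b) x = pd None (pd (Some c) (\<lambda>y. G y $ a $ b)) ?y / 2" for a b c
  proof -
    have "pd c (\<lambda>x. S x $ a $ b) x = pd c (\<lambda>x. (1/2) * pd None (\<lambda>y. G y $ a $ b) (adjoin s x)) x"
      by (simp add: S_def mpd_component)
    also have "\<dots> = (1/2) * pd c (\<lambda>x. pd None (\<lambda>y. G y $ a $ b) (adjoin s x)) x"
      by (rule pd_cmult, rule smooth_on_differentiable[OF smooth_on_slice[OF openW_fam] x], rule smooth_on_pd[OF smooth_matD[OF smooth_G_fam]])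
    also have "pd c (\<lambda>x. pd None (\<lambda>y. G y $ a $ b) (adjoin s x)) x = pd (Some c) (pd None (\<lambda>y. G y $ a $ b)) ?y"
      by (rule pd_slice[OF dG(2)])
    also have "\<dots> = pd None (pd (Some c) (\<lambda>y. G y $ a $ b)) ?y"
      by (rule pd_commute[OF openW_fam smooth_matD[OF smooth_G_fam] xs])
    finally show ?thesis by simp
  qed
  have pX: "mpd None ?X ?y $ l $ j = pd i (\<lambda>x. S x $ j $ l) x + pd j (\<lambda>x. S x $ i $ l) x - pd l (\<lambda>x. S x $ i $ j) x" for l j
  proof -
    have "mpd None ?X ?y $ l $ j = pd None (\<lambda>y. (1/2) * (pd (Some i) (\<lambda>y. G y $ j $ l) y + pd (Some j) (\<lambda>y. G y $ i $ l) y - pd (Some l) (\<lambda>y. G y $ i $ j) y)) ?y"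
      by (simp add: mpd_component)
    also have "\<dots> = (1/2) * (pd None (pd (Some i) (\<lambda>y. G y $ j $ l)) ?y + pd None (pd (Some j) (\<lambda>y. G y $ i $ l)) ?y
        - pd None (pd (Some l) (\<lambda>y. G y $ i $ j)) ?y)"
      by (subst pd_cmult pd_diff pd_add, (intro smooth_on_differentiable[OF _ xs] smooth_intros openW_fam smooth_matD[OF smooth_G_fam])+)+ simp
    finally show ?thesis by (simp add: pS)
  qed
  have "(mpd None ?X ?y - 2 *\<^sub>R (S x ** conn g i x)) $ l $ j = conn_variation g S l i j x" for l
  proof -
    have c: "christoffel g m a b x = christoffel g m b a x" for m a b by (rule christoffel_sym[OF gm x])
    have e: "(\<Sum>m\<in>UNIV. christoffel g m j i x * S x $ m $ l) = (\<Sum>m\<in>UNIV. christoffel g m i j x * S x $ m $ l)"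
      "(\<Sum>m\<in>UNIV. christoffel g m l i x * S x $ m $ j) = (\<Sum>m\<in>UNIV. christoffel g m i l x * S x $ j $ m)"
      "(\<Sum>m\<in>UNIV. christoffel g m l j x * S x $ i $ m) = (\<Sum>m\<in>UNIV. christoffel g m j l x * S x $ i $ m)"
      "(\<Sum>m\<in>UNIV. S x $ l $ m * christoffel g m i j x) = (\<Sum>m\<in>UNIV. christoffel g m i j x * S x $ m $ l)"
      by (intro sum.cong refl; simp only: c[of _ j i] c[of _ l i] c[of _ l j] Ss[of j] Ss[of l] mult.commute)+
    show ?thesis
      by (simp add: pX conn_variation_def cov1_def matrix_mult_component conn_def sum.distrib e)
  qed
  then have "mpd None ?c ?y $ k $ j = (\<Sum>l\<in>UNIV. matrix_inv (g x) $ k $ l * conn_variation g S l i j x)"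
    unfolding m by (simp add: matrix_mult_component)
  then show ?thesis by (simp add: mpd_component)
qed

text \<open>If the metric varies by twice its Schouten tensor, its Ricci tensor varies by the linearized expression above.
  This identifies the Bach tensor in the second Taylor coefficient of a Poincare-Einstein metric.\<close>

lemma pd_None_family_ricci:
  assumes n: "CARD('n) > 2" and xs: "adjoin s x \<in> W"
  defines "g \<equiv> \<lambda>x. G (adjoin s x)"
  defines "h \<equiv> matrix_inv (g x)"
  assumes S: "\<And>x. adjoin s x \<in> W \<Longrightarrow> mpd None G (adjoin s x) = 2 *\<^sub>R schouten g x"
    and div: "\<And>x k. adjoin s x \<in> W \<Longrightarrow> (\<Sum>i\<in>UNIV. \<Sum>l\<in>UNIV. matrix_inv (g x) $ i $ l * cov1 g (schouten g) i k l x)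
        = pd k (schouten_J g) x"
  shows "pd None (family_ricci G j k) (adjoin s x)
    = real CARD('n) * (schouten g x ** h ** schouten g x) $ j $ k - schouten_norm2 g x * g x $ j $ k - bach g x $ j $ k"
proof -
  let ?y = "adjoin s x" and ?V = "slice W s" and ?f = "family_conn G"
  let ?S = "\<lambda>x. (1/2) *\<^sub>R mpd None G (adjoin s x)"
  define \<gamma> where "\<gamma> i k j x = pd None (?f i k j) (adjoin s x)" for i k j x
  have openV_fam: "open ?V" by (rule open_slice[OF openW_fam])
  have x: "x \<in> ?V" using xs by (simp add: slice_def)
  have gm: "metric_on ?V g" unfolding g_def by (rule metric_on_slice[OF G])
  have SP: "?S x = schouten g x" if "x \<in> ?V" for x
    using S[of x] that by (simp add: slice_def)
  have sS: "smooth_mat ?V (schouten g)"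
    by (rule smooth_mat_cong[OF openV_fam SP smooth_mat_scale[OF openV_fam smooth_on_const smooth_mat_slice[OF openW_fam smooth_mat_mpd[OF smooth_G_fam]]]])
  have sym: "transpose (schouten g x) = schouten g x" if x: "x \<in> ?V" for x
  proof -
    have "adjoin s x \<in> W" using x by (simp add: slice_def)
    then have "mpd None (\<lambda>y. transpose (G y)) (adjoin s x) = mpd None G (adjoin s x)"
      by (rule mpd_cong[OF openW_fam]) (rule metric_on_symmetric[OF G])
    then show ?thesis unfolding SP[OF x, symmetric] by (simp add: mpd_transpose transpose_scale)
  qed
  have cong: "conn_variation g ?S l i j x = conn_variation g (schouten g) l i j x" if x: "x \<in> ?V" for l i j x
  proof -
    have "cov1 g ?S k i j x = cov1 g (schouten g) k i j x" for k i j
      unfolding cov1_def SP[OF x] using pd_cong[OF openV_fam x, of "\<lambda>x. ?S x $ i $ j" "\<lambda>x. schouten g x $ i $ j" k] SP by simp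
    then show ?thesis by (simp add: conn_variation_def)
  qed
  have \<gamma>: "\<gamma> i k j x = (\<Sum>l\<in>UNIV. matrix_inv (g x) $ i $ l * conn_variation g (schouten g) l k j x)" if "x \<in> ?V" for x i k j
    using pd_None_family_conn[of s x i k j, folded g_def] that by (simp add: \<gamma>_def cong slice_def) (simp add: g_def)
  note f = smooth_on_family_conn
  have fd: "?f i k j differentiable (at ?y)" "pd a (?f i k j) differentiable (at ?y)" for a i k j
    by (intro smooth_on_differentiable[OF _ xs] f smooth_on_pd)+
  have com: "pd None (pd (Some l) (?f i k j)) ?y = pd l (\<gamma> i k j) x" for l i k j
    unfolding \<gamma>_def[abs_def] pd_slice[OF fd(2)] by (rule pd_commute[OF openW_fam f xs])
  have fc: "?f m k i ?y = christoffel g m k i x" for m k i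
    unfolding g_def by (rule christoffel_slice[OF xs, symmetric])
  have "pd None (family_ricci G j k) ?y = (\<Sum>i\<in>UNIV. pd None (pd (Some i) (?f i k j)) ?y - pd None (pd (Some k) (?f i i j)) ?y
     + (\<Sum>m\<in>UNIV. ?f i i m ?y * pd None (?f m k j) ?y + pd None (?f i i m) ?y * ?f m k j ?y
       - (?f i k m ?y * pd None (?f m i j) ?y + pd None (?f i k m) ?y * ?f m i j ?y)))"
    unfolding family_ricci_def[abs_def]
    by (subst pd_sum pd_add pd_diff pd_mult, (auto intro!: smooth_on_differentiable[OF _ xs] smooth_intros openW_fam f smooth_on_pd)+)+ 
  also have "\<dots> = (\<Sum>i\<in>UNIV. pd i (\<gamma> i k j) x - pd k (\<gamma> i i j) x
      + (\<Sum>m\<in>UNIV. \<gamma> i i m x * christoffel g m k j x + christoffel g i i m x * \<gamma> m k j x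
        - (\<gamma> i k m x * christoffel g m i j x + christoffel g i k m x * \<gamma> m i j x)))"
    unfolding com fc \<gamma>_def[symmetric] by (simp add: add.commute)
  also have "\<dots> = (\<Sum>i\<in>UNIV. \<Sum>l\<in>UNIV. h $ i $ l * (cov2 g (schouten g) i k j l x + cov2 g (schouten g) i j k l x
        - cov2 g (schouten g) i l k j x))
      - (pd k (pd j (schouten_J g)) x - (\<Sum>m\<in>UNIV. christoffel g m k j x * pd m (schouten_J g) x))"
    unfolding h_def by (rule linearized_ricci[OF gm sS sym \<gamma> trace_schouten[OF gm n] x])
  also have "\<dots> = real CARD('n) * (schouten g x ** h ** schouten g x) $ j $ k - schouten_norm2 g x * g x $ j $ k - bach g x $ j $ k"
  proof -
    have "smooth_on ?V (\<lambda>x. trace (matrix_inv (g x) ** schouten g x))"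
      by (intro smooth_mat_trace smooth_mat_intros openV_fam sS metric_on_inverse_smooth_mat[OF gm])
    then have sJ: "smooth_on ?V (schouten_J g)"
      by (rule smooth_on_cong[OF openV_fam, THEN iffD1, rotated]) (rule trace_schouten[OF gm n])
    have "pd k (pd j (schouten_J g)) x = pd j (pd k (schouten_J g)) x"
      by (rule pd_commute[OF openV_fam sJ x])
    moreover have "cov2 g (schouten g) i l k j x = cov2 g (schouten g) i l j k x" for i l
      by (rule cov_sym(3)[OF gm sym x])
    moreover have "christoffel g m k j x = christoffel g m j k x" for m
      by (rule christoffel_sym[OF gm x])
    ultimately show ?thesis
      using linearized_ricci_schouten[where j = j and k = k, OF gm sS sym n x, folded h_def] div
      by (simp add: slice_def)
  qed
  finally show ?thesis .
qed

end


section \<open>The Ricci tensor of a Poincare-Einstein metric\<close>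

text \<open>A family that is even in \<open>r\<close> is a function of \<open>\<rho> = - r\<^sup>2 / 2\<close>. Its Taylor coefficients are taken with respect to \<open>\<rho>\<close>,
  but the Einstein equation is formulated in \<open>r\<close>.\<close>

definition to_rho :: "real^('n::finite option) \<Rightarrow> real^('n option)" where
  "to_rho y = adjoin (- (y $ None)\<^sup>2 / 2) (base y)"

lemma to_rho_component: "to_rho y $ None = - (y $ None)\<^sup>2 / 2" "to_rho y $ Some i = y $ Some i"
  by (simp_all add: to_rho_def)

lemma smooth_on_to_rho_component:
  assumes "open U" shows "smooth_on U (\<lambda>y. to_rho y $ a)"
proof (cases a)
  case None
  have "smooth_on U (\<lambda>y. (-1/2) * (y $ None)\<^sup>2)" by (intro smooth_intros assms)
  then show ?thesis by (simp add: None to_rho_component)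
qed (simp add: to_rho_component smooth_on_coord)

lemma continuous_on_to_rho: "continuous_on S to_rho"
proof -
  have "(\<lambda>y. to_rho y $ a) differentiable (at y)" for y and a :: "'n::finite option"
    using smooth_on_differentiable[OF smooth_on_to_rho_component[of UNIV]] by simp
  then show ?thesis
    by (intro continuous_at_imp_continuous_on ballI has_derivative_continuous[OF differentiable_vec])
qed

lemma pd_to_rho:
  assumes "F differentiable (at (to_rho y))"
  shows "(\<lambda>y. F (to_rho y)) differentiable (at y)"
    "pd (Some i) (\<lambda>y. F (to_rho y)) y = pd (Some i) F (to_rho y)"
    "pd None (\<lambda>y. F (to_rho y)) y = - (y $ None) * pd None F (to_rho y)"
proof -
  have d: "(\<lambda>y. to_rho y $ a) differentiable (at y)" for a
    using smooth_on_differentiable[OF smooth_on_to_rho_component[of UNIV]] by simp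
  have c: "(\<lambda>y. y $ None) differentiable (at y)" for y :: "real^('b::finite option)"
    using smooth_on_differentiable[OF smooth_on_coord[of UNIV]] by simp
  have N: "pd a (\<lambda>y. to_rho y $ None) y = (if a = None then - (y $ None) else 0)" for a
  proof -
    have "pd a (\<lambda>y. to_rho y $ None) y = pd a (\<lambda>y. (-1/2) * (y $ None * y $ None)) y"
      by (simp add: to_rho_component power2_eq_square)
    also have "\<dots> = (-1/2) * pd a (\<lambda>y. y $ None * y $ None) y"
      by (rule pd_cmult) (intro differentiable_mult c)
    also have "pd a (\<lambda>y. y $ None * y $ None) y = (if a = None then 2 * y $ None else 0)"
      by (subst pd_mult[OF c c]) (simp add: pd_coord)
    finally show ?thesis by simp
  qed
  show "(\<lambda>y. F (to_rho y)) differentiable (at y)" by (rule pd_compose(1)[OF d assms])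
  show "pd (Some i) (\<lambda>y. F (to_rho y)) y = pd (Some i) F (to_rho y)"
    "pd None (\<lambda>y. F (to_rho y)) y = - (y $ None) * pd None F (to_rho y)"
    unfolding pd_compose(2)[OF d assms]
    by (simp_all add: sum_option N to_rho_component(2) pd_coord if_distrib cong: if_cong)
qed

lemma pd_radial_mult:
  assumes F: "F differentiable (at (to_rho y))" and \<phi>: "(\<phi> has_real_derivative d) (at (y $ None))"
  shows "(\<lambda>y. \<phi> (y $ None) * F (to_rho y)) differentiable (at y)"
    "pd (Some i) (\<lambda>y. \<phi> (y $ None) * F (to_rho y)) y = \<phi> (y $ None) * pd (Some i) F (to_rho y)"
    "pd None (\<lambda>y. \<phi> (y $ None) * F (to_rho y)) y = d * F (to_rho y) - \<phi> (y $ None) * (y $ None) * pd None F (to_rho y)"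
proof -
  have c: "(\<lambda>y. y $ None) differentiable (at y)"
    using smooth_on_differentiable[OF smooth_on_coord[of UNIV]] by simp
  note 1 = pd_compose_real(1)[OF c \<phi>] and 2 = pd_compose_real(2)[OF c \<phi>] and 3 = pd_to_rho[OF F]
  show "(\<lambda>y. \<phi> (y $ None) * F (to_rho y)) differentiable (at y)" using 1 3(1) by (rule differentiable_mult)
  show "pd (Some i) (\<lambda>y. \<phi> (y $ None) * F (to_rho y)) y = \<phi> (y $ None) * pd (Some i) F (to_rho y)"
    "pd None (\<lambda>y. \<phi> (y $ None) * F (to_rho y)) y = d * F (to_rho y) - \<phi> (y $ None) * (y $ None) * pd None F (to_rho y)"
    by (simp_all add: pd_mult[OF 1 3(1)] 2 3 pd_coord)
qed

definition rho_family :: "(real^('n::finite option) \<Rightarrow> real^'n^'n) \<Rightarrow> real^'n \<Rightarrow> real \<Rightarrow> real^'n^'n" where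
  "rho_family G x r = G (adjoin (- r\<^sup>2 / 2) x)"

abbreviation (input) "gplus_rho G \<equiv> gplus (rho_family G)"

definition rho_domain :: "(real^('n::finite option)) set \<Rightarrow> (real^('n option)) set" where
  "rho_domain W = {y. y $ None > 0 \<and> to_rho y \<in> W}"

text \<open>The endomorphism \<open>B = g\<^sup>-\<^sup>1 g'\<close>, where the prime is the derivative in \<open>\<rho>\<close>. Its trace \<open>\<theta>\<close> is the logarithmic
  derivative of \<open>det g\<close>.\<close>

definition rate :: "(real^('n::finite option) \<Rightarrow> real^'n^'n) \<Rightarrow> real^('n option) \<Rightarrow> real^'n^'n" where
  "rate G y = matrix_inv (G y) ** mpd None G y"

context
  fixes W :: "(real^('n::finite option)) set" and G :: "real^('n option) \<Rightarrow> real^'n^'n"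
  assumes G: "metric_on W G"
begin

private lemma openW_ein: "open W"
  using G by (rule metric_onD)

private lemmas smooth_G_ein = metric_on_smooth_mat[OF G]
private lemmas smooth_Ginv_ein = metric_on_inverse_smooth_mat[OF G]


lemma mpd_metric_symmetric:
  assumes "z \<in> W" shows "transpose (mpd a G z) = mpd a G z"
proof -
  have "mpd a (\<lambda>y. transpose (G y)) z = mpd a G z"
    by (rule mpd_cong[OF openW_ein assms]) (rule metric_on_symmetric[OF G])
  then show ?thesis by (simp add: mpd_transpose)
qed

lemma family_conn_sym:
  assumes "z \<in> W" shows "family_conn G k i j z = family_conn G k j i z"
proof -
  have z: "adjoin (z $ None) (base z) \<in> W" using assms by simp
  then have "base z \<in> slice W (z $ None)" by (simp add: slice_def)
  from christoffel_sym[OF metric_on_slice[OF G] this, of k i j] show ?thesis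
    by (simp add: christoffel_slice[OF G z])
qed

lemma open_rho_domain: "open (rho_domain W)"
proof -
  have "open (to_rho -` W)" by (rule open_vimage[OF openW_ein continuous_on_to_rho])
  moreover have "open {y :: real^('n option). 0 < y $ None}"
    by (intro open_Collect_less continuous_intros)
  moreover have "rho_domain W = {y. 0 < y $ None} \<inter> to_rho -` W" by (auto simp: rho_domain_def)
  ultimately show ?thesis by (simp add: open_Int)
qed

lemma gplus_component:
  "(gplus_rho G) y $ None $ None = (1 / (y $ None)\<^sup>2) * 1"
  "(gplus_rho G) y $ None $ Some j = 0" "(gplus_rho G) y $ Some i $ None = 0"
  "(gplus_rho G) y $ Some i $ Some j = (1 / (y $ None)\<^sup>2) * G (to_rho y) $ i $ j"
  by (simp_all add: gplus_def rho_family_def to_rho_def)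

lemma smooth_mat_rate: "smooth_mat W (rate G)"
  unfolding rate_def[abs_def] by (intro smooth_mat_intros openW_ein smooth_G_ein smooth_Ginv_ein)

context
  fixes y :: "real^('n option)"
  assumes y: "y \<in> rho_domain W"
begin

private lemma r_pos_ein: "y $ None > 0" and rho_in_W_ein: "to_rho y \<in> W"
  using y by (auto simp: rho_domain_def)

private lemma diff_G_ein: "(\<lambda>y. G y $ i $ j) differentiable (at (to_rho y))"
  by (rule smooth_mat_component_differentiable[OF smooth_G_ein rho_in_W_ein])

private lemma deriv_ein: "((\<lambda>r. 1 / r\<^sup>2) has_real_derivative - 2 / (y $ None) ^ 3) (at (y $ None))"
  using r_pos_ein by (auto intro!: derivative_eq_intros simp: power2_eq_square power3_eq_cube field_simps)

lemma pd_gplus: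
  "pd None (\<lambda>y. (gplus_rho G) y $ Some i $ Some j) y = - 2 / (y $ None) ^ 3 * G (to_rho y) $ i $ j - 1 / (y $ None) * mpd None G (to_rho y) $ i $ j"
  "pd (Some k) (\<lambda>y. (gplus_rho G) y $ Some i $ Some j) y = (1 / (y $ None)\<^sup>2) * pd (Some k) (\<lambda>y. G y $ i $ j) (to_rho y)"
  "pd None (\<lambda>y. (gplus_rho G) y $ None $ None) y = - 2 / (y $ None) ^ 3"
  "pd (Some k) (\<lambda>y. (gplus_rho G) y $ None $ None) y = 0"
  "pd a (\<lambda>y. (gplus_rho G) y $ None $ Some j) y = 0" "pd a (\<lambda>y. (gplus_rho G) y $ Some i $ None) y = 0"
  unfolding gplus_component
  using r_pos_ein by (simp_all only: pd_radial_mult[OF diff_G_ein deriv_ein] pd_radial_mult[OF differentiable_const deriv_ein] pd_const mpd_component)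
     (simp_all add: power2_eq_square)

lemma inverse_gplus:
  "matrix_inv ((gplus_rho G) y) = (\<chi> a b. case (a, b) of (None, None) \<Rightarrow> (y $ None)\<^sup>2
     | (Some i, Some j) \<Rightarrow> (y $ None)\<^sup>2 * matrix_inv (G (to_rho y)) $ i $ j | _ \<Rightarrow> 0)"
    (is "_ = ?N")
proof (rule matrix_inv_unique(1))
  have "(\<Sum>k\<in>UNIV. G (to_rho y) $ i $ k * matrix_inv (G (to_rho y)) $ k $ j) = (if i = j then 1 else 0)" for i j
    using metric_on_inverse(1)[OF G rho_in_W_ein] by (simp add: vec_eq_iff matrix_mult_component mat_def)
  then show "(gplus_rho G) y ** ?N = mat 1"
    using r_pos_ein by (simp add: vec_eq_iff matrix_mult_component sum_option gplus_component mat_def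
        split_option_all sum_distrib_left[symmetric] split: option.split)
qed

lemma christoffel_gplus:
  "christoffel (gplus_rho G) None None None y = - 1 / (y $ None)"
  "christoffel (gplus_rho G) None None (Some j) y = 0" "christoffel (gplus_rho G) None (Some i) None y = 0"
  "christoffel (gplus_rho G) None (Some i) (Some j) y = 1 / (y $ None) * G (to_rho y) $ i $ j + (y $ None) / 2 * mpd None G (to_rho y) $ i $ j"
  "christoffel (gplus_rho G) (Some k) None None y = 0"
  "christoffel (gplus_rho G) (Some k) None (Some j) y = (if k = j then - 1 / (y $ None) else 0) - (y $ None) / 2 * rate G (to_rho y) $ k $ j"
  "christoffel (gplus_rho G) (Some k) (Some j) None y = (if k = j then - 1 / (y $ None) else 0) - (y $ None) / 2 * rate G (to_rho y) $ k $ j"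
  "christoffel (gplus_rho G) (Some k) (Some i) (Some j) y = family_conn G k i j (to_rho y)"
proof -
  have *: "(\<Sum>l\<in>UNIV. (y $ None)\<^sup>2 * matrix_inv (G (to_rho y)) $ k $ l * (- 2 / (y $ None) ^ 3 * G (to_rho y) $ l $ j - 1 / (y $ None) * mpd None G (to_rho y) $ l $ j)) / 2
     = (if k = j then - 1 / (y $ None) else 0) - (y $ None) / 2 * rate G (to_rho y) $ k $ j" for k j
  proof -
    have "(\<Sum>l\<in>UNIV. matrix_inv (G (to_rho y)) $ k $ l * G (to_rho y) $ l $ j) = (if k = j then 1 else 0)"
      using metric_on_inverse(2)[OF G rho_in_W_ein] by (simp add: vec_eq_iff matrix_mult_component mat_def)
    moreover have "(\<Sum>l\<in>UNIV. (y $ None)\<^sup>2 * matrix_inv (G (to_rho y)) $ k $ l * (- 2 / (y $ None) ^ 3 * G (to_rho y) $ l $ j - 1 / (y $ None) * mpd None G (to_rho y) $ l $ j)) / 2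
      = - 1 / (y $ None) * (\<Sum>l\<in>UNIV. matrix_inv (G (to_rho y)) $ k $ l * G (to_rho y) $ l $ j)
        - (y $ None) / 2 * (\<Sum>l\<in>UNIV. matrix_inv (G (to_rho y)) $ k $ l * mpd None G (to_rho y) $ l $ j)"
      unfolding sum_divide_distrib sum_distrib_left sum_subtractf[symmetric]
      using r_pos_ein by (intro sum.cong refl) (simp add: power2_eq_square power3_eq_cube field_simps)
    ultimately show ?thesis by (simp add: rate_def matrix_mult_component)
  qed
  show "christoffel (gplus_rho G) None None None y = - 1 / (y $ None)"
  "christoffel (gplus_rho G) None None (Some j) y = 0" "christoffel (gplus_rho G) None (Some i) None y = 0"
  "christoffel (gplus_rho G) None (Some i) (Some j) y = 1 / (y $ None) * G (to_rho y) $ i $ j + (y $ None) / 2 * mpd None G (to_rho y) $ i $ j"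
  "christoffel (gplus_rho G) (Some k) None None y = 0"
    unfolding christoffel_def sum_option inverse_gplus
    using r_pos_ein by (simp_all add: pd_gplus power2_eq_square power3_eq_cube field_simps)
  have sG: "G (to_rho y) $ j $ l = G (to_rho y) $ l $ j" "mpd None G (to_rho y) $ j $ l = mpd None G (to_rho y) $ l $ j" for l
    using metric_onD(4)[OF G rho_in_W_ein] pd_cong[OF openW_ein rho_in_W_ein, of "\<lambda>y. G y $ j $ l" "\<lambda>y. G y $ l $ j"] metric_onD(4)[OF G]
    by (simp_all add: mpd_component)
  show "christoffel (gplus_rho G) (Some k) None (Some j) y = (if k = j then - 1 / (y $ None) else 0) - (y $ None) / 2 * rate G (to_rho y) $ k $ j"
    unfolding christoffel_def sum_option inverse_gplus *[symmetric]
    using r_pos_ein by (simp add: pd_gplus sG)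
  show "christoffel (gplus_rho G) (Some k) (Some j) None y = (if k = j then - 1 / (y $ None) else 0) - (y $ None) / 2 * rate G (to_rho y) $ k $ j"
    unfolding christoffel_def sum_option inverse_gplus *[symmetric]
    using r_pos_ein by (simp add: pd_gplus sG)
  show "christoffel (gplus_rho G) (Some k) (Some i) (Some j) y = family_conn G k i j (to_rho y)"
    unfolding christoffel_def sum_option inverse_gplus family_conn_def
    using r_pos_ein by (simp add: pd_gplus algebra_simps power2_eq_square)
qed

end

text \<open>In each component of the Ricci tensor the terms that are singular at \<open>r = 0\<close> add up to minus \<open>n\<close> times the metric,
  and what remains is a power of \<open>r\<close> times a smooth function of \<open>\<rho>\<close>.\<close>

context
  fixes y :: "real^('n option)"
  assumes y: "y \<in> rho_domain W"
begin

private lemma r_pos2_ein: "y $ None > 0" and rho_in_W2_ein: "to_rho y \<in> W"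
  using y by (auto simp: rho_domain_def)

private lemma diff_rate_ein: "(\<lambda>y. rate G y $ i $ j) differentiable (at (to_rho y))"
  by (rule smooth_mat_component_differentiable[OF smooth_mat_rate rho_in_W2_ein])

private lemma diff_G2_ein: "(\<lambda>y. G y $ i $ j) differentiable (at (to_rho y))"
  "(\<lambda>y. mpd None G y $ i $ j) differentiable (at (to_rho y))"
  by (rule smooth_mat_component_differentiable[OF _ rho_in_W2_ein]; intro smooth_mat_intros smooth_G_ein)+

private lemma diff_coord_ein: "(\<lambda>y. y $ None) differentiable (at y)"
  using smooth_on_differentiable[OF smooth_on_coord[of UNIV]] by simp

private lemma deriv2_ein: "((\<lambda>r. - 1 / r) has_real_derivative 1 / (y $ None)\<^sup>2) (at (y $ None))"
  "((\<lambda>r. 1 / r) has_real_derivative - 1 / (y $ None)\<^sup>2) (at (y $ None))"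
  "((\<lambda>r. r / 2) has_real_derivative 1 / 2) (at (y $ None))"
  using r_pos2_ein by (auto intro!: derivative_eq_intros simp: power2_eq_square)

lemma pd_christoffel_gplus_None:
  "pd None (christoffel (gplus_rho G) None None None) y = 1 / (y $ None)\<^sup>2"
  "pd (Some k) (christoffel (gplus_rho G) None None None) y = 0"
  "pd a (christoffel (gplus_rho G) None None (Some j)) y = 0" "pd a (christoffel (gplus_rho G) None (Some j) None) y = 0"
  "pd a (christoffel (gplus_rho G) (Some k) None None) y = 0"
proof -
  have e: "pd a (christoffel (gplus_rho G) None None None) y = pd a (\<lambda>y. - 1 / (y $ None)) y" for a
    by (rule pd_cong[OF open_rho_domain y]) (rule christoffel_gplus)
  show "pd None (christoffel (gplus_rho G) None None None) y = 1 / (y $ None)\<^sup>2"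
    "pd (Some k) (christoffel (gplus_rho G) None None None) y = 0"
    unfolding e pd_compose_real(2)[OF diff_coord_ein deriv2_ein(1)] by (simp_all add: pd_coord)
  have "pd a (christoffel (gplus_rho G) None None (Some j)) y = pd a (\<lambda>y. 0) y"
    "pd a (christoffel (gplus_rho G) None (Some j) None) y = pd a (\<lambda>y. 0) y"
    "pd a (christoffel (gplus_rho G) (Some k) None None) y = pd a (\<lambda>y. 0) y"
    by (rule pd_cong[OF open_rho_domain y], erule christoffel_gplus)+
  then show "pd a (christoffel (gplus_rho G) None None (Some j)) y = 0" "pd a (christoffel (gplus_rho G) None (Some j) None) y = 0"
    "pd a (christoffel (gplus_rho G) (Some k) None None) y = 0" by simp_all
qed

lemma pd_christoffel_gplus_mixed:
  "pd None (christoffel (gplus_rho G) (Some k) (Some j) None) y = (if k = j then 1 / (y $ None)\<^sup>2 else 0)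
     - 1 / 2 * rate G (to_rho y) $ k $ j + (y $ None)\<^sup>2 / 2 * mpd None (rate G) (to_rho y) $ k $ j"
  "pd (Some i) (christoffel (gplus_rho G) (Some k) (Some j) None) y = - (y $ None) / 2 * mpd (Some i) (rate G) (to_rho y) $ k $ j"
proof -
  have e: "pd a (christoffel (gplus_rho G) (Some k) (Some j) None) y
    = pd a (\<lambda>y. (if k = j then 1 else 0) * (- 1 / (y $ None)) - (y $ None) / 2 * rate G (to_rho y) $ k $ j) y" for a
    by (rule pd_cong[OF open_rho_domain y]) (simp add: christoffel_gplus)
  note d1 = pd_compose_real[OF diff_coord_ein deriv2_ein(1)] and d2 = pd_radial_mult[OF diff_rate_ein deriv2_ein(3)]
  have d3: "(\<lambda>y. (if k = j then 1 else 0) * (- 1 / (y $ None))) differentiable (at y)"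
    by (rule differentiable_mult[OF differentiable_const d1(1)])
  show "pd None (christoffel (gplus_rho G) (Some k) (Some j) None) y = (if k = j then 1 / (y $ None)\<^sup>2 else 0)
     - 1 / 2 * rate G (to_rho y) $ k $ j + (y $ None)\<^sup>2 / 2 * mpd None (rate G) (to_rho y) $ k $ j"
  "pd (Some i) (christoffel (gplus_rho G) (Some k) (Some j) None) y = - (y $ None) / 2 * mpd (Some i) (rate G) (to_rho y) $ k $ j"
    unfolding e pd_diff[OF d3 d2(1)] pd_cmult[OF d1(1)] d1(2) d2(2,3)
    by (simp_all add: pd_coord mpd_component power2_eq_square)
qed

lemma pd_christoffel_gplus_tangential:
  "pd None (christoffel (gplus_rho G) None (Some i) (Some j)) y = - 1 / (y $ None)\<^sup>2 * G (to_rho y) $ i $ j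
     - 1 / 2 * mpd None G (to_rho y) $ i $ j - (y $ None)\<^sup>2 / 2 * mpd None (mpd None G) (to_rho y) $ i $ j"
  "pd (Some l) (christoffel (gplus_rho G) (Some k) (Some i) (Some j)) y = pd (Some l) (family_conn G k i j) (to_rho y)"
proof -
  have e: "pd None (christoffel (gplus_rho G) None (Some i) (Some j)) y
    = pd None (\<lambda>y. 1 / (y $ None) * G (to_rho y) $ i $ j + (y $ None) / 2 * mpd None G (to_rho y) $ i $ j) y"
    by (rule pd_cong[OF open_rho_domain y]) (rule christoffel_gplus)
  note d1 = pd_radial_mult[OF diff_G2_ein(1) deriv2_ein(2)] and d2 = pd_radial_mult[OF diff_G2_ein(2) deriv2_ein(3)]
  show "pd None (christoffel (gplus_rho G) None (Some i) (Some j)) y = - 1 / (y $ None)\<^sup>2 * G (to_rho y) $ i $ j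
     - 1 / 2 * mpd None G (to_rho y) $ i $ j - (y $ None)\<^sup>2 / 2 * mpd None (mpd None G) (to_rho y) $ i $ j"
    unfolding e pd_add[OF d1(1) d2(1)] d1(3) d2(3)
    using r_pos2_ein by (simp add: mpd_component power2_eq_square)
  have "pd (Some l) (christoffel (gplus_rho G) (Some k) (Some i) (Some j)) y = pd (Some l) (\<lambda>y. family_conn G k i j (to_rho y)) y"
    by (rule pd_cong[OF open_rho_domain y]) (rule christoffel_gplus)
  then show "pd (Some l) (christoffel (gplus_rho G) (Some k) (Some i) (Some j)) y = pd (Some l) (family_conn G k i j) (to_rho y)"
    using pd_to_rho(2)[OF smooth_on_differentiable[OF smooth_on_family_conn[OF G] rho_in_W2_ein]] by simp
qed

lemma ricci_gplus_None_None:
  "ricci (gplus_rho G) y $ None $ None = - real CARD('n) / (y $ None)\<^sup>2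
     - (y $ None)\<^sup>2 / 2 * (trace (mpd None (rate G) (to_rho y)) + trace (rate G (to_rho y) ** rate G (to_rho y)) / 2)"
proof -
  let ?B = "rate G (to_rho y)" and ?r = "y $ None"
  have 1: "(\<Sum>m\<in>UNIV. ((if a = m then - 1 / ?r else 0) - ?r / 2 * ?B $ a $ m) * ((if m = a then - 1 / ?r else 0) - ?r / 2 * ?B $ m $ a))
     = 1 / ?r\<^sup>2 + ?B $ a $ a + ?r\<^sup>2 / 4 * (\<Sum>m\<in>UNIV. ?B $ a $ m * ?B $ m $ a)" for a
  proof -
    have "((if a = m then - 1 / ?r else 0) - ?r / 2 * ?B $ a $ m) * ((if m = a then - 1 / ?r else 0) - ?r / 2 * ?B $ m $ a)
       = (if m = a then 1 / ?r\<^sup>2 + ?B $ a $ a else 0) + ?r\<^sup>2 / 4 * (?B $ a $ m * ?B $ m $ a)" for m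
      using r_pos2_ein by (auto simp: power2_eq_square field_simps)
    then show ?thesis by (simp add: sum.distrib sum_distrib_left)
  qed
  have "ricci (gplus_rho G) y $ None $ None = (\<Sum>a\<in>UNIV. - (1 / ?r\<^sup>2 - 1 / 2 * ?B $ a $ a + ?r\<^sup>2 / 2 * mpd None (rate G) (to_rho y) $ a $ a)
      + (- 1 / ?r - ?r / 2 * ?B $ a $ a) * (- 1 / ?r)
      - (\<Sum>m\<in>UNIV. ((if a = m then - 1 / ?r else 0) - ?r / 2 * ?B $ a $ m) * ((if m = a then - 1 / ?r else 0) - ?r / 2 * ?B $ m $ a)))"
    by (simp add: ricci_def riemann_up_def sum_option pd_christoffel_gplus_None pd_christoffel_gplus_mixed christoffel_gplus[OF y] sum_negf add_diff_eq)
  also have "\<dots> = (\<Sum>a\<in>UNIV. - 1 / ?r\<^sup>2 - ?r\<^sup>2 / 2 * mpd None (rate G) (to_rho y) $ a $ a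
      - ?r\<^sup>2 / 4 * (\<Sum>m\<in>UNIV. ?B $ a $ m * ?B $ m $ a))"
    unfolding 1 using r_pos2_ein by (intro sum.cong refl) (simp add: power2_eq_square field_simps)
  finally have "ricci (gplus_rho G) y $ None $ None = (\<Sum>a\<in>UNIV. - 1 / ?r\<^sup>2 - ?r\<^sup>2 / 2 * mpd None (rate G) (to_rho y) $ a $ a
      - ?r\<^sup>2 / 4 * (\<Sum>m\<in>UNIV. ?B $ a $ m * ?B $ m $ a))" .
  then show ?thesis
    unfolding sum_subtractf sum_distrib_left[symmetric]
    by (simp add: trace_def matrix_mult_component algebra_simps)
qed

lemma ricci_gplus_None_Some:
  "ricci (gplus_rho G) y $ None $ Some a = - (y $ None) / 2 *
     ((\<Sum>i\<in>UNIV. mpd (Some i) (rate G) (to_rho y) $ i $ a)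
      + (\<Sum>i\<in>UNIV. \<Sum>m\<in>UNIV. family_conn G i i m (to_rho y) * rate G (to_rho y) $ m $ a
           - family_conn G i a m (to_rho y) * rate G (to_rho y) $ m $ i)
      - trace (mpd (Some a) (rate G) (to_rho y)))"
proof -
  let ?B = "rate G (to_rho y)" and ?r = "y $ None" and ?f = "\<lambda>k i j. family_conn G k i j (to_rho y)"
  have fs: "?f k i j = ?f k j i" for k i j
    by (rule family_conn_sym[OF rho_in_W2_ein])
  have 1: "(\<Sum>m\<in>UNIV. ?f i i m * ((if m = a then - 1 / ?r else 0) - ?r / 2 * ?B $ m $ a)
         - ?f i a m * ((if m = i then - 1 / ?r else 0) - ?r / 2 * ?B $ m $ i))
       = - ?r / 2 * (\<Sum>m\<in>UNIV. ?f i i m * ?B $ m $ a - ?f i a m * ?B $ m $ i)" for i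
  proof -
    have "(\<Sum>m\<in>UNIV. ?f i i m * ((if m = a then - 1 / ?r else 0) - ?r / 2 * ?B $ m $ a)
         - ?f i a m * ((if m = i then - 1 / ?r else 0) - ?r / 2 * ?B $ m $ i))
      = (\<Sum>m\<in>UNIV. (if m = a then - ?f i i a / ?r else 0) - (if m = i then - ?f i a i / ?r else 0)
         + - ?r / 2 * (?f i i m * ?B $ m $ a - ?f i a m * ?B $ m $ i))"
      by (intro sum.cong refl) (auto simp: field_simps)
    also have "\<dots> = - ?r / 2 * (\<Sum>m\<in>UNIV. ?f i i m * ?B $ m $ a - ?f i a m * ?B $ m $ i)"
      unfolding sum.distrib sum_subtractf sum_distrib_left[symmetric] using fs[of i i a] by simp
    finally show ?thesis .
  qed
  have "ricci (gplus_rho G) y $ None $ Some a = (\<Sum>i\<in>UNIV. - ?r / 2 * mpd (Some i) (rate G) (to_rho y) $ i $ a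
      + ?r / 2 * mpd (Some a) (rate G) (to_rho y) $ i $ i
      + - ?r / 2 * (\<Sum>m\<in>UNIV. ?f i i m * ?B $ m $ a - ?f i a m * ?B $ m $ i))"
    unfolding 1[symmetric]
    by (simp add: ricci_def riemann_up_def sum_option pd_christoffel_gplus_None pd_christoffel_gplus_mixed christoffel_gplus[OF y])
  then show ?thesis
    unfolding sum.distrib sum_distrib_left[symmetric] by (simp add: trace_def algebra_simps)
qed

lemma ricci_gplus_Some_Some:
  "ricci (gplus_rho G) y $ Some a $ Some b = family_ricci G a b (to_rho y) - real CARD('n) / (y $ None)\<^sup>2 * G (to_rho y) $ a $ b
     - (real CARD('n) / 2 - 1) * mpd None G (to_rho y) $ a $ b - trace (rate G (to_rho y)) / 2 * G (to_rho y) $ a $ b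
     - (y $ None)\<^sup>2 / 2 * (mpd None (mpd None G) (to_rho y) $ a $ b
        + trace (rate G (to_rho y)) / 2 * mpd None G (to_rho y) $ a $ b
        - (mpd None G (to_rho y) ** rate G (to_rho y)) $ a $ b)"
proof -
  let ?B = "rate G (to_rho y)" and ?r = "y $ None" and ?f = "\<lambda>k i j. family_conn G k i j (to_rho y)"
  let ?g = "G (to_rho y)" and ?g' = "mpd None G (to_rho y)"
  let ?L = "(1 / ?r) *\<^sub>R ?g + (?r / 2) *\<^sub>R ?g'"
  have gs: "transpose ?g = ?g" by (rule metric_on_symmetric[OF G rho_in_W2_ein])
  have gs': "transpose ?g' = ?g'"
    by (rule mpd_metric_symmetric[OF rho_in_W2_ein])
  have gB: "?g ** ?B = ?g'" by (simp add: rate_def matrix_mul_assoc metric_on_inverse[OF G rho_in_W2_ein])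
  have LB: "?L ** ?B = (1 / ?r) *\<^sub>R ?g' + (?r / 2) *\<^sub>R (?g' ** ?B)" by (simp add: matrix_algebra gB)
  have g'B: "transpose (?g' ** ?B) = ?g' ** ?B"
    by (simp add: rate_def matrix_transpose_mul gs' metric_on_inverse_symmetric[OF G rho_in_W2_ein] matrix_mul_assoc)
  have BL: "transpose ?B ** ?L = ?L ** ?B"
  proof -
    have "transpose ?B ** ?L = transpose (?L ** ?B)" by (simp add: matrix_transpose_mul transpose_algebra gs gs')
    also have "\<dots> = ?L ** ?B" unfolding LB by (simp only: transpose_add transpose_scale gs' g'B)
    finally show ?thesis .
  qed
  have Ls: "?L $ i $ j = ?L $ j $ i" for i j
    using gs gs' by (metis transpose_component transpose_add transpose_scale)
  have gen: "l * ((if p then - 1 / ?r else 0) - ?r / 2 * c) = (if p then - l / ?r else 0) - ?r / 2 * (l * c)" for l c p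
    by (simp add: algebra_simps)
  have 1: "(\<Sum>m\<in>UNIV. ?L $ b $ m * ((if m = a then - 1 / ?r else 0) - ?r / 2 * ?B $ m $ a))
     = - ?L $ b $ a / ?r - ?r / 2 * (?L ** ?B) $ b $ a"
  proof -
    have "(\<Sum>m\<in>UNIV. ?L $ b $ m * ((if m = a then - 1 / ?r else 0) - ?r / 2 * ?B $ m $ a))
      = (\<Sum>m\<in>UNIV. (if m = a then - ?L $ b $ m / ?r else 0) - ?r / 2 * (?L $ b $ m * ?B $ m $ a))"
      by (simp only: gen)
    then show ?thesis unfolding sum_subtractf sum_distrib_left[symmetric] matrix_mult_component
      by (simp only: sum.delta finite UNIV_I if_True)
  qed
  have 2: "(\<Sum>i\<in>UNIV. ((if i = b then - 1 / ?r else 0) - ?r / 2 * ?B $ i $ b) * ?L $ i $ a)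
     = - ?L $ b $ a / ?r - ?r / 2 * (?L ** ?B) $ b $ a"
  proof -
    have "(\<Sum>i\<in>UNIV. ((if i = b then - 1 / ?r else 0) - ?r / 2 * ?B $ i $ b) * ?L $ i $ a)
      = (\<Sum>i\<in>UNIV. (if i = b then - ?L $ i $ a / ?r else 0) - ?r / 2 * (transpose ?B $ b $ i * ?L $ i $ a))"
      by (simp only: gen mult.commute[of _ "?L $ _ $ a"] transpose_component)
    then show ?thesis unfolding sum_subtractf sum_distrib_left[symmetric] BL[symmetric] matrix_mult_component
      by (simp only: sum.delta finite UNIV_I if_True)
  qed
  have L: "1 / ?r * ?g $ i $ j + ?r / 2 * ?g' $ i $ j = ?L $ i $ j" for i j by simp
  have ric: "ricci (gplus_rho G) y $ Some a $ Some b = pd None (christoffel (gplus_rho G) None (Some b) (Some a)) y + (- 1 / ?r) * ?L $ b $ a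
      - (\<Sum>m\<in>UNIV. ?L $ b $ m * ((if m = a then - 1 / ?r else 0) - ?r / 2 * ?B $ m $ a))
      + family_ricci G a b (to_rho y)
      + (\<Sum>i\<in>UNIV. (- 1 / ?r - ?r / 2 * ?B $ i $ i) * ?L $ b $ a)
      - (\<Sum>i\<in>UNIV. ((if i = b then - 1 / ?r else 0) - ?r / 2 * ?B $ i $ b) * ?L $ i $ a)"
    unfolding L[symmetric]
    by (simp add: ricci_def riemann_up_def sum_option pd_christoffel_gplus_None pd_christoffel_gplus_tangential(2) christoffel_gplus[OF y]
       family_ricci_def sum.distrib sum_subtractf sum_negf)
  have tB: "(\<Sum>i\<in>UNIV. (- 1 / ?r - ?r / 2 * ?B $ i $ i)) = - real CARD('n) / ?r - ?r / 2 * trace ?B"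
    by (simp add: sum_subtractf trace_def sum_distrib_left)
  have gba: "?g $ b $ a = ?g $ a $ b" "?g' $ b $ a = ?g' $ a $ b" "(?g' ** ?B) $ b $ a = (?g' ** ?B) $ a $ b"
     "mpd None (mpd None G) (to_rho y) $ b $ a = mpd None (mpd None G) (to_rho y) $ a $ b"
  proof -
    have "mpd None (\<lambda>y. transpose (mpd None G y)) (to_rho y) = mpd None (mpd None G) (to_rho y)"
      by (rule mpd_cong[OF openW_ein rho_in_W2_ein]) (rule mpd_metric_symmetric)
    then have gs'': "transpose (mpd None (mpd None G) (to_rho y)) = mpd None (mpd None G) (to_rho y)"
      by (simp add: mpd_transpose)
    show "?g $ b $ a = ?g $ a $ b" "?g' $ b $ a = ?g' $ a $ b" "(?g' ** ?B) $ b $ a = (?g' ** ?B) $ a $ b"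
     "mpd None (mpd None G) (to_rho y) $ b $ a = mpd None (mpd None G) (to_rho y) $ a $ b"
      using gs gs' gs'' g'B by (metis transpose_component)+
  qed
  show ?thesis
    unfolding ric 1 2 sum_distrib_right[symmetric] tB LB pd_christoffel_gplus_tangential(1)
    using r_pos2_ein by (simp add: gba field_simps power2_eq_square)
qed

end

end


section \<open>The Taylor coefficients of a Poincare-Einstein metric\<close>

lemma ricci_cong:
  assumes N: "open N" "y \<in> N" and eq: "\<And>z. z \<in> N \<Longrightarrow> g z = g' z"
  shows "ricci g y = ricci g' y"
proof -
  have c: "christoffel g k i j z = christoffel g' k i j z" if z: "z \<in> N" for k i j z
  proof -
    have "pd a (\<lambda>y. g y $ b $ c) z = pd a (\<lambda>y. g' y $ b $ c) z" for a b c
      by (rule pd_cong[OF N(1) z]) (simp add: eq)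
    then show ?thesis by (simp add: christoffel_def eq[OF z])
  qed
  have "pd a (christoffel g k i j) y = pd a (christoffel g' k i j) y" for a k i j
    by (rule pd_cong[OF N c])
  then show ?thesis by (simp add: ricci_def riemann_up_def c[OF N(2)])
qed

text \<open>The form in which orders of vanishing in \<open>r\<close> are used: a function that is \<open>r\<^sup>k\<close> times a convergent one and vanishes
  to a higher order has limit zero.\<close>

lemma limit_zero_of_bigo:
  fixes \<psi> :: "real \<Rightarrow> real"
  assumes lim: "(\<psi> \<longlongrightarrow> L) (at_right 0)" and O: "f \<in> O[at_right 0](\<lambda>r. r ^ m)"
    and eq: "\<forall>\<^sub>F r in at_right 0. f r = r ^ k * \<psi> r" and km: "k < m"
  shows "L = 0"
proof -
  obtain C where C: "\<forall>\<^sub>F r in at_right 0. norm (f r) \<le> C * norm (r ^ m)"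
    using landau_o.bigE[OF O] by blast
  have pos: "\<forall>\<^sub>F r::real in at_right 0. r > 0" by (simp add: eventually_at_right_less)
  have "\<forall>\<^sub>F r in at_right 0. norm (\<psi> r) \<le> C * r ^ (m - k)"
    using C eq pos
  proof eventually_elim
    case (elim r)
    have "r ^ m = r ^ k * r ^ (m - k)" using km by (simp flip: power_add)
    then have "r ^ k * \<bar>\<psi> r\<bar> \<le> r ^ k * (C * r ^ (m - k))"
      using elim by (simp add: abs_mult mult_ac)
    then show ?case using elim(3) by simp
  qed
  moreover have "((\<lambda>r. C * r ^ (m - k)) \<longlongrightarrow> 0) (at_right 0)"
  proof -
    have "((\<lambda>r. C * r ^ (m - k)) \<longlongrightarrow> C * 0 ^ (m - k)) (at_right 0)"
      by (intro tendsto_intros)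
    moreover have "C * 0 ^ (m - k) = 0" using km by (simp add: power_0_left)
    ultimately show ?thesis by simp
  qed
  ultimately have "(\<psi> \<longlongrightarrow> 0) (at_right 0)" by (rule Lim_null_comparison)
  then show ?thesis using lim tendsto_unique by (metis trivial_limit_at_right_real)
qed

lemma tendsto_along_rho:
  assumes "(F :: real^('n::finite option) \<Rightarrow> real) differentiable (at (adjoin 0 x))"
  shows "((\<lambda>r. F (adjoin (- r\<^sup>2 / 2) x)) \<longlongrightarrow> F (adjoin 0 x)) (at_right 0)"
    and "((\<lambda>r. (F (adjoin (- r\<^sup>2 / 2) x) - F (adjoin 0 x)) / (- r\<^sup>2 / 2)) \<longlongrightarrow> pd None F (adjoin 0 x)) (at_right 0)"
proof -
  have line: "adjoin 0 x + s *\<^sub>R axis None 1 = adjoin s x" for s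
    by (simp add: vec_eq_iff adjoin_def axis_def split: option.split)
  have D: "((\<lambda>s. F (adjoin s x)) has_real_derivative pd None F (adjoin 0 x)) (at 0)"
    using pd_along_line[of F "adjoin 0 x" 0 None] assms by (simp add: line)
  have rho: "filterlim (\<lambda>r::real. - r\<^sup>2 / 2) (at 0) (at_right 0)"
  proof (rule filterlim_atI)
    have "((\<lambda>r::real. - r\<^sup>2 / 2) \<longlongrightarrow> - 0\<^sup>2 / 2) (at_right 0)" by (intro tendsto_intros) simp
    then show "((\<lambda>r::real. - r\<^sup>2 / 2) \<longlongrightarrow> 0) (at_right 0)" by simp
    show "\<forall>\<^sub>F r::real in at_right 0. - r\<^sup>2 / 2 \<noteq> 0"
      using eventually_at_right_less[of "0::real"] by eventually_elim simp
  qed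
  have "((\<lambda>s. F (adjoin s x)) \<longlongrightarrow> F (adjoin 0 x)) (at 0)"
    using DERIV_isCont[OF D] by (simp add: isCont_def)
  then show "((\<lambda>r. F (adjoin (- r\<^sup>2 / 2) x)) \<longlongrightarrow> F (adjoin 0 x)) (at_right 0)"
    using rho by (rule filterlim_compose)
  have "((\<lambda>s. (F (adjoin s x) - F (adjoin 0 x)) / s) \<longlongrightarrow> pd None F (adjoin 0 x)) (at 0)"
    using D by (simp add: DERIV_def)
  then show "((\<lambda>r. (F (adjoin (- r\<^sup>2 / 2) x) - F (adjoin 0 x)) / (- r\<^sup>2 / 2)) \<longlongrightarrow> pd None F (adjoin 0 x)) (at_right 0)"
    using rho by (rule filterlim_compose)
qed

abbreviation (input) "initial G \<equiv> \<lambda>x. G (adjoin 0 x)"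

text \<open>The defect \<open>Ric(g\<^sub>+) + n g\<^sub>+\<close> has the tangential components \<open>einstein_tangential\<close>, the mixed components
  \<open>- r/2\<close> times \<open>einstein_mixed\<close> and the normal component \<open>- r\<^sup>2/2\<close> times \<open>einstein_normal\<close>, all taken at
  \<open>\<rho> = - r\<^sup>2/2\<close>.\<close>

definition einstein_tangential :: "(real^('n::finite option) \<Rightarrow> real^'n^'n) \<Rightarrow> 'n \<Rightarrow> 'n \<Rightarrow> real^('n option) \<Rightarrow> real" where
  "einstein_tangential G a b y = family_ricci G a b y - (real CARD('n) / 2 - 1) * mpd None G y $ a $ b
     - trace (rate G y) / 2 * G y $ a $ b
     + y $ None * (mpd None (mpd None G) y $ a $ b + trace (rate G y) / 2 * mpd None G y $ a $ b
        - (mpd None G y ** rate G y) $ a $ b)"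

definition einstein_mixed :: "(real^('n::finite option) \<Rightarrow> real^'n^'n) \<Rightarrow> 'n \<Rightarrow> real^('n option) \<Rightarrow> real" where
  "einstein_mixed G a y = (\<Sum>i\<in>UNIV. mpd (Some i) (rate G) y $ i $ a)
      + (\<Sum>i\<in>UNIV. \<Sum>m\<in>UNIV. family_conn G i i m y * rate G y $ m $ a - family_conn G i a m y * rate G y $ m $ i)
      - trace (mpd (Some a) (rate G) y)"

definition einstein_normal :: "(real^('n::finite option) \<Rightarrow> real^'n^'n) \<Rightarrow> real^('n option) \<Rightarrow> real" where
  "einstein_normal G y = trace (mpd None (rate G) y) + trace (rate G y ** rate G y) / 2"

context
  fixes W :: "(real^('n::finite option)) set" and G :: "real^('n option) \<Rightarrow> real^'n^'n"
  assumes G: "metric_on W G"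
begin

private lemma openW_tay: "open W"
  using G by (rule metric_onD)

private lemmas smooth_G_tay = metric_on_smooth_mat[OF G]
private lemmas smooth_rate_tay = smooth_mat_rate[OF G]

lemma smooth_on_einstein:
  "smooth_on W (einstein_tangential G a b)" "smooth_on W (einstein_mixed G a)" "smooth_on W (einstein_normal G)"
  unfolding einstein_tangential_def[abs_def] einstein_mixed_def[abs_def] einstein_normal_def[abs_def] divide_inverse
  by (intro smooth_intros openW_tay smooth_on_family_ricci[OF G] smooth_on_family_conn[OF G] smooth_matD smooth_mat_trace
      smooth_mat_intros smooth_G_tay smooth_rate_tay)+

text \<open>As \<open>\<rho>\<close> is quadratic in \<open>r\<close>, a defect of order \<open>r\<^sup>4\<close> forces the tangential part to vanish together with its first
  derivative in \<open>\<rho>\<close>. The prefactors \<open>r\<close> and \<open>r\<^sup>2\<close> of the mixed and the normal part leave only their values.\<close>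

lemma einstein_equations:
  assumes x: "adjoin 0 x \<in> W" and N: "open N" "adjoin 0 x \<in> N"
    and NW: "\<And>y. y \<in> N \<Longrightarrow> to_rho y \<in> W \<and> h (base y) (y $ None) = G (to_rho y)"
    and E: "\<And>a b. (\<lambda>r. einstein_defect h x r $ a $ b) \<in> O[at_right 0](\<lambda>r. r ^ 4)"
  shows "einstein_tangential G a b (adjoin 0 x) = 0" "pd None (einstein_tangential G a b) (adjoin 0 x) = 0"
    "einstein_mixed G a (adjoin 0 x) = 0" "einstein_normal G (adjoin 0 x) = 0"
proof -
  have "open {r. adjoin r x \<in> N}"
  proof -
    have "continuous_on UNIV (\<lambda>r. adjoin r x)"
    proof (rule continuous_at_imp_continuous_on, rule ballI)
      fix s
      have "adjoin 0 x + s *\<^sub>R axis None 1 = adjoin s x" for s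
        by (simp add: vec_eq_iff adjoin_def axis_def split: option.split)
      then have "(\<lambda>r. adjoin r x) = (\<lambda>s. adjoin 0 x + s *\<^sub>R axis None 1)" by auto
      then show "isCont (\<lambda>r. adjoin r x) s" by (auto intro!: continuous_intros)
    qed
    then show ?thesis using open_vimage[OF N(1)] by (simp add: vimage_def)
  qed
  then have "\<forall>\<^sub>F r in nhds 0. adjoin r x \<in> N" using N(2) by (auto intro: eventually_nhds_in_open[of "{r. adjoin r x \<in> N}", simplified])
  then have ev: "\<forall>\<^sub>F r in at_right 0. r > 0 \<and> adjoin r x \<in> N"
    by (intro eventually_conj eventually_at_right_less filter_leD[OF at_within_le_nhds])
  have eq: "einstein_defect h x r = ricci (gplus (rho_family G)) (adjoin r x) + real CARD('n) *\<^sub>R gplus (rho_family G) (adjoin r x)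
      \<and> adjoin r x \<in> rho_domain W"
    if r: "r > 0" "adjoin r x \<in> N" for r
  proof -
    have g: "gplus h y = gplus (rho_family G) y" if "y \<in> N" for y
      using NW[OF that] by (simp add: gplus_def rho_family_def to_rho_def cong: option.case_cong)
    show ?thesis
      unfolding einstein_defect_def using ricci_cong[OF N(1) r(2) g] g[OF r(2)] NW[OF r(2)] r(1) by (simp add: rho_domain_def)
  qed
  have rho: "to_rho (adjoin r x) = adjoin (- r\<^sup>2 / 2) x" for r by (simp add: to_rho_def)
  note d = smooth_on_differentiable[OF _ x]
  have T: "\<forall>\<^sub>F r in at_right 0. einstein_defect h x r $ Some a $ Some b = einstein_tangential G a b (adjoin (- r\<^sup>2 / 2) x)" for a b
    using ev
  proof eventually_elim
    case (elim r)
    then show ?case using eq[of r]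
      by (simp add: ricci_gplus_Some_Some[OF G] gplus_component[OF G] rho einstein_tangential_def)
  qed
  note lT = tendsto_along_rho[OF d[OF smooth_on_einstein(1)]]
  show T0: "einstein_tangential G a b (adjoin 0 x) = 0" for a b
    by (rule limit_zero_of_bigo[where k = 0, OF lT(1) E[of "Some a" "Some b"]]) (use T[of a b] in auto)
  have l2: "((\<lambda>r. einstein_tangential G a b (adjoin (- r\<^sup>2 / 2) x) / r\<^sup>2) \<longlongrightarrow> pd None (einstein_tangential G a b) (adjoin 0 x) * (- 1 / 2)) (at_right 0)"
    using tendsto_mult[OF lT(2) tendsto_const[of "- 1 / 2"], of a b] by (simp add: T0)
  have "pd None (einstein_tangential G a b) (adjoin 0 x) * (- 1 / 2) = 0"
  proof (rule limit_zero_of_bigo[where k = 2, OF l2 E[of "Some a" "Some b"]])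
    show "\<forall>\<^sub>F r in at_right 0. einstein_defect h x r $ Some a $ Some b = r\<^sup>2 * (einstein_tangential G a b (adjoin (- r\<^sup>2 / 2) x) / r\<^sup>2)"
      using T[of a b] ev by eventually_elim simp
  qed simp
  then show "pd None (einstein_tangential G a b) (adjoin 0 x) = 0" by simp
  have Mx: "\<forall>\<^sub>F r in at_right 0. einstein_defect h x r $ None $ Some a = r ^ 1 * (- 1 / 2 * einstein_mixed G a (adjoin (- r\<^sup>2 / 2) x))"
    using ev
  proof eventually_elim
    case (elim r)
    then show ?case using eq[of r]
      by (simp add: ricci_gplus_None_Some[OF G] gplus_component[OF G] rho einstein_mixed_def)
  qed
  have "- 1 / 2 * einstein_mixed G a (adjoin 0 x) = 0"
    by (rule limit_zero_of_bigo[OF tendsto_mult[OF tendsto_const tendsto_along_rho(1)[OF d[OF smooth_on_einstein(2)]]] E Mx]) simp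
  then show "einstein_mixed G a (adjoin 0 x) = 0" by simp
  have Nn: "\<forall>\<^sub>F r in at_right 0. einstein_defect h x r $ None $ None = r ^ 2 * (- 1 / 2 * einstein_normal G (adjoin (- r\<^sup>2 / 2) x))"
    using ev
  proof eventually_elim
    case (elim r)
    then show ?case using eq[of r]
      by (simp add: ricci_gplus_None_None[OF G] gplus_component[OF G] rho einstein_normal_def)
  qed
  have "- 1 / 2 * einstein_normal G (adjoin 0 x) = 0"
    by (rule limit_zero_of_bigo[OF tendsto_mult[OF tendsto_const tendsto_along_rho(1)[OF d[OF smooth_on_einstein(3)]]] E Nn]) simp
  then show "einstein_normal G (adjoin 0 x) = 0" by simp
qed

end

text \<open>With the first index raised, the divergence of a 2-tensor is a coordinate divergence plus connection terms:
  \<open>\<partial>\<^sub>i A = g\<^sup>-\<^sup>1 \<nabla>\<^sub>i P + A \<Gamma>\<^sub>i - \<Gamma>\<^sub>i A\<close> for \<open>A = g\<^sup>-\<^sup>1 P\<close>.\<close>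

lemma divergence_raised:
  assumes g: "metric_on V g" and P: "smooth_mat V P" and sym: "\<And>x. x \<in> V \<Longrightarrow> transpose (P x) = P x" and x: "x \<in> V"
  defines "A \<equiv> \<lambda>x. matrix_inv (g x) ** P x"
  shows "(\<Sum>i\<in>UNIV. mpd i A x $ i $ a)
      + (\<Sum>i\<in>UNIV. \<Sum>m\<in>UNIV. christoffel g i i m x * A x $ m $ a - christoffel g i a m x * A x $ m $ i)
    = (\<Sum>i\<in>UNIV. \<Sum>l\<in>UNIV. matrix_inv (g x) $ i $ l * cov1 g P i a l x)"
proof -
  let ?h = "matrix_inv (g x)" and ?G = "\<lambda>i. conn g i x"
  have m: "mpd i A x = ?h ** covm g P i x + A x ** ?G i - ?G i ** A x" for i
    unfolding A_def
    by (simp add: mpd_mult[OF x metric_onD(1)[OF g] metric_on_inverse_smooth_mat[OF g] P]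
        inverse_metric_compatible[OF g x] covm_def matrix_algebra)
  have 1: "(\<Sum>i\<in>UNIV. (A x ** ?G i) $ i $ a) = (\<Sum>i\<in>UNIV. \<Sum>m\<in>UNIV. christoffel g i a m x * A x $ m $ i)"
    by (subst sum.swap) (simp add: matrix_mult_component conn_def christoffel_sym[where k = a, OF g x] mult.commute)
  have 2: "(\<Sum>i\<in>UNIV. (?G i ** A x) $ i $ a) = (\<Sum>i\<in>UNIV. \<Sum>m\<in>UNIV. christoffel g i i m x * A x $ m $ a)"
    by (simp add: matrix_mult_component conn_def)
  have 3: "(?h ** covm g P i x) $ i $ a = (\<Sum>l\<in>UNIV. ?h $ i $ l * cov1 g P i a l x)" for i
    unfolding matrix_mult_component cov1_eq_covm[symmetric] by (simp add: cov_sym(2)[where S = P and j = a, OF g sym x])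
  show ?thesis
    by (simp add: m sum.distrib sum_subtractf 1 2 3)
qed

context
  fixes W :: "(real^('n::finite option)) set" and G :: "real^('n option) \<Rightarrow> real^'n^'n"
  assumes G: "metric_on W G" and n: "CARD('n) > 2"
    and tangential: "\<And>x a b. adjoin 0 x \<in> W \<Longrightarrow> einstein_tangential G a b (adjoin 0 x) = 0"
    and tangential': "\<And>x a b. adjoin 0 x \<in> W \<Longrightarrow> pd None (einstein_tangential G a b) (adjoin 0 x) = 0"
    and mixed: "\<And>x a. adjoin 0 x \<in> W \<Longrightarrow> einstein_mixed G a (adjoin 0 x) = 0"
    and normal: "\<And>x. adjoin 0 x \<in> W \<Longrightarrow> einstein_normal G (adjoin 0 x) = 0"
begin

private lemma openW2_tay: "open W"
  using G by (rule metric_onD)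

private lemmas smooth_G2_tay = metric_on_smooth_mat[OF G]
private lemmas smooth_rate2_tay = smooth_mat_rate[OF G]

private lemma initial_metric_tay: "metric_on (slice W 0) (initial G)"
  by (rule metric_on_slice[OF G])

private lemma openV_tay: "open (slice W 0)"
  by (rule open_slice[OF openW2_tay])

text \<open>At \<open>\<rho> = 0\<close> the tangential equation reads \<open>Ric = (n/2 - 1) g' + \<theta>/2 g\<close>. Its trace gives \<open>\<theta> = 2J\<close>, and then \<open>g' = 2P\<close>.\<close>

lemma first_coefficient:
  assumes xW: "adjoin 0 x \<in> W"
  shows "mpd None G (adjoin 0 x) = 2 *\<^sub>R schouten (initial G) x" and "trace (rate G (adjoin 0 x)) = 2 * schouten_J (initial G) x"
proof -
  let ?y = "adjoin 0 x" and ?n = "real CARD('n)"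
  let ?\<theta> = "trace (rate G ?y)"
  have x: "x \<in> slice W 0" using xW by (simp add: slice_def)
  have n2: "?n > 2" using n by simp
  have ric: "ricci (initial G) x = (?n / 2 - 1) *\<^sub>R mpd None G ?y + (?\<theta> / 2) *\<^sub>R (initial G) x"
  proof -
    have "family_ricci G a b ?y = (?n / 2 - 1) * mpd None G ?y $ a $ b + ?\<theta> / 2 * (initial G) x $ a $ b" for a b
      using tangential[OF xW, of a b] by (simp add: einstein_tangential_def)
    then show ?thesis by (simp add: vec_eq_iff ricci_slice[OF G xW])
  qed
  have "scal (initial G) x = (?n / 2 - 1) * ?\<theta> + ?\<theta> / 2 * ?n"
    unfolding scal_eq_trace[OF initial_metric_tay x] ric
    by (simp add: matrix_algebra trace_add trace_scale metric_on_inverse[OF initial_metric_tay x] trace_I flip: rate_def)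
  then have s: "scal (initial G) x = (?n - 1) * ?\<theta>" by (simp add: field_simps)
  define c where "c = ?n - 1"
  have "c \<noteq> 0" using n2 by (simp add: c_def)
  then show J: "?\<theta> = 2 * schouten_J (initial G) x"
    unfolding schouten_J_def s c_def[symmetric] by simp
  define e where "e = ?n - 2"
  have e: "e \<noteq> 0" "?n / 2 - 1 = e / 2" using n2 by (auto simp: e_def)
  have "schouten (initial G) x = (1 / e) *\<^sub>R ((e / 2) *\<^sub>R mpd None G ?y)"
    unfolding schouten_def e_def[symmetric] ric e(2) J by simp
  then show "mpd None G ?y = 2 *\<^sub>R schouten (initial G) x" using e(1) by simp
qed

lemma smooth_mat_schouten: "smooth_mat (slice W 0) (schouten (initial G))"
proof (rule smooth_mat_cong[OF openV_tay])
  show "smooth_mat (slice W 0) (\<lambda>x. (1/2) *\<^sub>R mpd None G (adjoin 0 x))"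
    by (intro smooth_mat_scale openV_tay smooth_on_const smooth_mat_slice[OF openW2_tay] smooth_mat_mpd smooth_G2_tay)
qed (simp add: first_coefficient slice_def)

lemma schouten_symmetric:
  assumes "adjoin 0 x \<in> W" shows "transpose (schouten (initial G) x) = schouten (initial G) x"
proof -
  have "transpose (2 *\<^sub>R schouten (initial G) x) = 2 *\<^sub>R schouten (initial G) x"
    unfolding first_coefficient[OF assms, symmetric] by (rule mpd_metric_symmetric[OF G assms])
  then show ?thesis by (simp add: transpose_scale)
qed

lemma rate_slice: "adjoin 0 x \<in> W \<Longrightarrow> rate G (adjoin 0 x) = 2 *\<^sub>R (matrix_inv ((initial G) x) ** schouten (initial G) x)"
  by (simp add: rate_def first_coefficient matrix_scaleR_right)

text \<open>The mixed equation at \<open>\<rho> = 0\<close> is the contracted second Bianchi identity, which is thus obtained without third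
  derivatives of the metric.\<close>

lemma divergence_schouten:
  assumes xW: "adjoin 0 x \<in> W"
  shows "(\<Sum>i\<in>UNIV. \<Sum>l\<in>UNIV. matrix_inv ((initial G) x) $ i $ l * cov1 (initial G) (schouten (initial G)) i a l x) = pd a (schouten_J (initial G)) x"
proof -
  let ?A = "\<lambda>x. matrix_inv ((initial G) x) ** schouten (initial G) x"
  have x: "x \<in> slice W 0" using xW by (simp add: slice_def)
  have sA: "smooth_mat (slice W 0) ?A"
    by (intro smooth_mat_mult openV_tay metric_on_inverse_smooth_mat[OF initial_metric_tay] smooth_mat_schouten)
  have m: "mpd (Some i) (rate G) (adjoin 0 x) = 2 *\<^sub>R mpd i ?A x" for i
  proof -
    have "mpd (Some i) (rate G) (adjoin 0 x) = mpd i (\<lambda>x. rate G (adjoin 0 x)) x"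
      by (rule mpd_slice[OF G smooth_rate2_tay xW, symmetric])
    also have "\<dots> = mpd i (\<lambda>x. 2 *\<^sub>R ?A x) x"
      by (rule mpd_cong[OF openV_tay x]) (simp add: rate_slice slice_def)
    finally show ?thesis by (simp add: mpd_cmult[OF x sA])
  qed
  have t: "trace (mpd a ?A x) = pd a (schouten_J (initial G)) x"
    unfolding pd_trace[OF x sA, symmetric]
    by (rule pd_cong[OF openV_tay x]) (rule trace_schouten[OF initial_metric_tay n])
  have "einstein_mixed G a (adjoin 0 x) = 2 * ((\<Sum>i\<in>UNIV. mpd i ?A x $ i $ a)
      + (\<Sum>i\<in>UNIV. \<Sum>m\<in>UNIV. christoffel (initial G) i i m x * ?A x $ m $ a - christoffel (initial G) i a m x * ?A x $ m $ i)
      - pd a (schouten_J (initial G)) x)"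
    by (simp add: einstein_mixed_def m rate_slice[OF xW] trace_scale t christoffel_slice[OF G xW, symmetric]
        sum_distrib_left algebra_simps)
  then show ?thesis
    using mixed[OF xW, of a] divergence_raised[OF initial_metric_tay smooth_mat_schouten schouten_symmetric x, of a]
    by (simp add: slice_def)
qed

text \<open>The normal equation at \<open>\<rho> = 0\<close> says that \<open>\<theta>' = - tr B\<^sup>2 / 2\<close>, and \<open>B = 2 g\<^sup>-\<^sup>1 P\<close>.\<close>

lemma derivative_of_trace:
  assumes xW: "adjoin 0 x \<in> W"
  shows "pd None (\<lambda>y. trace (rate G y)) (adjoin 0 x) = - 2 * schouten_norm2 (initial G) x"
proof -
  let ?h = "matrix_inv ((initial G) x)" and ?P = "schouten (initial G) x"
  have x: "x \<in> slice W 0" using xW by (simp add: slice_def)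
  have "trace (rate G (adjoin 0 x) ** rate G (adjoin 0 x)) = 4 * trace (?h ** ?P ** ?h ** ?P)"
    by (simp add: rate_slice[OF xW] matrix_algebra trace_scale)
  also have "\<dots> = 4 * schouten_norm2 (initial G) x"
    by (simp add: schouten_norm2_eq[OF initial_metric_tay schouten_symmetric[OF xW] x])
  finally show ?thesis
    using normal[OF xW] by (simp add: einstein_normal_def pd_trace[OF xW smooth_rate2_tay])
qed

text \<open>The derivative of the tangential equation at \<open>\<rho> = 0\<close>, with the variation of the Ricci tensor inserted. In
  dimension 6 it says that \<open>g'' = 2 P\<^sup>2 - B\<close> with the Bach tensor \<open>B\<close>.\<close>

lemma second_coefficient:
  assumes xW: "adjoin 0 x \<in> W"
  shows "(real CARD('n) / 2 - 2) *\<^sub>R mpd None (mpd None G) (adjoin 0 x)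
    = (real CARD('n) - 4) *\<^sub>R (schouten (initial G) x ** matrix_inv ((initial G) x) ** schouten (initial G) x) - bach (initial G) x"
proof -
  let ?y = "adjoin 0 x" and ?n = "real CARD('n)" and ?h = "matrix_inv ((initial G) x)" and ?P = "schouten (initial G) x"
  let ?G' = "mpd None G" and ?G'' = "mpd None (mpd None G)"
  let ?\<theta> = "\<lambda>y. trace (rate G y)"
  note d = smooth_on_differentiable[OF _ xW]
  have st: "smooth_on W ?\<theta>" by (rule smooth_mat_trace[OF openW2_tay smooth_rate2_tay])
  have "?G'' ?y $ a $ b * (?n / 2 - 2) = (?n - 4) * (?P ** ?h ** ?P) $ a $ b - bach (initial G) x $ a $ b" for a b
  proof -
    let ?Z = "\<lambda>y. ?G'' y $ a $ b + ?\<theta> y * (1/2) * ?G' y $ a $ b - (?G' y ** rate G y) $ a $ b"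
    have sZ: "smooth_on W ?Z"
      by (intro smooth_intros openW2_tay st smooth_matD[where U = W] smooth_mat_intros smooth_G2_tay smooth_rate2_tay)
    note s = smooth_on_family_ricci[OF G, of a b] smooth_matD[OF smooth_mat_mpd[OF smooth_G2_tay], of None a b] smooth_matD[OF smooth_G2_tay, of a b]
    have "pd None (einstein_tangential G a b) ?y
      = pd None (\<lambda>y. family_ricci G a b y - (?n / 2 - 1) * ?G' y $ a $ b - (1/2) * (?\<theta> y * G y $ a $ b) + y $ None * ?Z y) ?y"
      unfolding einstein_tangential_def[abs_def] by simp
    also have "\<dots> = pd None (family_ricci G a b) ?y - (?n / 2 - 1) * ?G'' ?y $ a $ b
       - (1/2) * (?\<theta> ?y * ?G' ?y $ a $ b + pd None ?\<theta> ?y * G ?y $ a $ b) + ?Z ?y"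
    proof -
      have "pd None (\<lambda>y. family_ricci G a b y - (?n / 2 - 1) * ?G' y $ a $ b - (1/2) * (?\<theta> y * G y $ a $ b) + y $ None * ?Z y) ?y
        = pd None (\<lambda>y. family_ricci G a b y - (?n / 2 - 1) * ?G' y $ a $ b - (1/2) * (?\<theta> y * G y $ a $ b)) ?y
          + pd None (\<lambda>y. y $ None * ?Z y) ?y"
        by (rule pd_add; rule d; intro smooth_intros openW2_tay s st sZ)
      also have "pd None (\<lambda>y. family_ricci G a b y - (?n / 2 - 1) * ?G' y $ a $ b - (1/2) * (?\<theta> y * G y $ a $ b)) ?y
        = pd None (family_ricci G a b) ?y - (?n / 2 - 1) * pd None (\<lambda>y. ?G' y $ a $ b) ?y - (1/2) * pd None (\<lambda>y. ?\<theta> y * G y $ a $ b) ?y"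
        by (subst pd_diff pd_cmult, (rule d, intro smooth_intros openW2_tay s st)+)+ simp
      also have "pd None (\<lambda>y. ?\<theta> y * G y $ a $ b) ?y = ?\<theta> ?y * ?G' ?y $ a $ b + pd None ?\<theta> ?y * G ?y $ a $ b"
        by (subst pd_mult[OF d[OF st] d[OF s(3)]]) (simp add: mpd_component)
      also have "pd None (\<lambda>y. ?G' y $ a $ b) ?y = ?G'' ?y $ a $ b" by (simp add: mpd_component)
      also have "pd None (\<lambda>y. y $ None * ?Z y) ?y = ?Z ?y"
        by (subst pd_mult[OF d[OF smooth_on_coord] d[OF sZ]]) (simp add: pd_coord)
      finally show ?thesis .
    qed
    also have "(?G' ?y ** rate G ?y) $ a $ b = 4 * (?P ** ?h ** ?P) $ a $ b"
      by (simp add: first_coefficient[OF xW] rate_slice[OF xW] matrix_algebra)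
    finally have "0 = pd None (family_ricci G a b) ?y - (?n / 2 - 2) * ?G'' ?y $ a $ b
       + schouten_norm2 (initial G) x * G ?y $ a $ b - 4 * (?P ** ?h ** ?P) $ a $ b"
      unfolding tangential'[OF xW] derivative_of_trace[OF xW] by (simp add: algebra_simps)
    then show ?thesis
      using pd_None_family_ricci[OF G n xW first_coefficient(1) divergence_schouten, of a b]
      by (simp add: algebra_simps)
  qed
  then show ?thesis by (simp add: vec_eq_iff mult.commute)
qed

end


section \<open>Second-order operators on a family of metrics\<close>

lemma pd_double_sum:
  assumes U: "open U" "x \<in> U" and f: "\<And>i j. smooth_on U (f i j)"
  shows "pd a (\<lambda>x. \<Sum>i\<in>I. \<Sum>j\<in>J. f i j x) x = (\<Sum>i\<in>I. \<Sum>j\<in>J. pd a (f i j) x)"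
proof -
  have "smooth_on U (\<lambda>x. \<Sum>j\<in>J. f i j x)" for i by (intro smooth_on_sum U f)
  note d = smooth_on_differentiable[OF this U(2)] smooth_on_differentiable[OF f U(2)]
  show ?thesis
    by (cases "finite I"; cases "finite J") (simp_all add: pd_sum d)
qed

lemma codifferential_cong:
  assumes "\<And>x. x \<in> U \<Longrightarrow> g x = g' x" "\<And>x. x \<in> U \<Longrightarrow> \<omega> x = \<omega>' x"
  shows "codifferential U g \<omega> = codifferential U g' \<omega>'"
proof -
  have "is_codifferential U g \<omega> v = is_codifferential U g' \<omega>' v" for v
  proof -
    have "(LINT x:U|lborel. f x * v x * sqrt \<bar>det (g x)\<bar>) = (LINT x:U|lborel. f x * v x * sqrt \<bar>det (g' x)\<bar>)"
      "(LINT x:U|lborel. (grad_form f x \<bullet> (matrix_inv (g x) *v \<omega> x)) * sqrt \<bar>det (g x)\<bar>)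
        = (LINT x:U|lborel. (grad_form f x \<bullet> (matrix_inv (g' x) *v \<omega>' x)) * sqrt \<bar>det (g' x)\<bar>)" for f
      unfolding set_lebesgue_integral_def
      by (rule Bochner_Integration.integral_cong; use assms in \<open>auto simp: indicator_def\<close>)+
    then show ?thesis by (simp add: is_codifferential_def)
  qed
  then show ?thesis unfolding codifferential_def by presburger
qed

lemma grad_form_cong:
  assumes "open U" "x \<in> U" "\<And>y. y \<in> U \<Longrightarrow> f y = f' y"
  shows "grad_form f x = grad_form f' x"
  unfolding grad_form_def using pd_cong[OF assms] by simp

lemma laplacian_cong:
  assumes "open U" "\<And>x. x \<in> U \<Longrightarrow> g x = g' x" "\<And>x. x \<in> U \<Longrightarrow> f x = f' x"
  shows "laplacian U g f = laplacian U g' f'"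
  unfolding laplacian_def
  using codifferential_cong[of U g g' "grad_form f" "grad_form f'"] grad_form_cong[OF assms(1) _ assms(3)] assms(2)
  by simp

text \<open>The operators \<open>f \<mapsto> div (A df)\<close> comprise the Laplacian, for \<open>A = g\<^sup>-\<^sup>1\<close>, and minus \<open>f \<mapsto> \<delta>(T df)\<close>, for \<open>A = g\<^sup>-\<^sup>1 T\<close>. Here
  \<open>A\<close> maps one-forms to vectors.\<close>

definition div_grad :: "(real^'m \<Rightarrow> real^'m^'m) \<Rightarrow> (real^'m \<Rightarrow> real^'m^'m) \<Rightarrow> (real^'m \<Rightarrow> real) \<Rightarrow> real^'m \<Rightarrow> real" where
  "div_grad g A f = divg g (\<lambda>x. A x *v grad_form f x)"

lemma smooth_on_grad_form: "smooth_on U f \<Longrightarrow> smooth_on U (\<lambda>x. grad_form f x $ i)"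
  by (simp add: grad_form_def smooth_on_pd_fun)

lemma laplacian_eq_div_grad:
  assumes "metric_on U g" "smooth_on U f" "x \<in> U"
  shows "laplacian U g f x = div_grad g (\<lambda>x. matrix_inv (g x)) f x"
  unfolding laplacian_def div_grad_def
  using codifferential_eq_divg[OF assms(1) smooth_on_grad_form[OF assms(2)] assms(3)] by simp

lemma delta_T_d_eq_div_grad:
  assumes g: "metric_on U g" and f: "smooth_on U f" and T: "smooth_mat U T" and x: "x \<in> U"
  shows "delta_T_d U g T f x = - div_grad g (\<lambda>x. matrix_inv (g x) ** T x) f x"
proof -
  have "smooth_on U (\<lambda>x. (T x *v grad_form f x) $ i)" for i
    unfolding matrix_vector_mult_def vec_lambda_beta
    by (intro smooth_intros metric_onD(1)[OF g] smooth_matD[OF T] smooth_on_grad_form[OF f])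
  then show ?thesis
    unfolding delta_T_d_def div_grad_def
    using codifferential_eq_divg[OF g _ x] by (simp add: matrix_vector_mul_assoc)
qed

text \<open>On functions of all coordinates such an operator acts along the slices of constant parameter, and can be
  differentiated with respect to the parameter.\<close>

definition slice_div_grad :: "(real^('n::finite option) \<Rightarrow> real^'n^'n) \<Rightarrow> (real^('n option) \<Rightarrow> real^'n^'n) \<Rightarrow> (real^('n option) \<Rightarrow> real) \<Rightarrow> real^('n option) \<Rightarrow> real" where
  "slice_div_grad G A f y = (\<Sum>i\<in>UNIV. \<Sum>j\<in>UNIV. pd (Some i) (\<lambda>y. A y $ i $ j * pd (Some j) f y) y
     + dlogdet G (Some i) y / 2 * (A y $ i $ j * pd (Some j) f y))"

definition pairing :: "(real^('n::finite option) \<Rightarrow> real^'n^'n) \<Rightarrow> (real^('n option) \<Rightarrow> real) \<Rightarrow> (real^('n option) \<Rightarrow> real) \<Rightarrow> real^('n option) \<Rightarrow> real" where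
  "pairing A \<phi> f y = (\<Sum>i\<in>UNIV. \<Sum>j\<in>UNIV. pd (Some i) \<phi> y * (A y $ i $ j * pd (Some j) f y))"

context
  fixes W :: "(real^('n::finite option)) set" and G :: "real^('n option) \<Rightarrow> real^'n^'n"
  assumes G: "metric_on W G"
begin

private lemma openW_div: "open W"
  using G by (rule metric_onD)

private lemmas smooth_G_div = metric_on_smooth_mat[OF G]
private lemmas smooth_Ginv_div = metric_on_inverse_smooth_mat[OF G]
private lemmas smooth_dlogdet_div = smooth_on_dlogdet[OF G]

lemma smooth_on_slice_div_grad: "smooth_mat W A \<Longrightarrow> smooth_on W f \<Longrightarrow> smooth_on W (slice_div_grad G A f)"
  unfolding slice_div_grad_def[abs_def] divide_inverse by (intro smooth_intros openW_div smooth_dlogdet_div smooth_matD)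

lemma smooth_on_pairing: "smooth_mat W A \<Longrightarrow> smooth_on W \<phi> \<Longrightarrow> smooth_on W f \<Longrightarrow> smooth_on W (pairing A \<phi> f)"
  unfolding pairing_def[abs_def] by (intro smooth_intros openW_div smooth_matD)

lemma slice_div_grad_slice:
  assumes A: "smooth_mat W A" and f: "smooth_on W f" and xW: "adjoin s x \<in> W"
  shows "slice_div_grad G A f (adjoin s x) = div_grad (\<lambda>x. G (adjoin s x)) (\<lambda>x. A (adjoin s x)) (\<lambda>x. f (adjoin s x)) x"
proof -
  let ?V = "slice W s"
  have V: "open ?V" by (rule open_slice[OF openW_div])
  have x: "x \<in> ?V" using xW by (simp add: slice_def)
  have gf: "grad_form (\<lambda>x. f (adjoin s x)) z $ j = pd (Some j) f (adjoin s z)" if "z \<in> ?V" for z j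
    using that by (simp add: grad_form_def pd_slice[OF smooth_on_differentiable[OF f]] slice_def)
  have dl: "dlogdet (\<lambda>x. G (adjoin s x)) i x = dlogdet G (Some i) (adjoin s x)" for i
    by (simp add: dlogdet_eq_trace mpd_slice[OF G smooth_G_div xW])
  have t: "smooth_on W (\<lambda>y. A y $ i $ j * pd (Some j) f y)" for i j
    by (intro smooth_intros openW_div smooth_matD[OF A] f)
  have "pd i (\<lambda>z. (A (adjoin s z) *v grad_form (\<lambda>x. f (adjoin s x)) z) $ i) x
      = (\<Sum>j\<in>UNIV. pd (Some i) (\<lambda>y. A y $ i $ j * pd (Some j) f y) (adjoin s x))" for i
  proof -
    have "pd i (\<lambda>z. (A (adjoin s z) *v grad_form (\<lambda>x. f (adjoin s x)) z) $ i) x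
      = pd i (\<lambda>z. (\<lambda>y. \<Sum>j\<in>UNIV. A y $ i $ j * pd (Some j) f y) (adjoin s z)) x"
      by (rule pd_cong[OF V x]) (simp add: matrix_vector_mult_def gf)
    also have "\<dots> = pd (Some i) (\<lambda>y. \<Sum>j\<in>UNIV. A y $ i $ j * pd (Some j) f y) (adjoin s x)"
      by (rule pd_slice, rule smooth_on_differentiable[OF _ xW], intro smooth_on_sum openW_div t)
    also have "\<dots> = (\<Sum>j\<in>UNIV. pd (Some i) (\<lambda>y. A y $ i $ j * pd (Some j) f y) (adjoin s x))"
      by (rule pd_sum) (auto intro: smooth_on_differentiable[OF t xW])
    finally show ?thesis .
  qed
  then show ?thesis
    unfolding div_grad_def divg_def slice_div_grad_def
    by (simp add: dl matrix_vector_mult_def gf[OF x] sum.distrib sum_distrib_left sum_distrib_right sum_divide_distrib mult_ac)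
qed

context
  fixes y :: "real^('n option)"
  assumes y: "y \<in> W"
begin

private lemmas diff_div = smooth_on_differentiable[OF _ y]

lemma slice_div_grad_add:
  assumes A: "smooth_mat W A" and f: "smooth_on W f" and h: "smooth_on W h"
  shows "slice_div_grad G A (\<lambda>y. f y + h y) y = slice_div_grad G A f y + slice_div_grad G A h y"
proof -
  have "pd (Some i) (\<lambda>y. A y $ i $ j * pd (Some j) (\<lambda>y. f y + h y) y) y
    = pd (Some i) (\<lambda>y. A y $ i $ j * pd (Some j) f y) y + pd (Some i) (\<lambda>y. A y $ i $ j * pd (Some j) h y) y" for i j
  proof -
    have "pd (Some i) (\<lambda>y. A y $ i $ j * pd (Some j) (\<lambda>y. f y + h y) y) y
      = pd (Some i) (\<lambda>y. A y $ i $ j * pd (Some j) f y + A y $ i $ j * pd (Some j) h y) y"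
      by (rule pd_cong[OF openW_div y]) (simp add: pd_add smooth_on_differentiable[OF f] smooth_on_differentiable[OF h] distrib_left)
    also have "\<dots> = pd (Some i) (\<lambda>y. A y $ i $ j * pd (Some j) f y) y + pd (Some i) (\<lambda>y. A y $ i $ j * pd (Some j) h y) y"
      by (rule pd_add; rule diff_div; intro smooth_intros openW_div smooth_matD[OF A] f h)
    finally show ?thesis .
  qed
  then show ?thesis
    by (simp add: slice_div_grad_def pd_add diff_div f h sum.distrib algebra_simps)
qed

lemma slice_div_grad_cmult:
  assumes A: "smooth_mat W A" and f: "smooth_on W f"
  shows "slice_div_grad G A (\<lambda>y. c * f y) y = c * slice_div_grad G A f y"
proof -
  have "pd (Some i) (\<lambda>y. A y $ i $ j * pd (Some j) (\<lambda>y. c * f y) y) y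
    = c * pd (Some i) (\<lambda>y. A y $ i $ j * pd (Some j) f y) y" for i j
  proof -
    have "pd (Some i) (\<lambda>y. A y $ i $ j * pd (Some j) (\<lambda>y. c * f y) y) y
      = pd (Some i) (\<lambda>y. c * (A y $ i $ j * pd (Some j) f y)) y"
      by (rule pd_cong[OF openW_div y]) (simp add: pd_cmult smooth_on_differentiable[OF f])
    also have "\<dots> = c * pd (Some i) (\<lambda>y. A y $ i $ j * pd (Some j) f y) y"
      by (rule pd_cmult; rule diff_div; intro smooth_intros openW_div smooth_matD[OF A] f)
    finally show ?thesis .
  qed
  then show ?thesis
    by (simp add: slice_div_grad_def pd_cmult diff_div f sum_distrib_left algebra_simps)
qed

lemma slice_div_grad_add_left:
  assumes A: "smooth_mat W A" and B: "smooth_mat W B" and f: "smooth_on W f"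
  shows "slice_div_grad G (\<lambda>y. A y + B y) f y = slice_div_grad G A f y + slice_div_grad G B f y"
proof -
  have "pd (Some i) (\<lambda>y. (A y + B y) $ i $ j * pd (Some j) f y) y
    = pd (Some i) (\<lambda>y. A y $ i $ j * pd (Some j) f y) y + pd (Some i) (\<lambda>y. B y $ i $ j * pd (Some j) f y) y" for i j
    unfolding vector_add_component distrib_right
    by (rule pd_add; rule diff_div; intro smooth_intros openW_div smooth_matD[OF A] smooth_matD[OF B] f)
  then show ?thesis by (simp add: slice_div_grad_def sum.distrib algebra_simps)
qed

lemma slice_div_grad_scale_left:
  assumes A: "smooth_mat W A" and \<phi>: "smooth_on W \<phi>" and f: "smooth_on W f"
  shows "slice_div_grad G (\<lambda>y. \<phi> y *\<^sub>R A y) f y = \<phi> y * slice_div_grad G A f y + pairing A \<phi> f y"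
proof -
  have "pd (Some i) (\<lambda>y. (\<phi> y *\<^sub>R A y) $ i $ j * pd (Some j) f y) y
    = \<phi> y * pd (Some i) (\<lambda>y. A y $ i $ j * pd (Some j) f y) y + pd (Some i) \<phi> y * (A y $ i $ j * pd (Some j) f y)" for i j
    unfolding vector_scaleR_component real_scaleR_def mult.assoc
    by (rule pd_mult; rule diff_div; intro smooth_intros openW_div smooth_matD[OF A] \<phi> f)
  then show ?thesis by (simp add: slice_div_grad_def pairing_def sum.distrib sum_distrib_left algebra_simps)
qed

text \<open>Both sides are mixed second derivatives of \<open>ln \<bar>det g\<bar>\<close>.\<close>

lemma pd_None_dlogdet: "pd None (dlogdet G (Some i)) y = pd (Some i) (\<lambda>y. trace (rate G y)) y"
proof -
  have 1: "pd None (dlogdet G (Some i)) y = trace (mpd None (\<lambda>y. matrix_inv (G y) ** mpd (Some i) G y) y)"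
    unfolding dlogdet_eq_trace[abs_def] by (rule pd_trace[OF y smooth_mat_mult[OF openW_div smooth_Ginv_div smooth_mat_mpd[OF smooth_G_div]]])
  have 2: "pd (Some i) (\<lambda>y. trace (rate G y)) y = trace (mpd (Some i) (\<lambda>y. matrix_inv (G y) ** mpd None G y) y)"
    unfolding rate_def by (rule pd_trace[OF y smooth_mat_mult[OF openW_div smooth_Ginv_div smooth_mat_mpd[OF smooth_G_div]]])
  let ?h = "matrix_inv (G y)"
  have "trace (?h ** mpd None G y ** ?h ** mpd (Some i) G y) = trace (?h ** mpd (Some i) G y ** ?h ** mpd None G y)"
    using trace_mul_sym[of "?h ** mpd None G y" "?h ** mpd (Some i) G y"] by (simp add: matrix_mul_assoc)
  then show ?thesis
    unfolding 1 2 mpd_mult[OF y openW_div smooth_Ginv_div smooth_mat_mpd[OF smooth_G_div]] mpd_matrix_inv[OF G y]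
    by (simp add: matrix_algebra trace_add trace_sub trace_uminus mpd_commute[OF y openW_div smooth_G_div, of None])
qed

text \<open>Besides the coefficient matrix and the function, the volume density depends on the parameter; this is the
  last term.\<close>

lemma pd_None_slice_div_grad:
  assumes A: "smooth_mat W A" and f: "smooth_on W f"
  shows "pd None (slice_div_grad G A f) y = slice_div_grad G (mpd None A) f y + slice_div_grad G A (pd None f) y + pairing A (\<lambda>y. trace (rate G y)) f y / 2"
proof -
  have q: "pd None (\<lambda>y. A y $ i $ j * pd (Some j) f y) z = mpd None A z $ i $ j * pd (Some j) f z + A z $ i $ j * pd (Some j) (pd None f) z"
    if z: "z \<in> W" for i j z
    using pd_mult[OF smooth_on_differentiable[OF smooth_matD[OF A] z] smooth_on_differentiable[OF smooth_on_pd[OF f] z]]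
      pd_commute[OF openW_div f z, of None "Some j"] by (simp add: mpd_component)
  have t: "smooth_on W (\<lambda>y. A y $ i $ j * pd (Some j) f y)" for i j
    by (intro smooth_intros openW_div smooth_matD[OF A] f)
  have c: "pd None (pd (Some i) (\<lambda>y. A y $ i $ j * pd (Some j) f y)) y
    = pd (Some i) (\<lambda>y. mpd None A y $ i $ j * pd (Some j) f y) y + pd (Some i) (\<lambda>y. A y $ i $ j * pd (Some j) (pd None f) y) y" for i j
  proof -
    have "pd None (pd (Some i) (\<lambda>y. A y $ i $ j * pd (Some j) f y)) y = pd (Some i) (pd None (\<lambda>y. A y $ i $ j * pd (Some j) f y)) y"
      by (rule pd_commute[OF openW_div t y])
    also have "\<dots> = pd (Some i) (\<lambda>y. mpd None A y $ i $ j * pd (Some j) f y + A y $ i $ j * pd (Some j) (pd None f) y) y"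
      by (rule pd_cong[OF openW_div y q])
    also have "\<dots> = pd (Some i) (\<lambda>y. mpd None A y $ i $ j * pd (Some j) f y) y + pd (Some i) (\<lambda>y. A y $ i $ j * pd (Some j) (pd None f) y) y"
      by (rule pd_add; rule diff_div; intro smooth_intros openW_div smooth_matD smooth_mat_mpd smooth_on_pd A f)
    finally show ?thesis .
  qed
  have e: "pd None (\<lambda>y. dlogdet G (Some i) y / 2 * (A y $ i $ j * pd (Some j) f y)) y
    = dlogdet G (Some i) y / 2 * (mpd None A y $ i $ j * pd (Some j) f y + A y $ i $ j * pd (Some j) (pd None f) y)
      + pd (Some i) (\<lambda>y. trace (rate G y)) y / 2 * (A y $ i $ j * pd (Some j) f y)" for i j
  proof -
    have "pd None (\<lambda>y. dlogdet G (Some i) y / 2 * (A y $ i $ j * pd (Some j) f y)) y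
      = pd None (\<lambda>y. (1/2) * (dlogdet G (Some i) y * (A y $ i $ j * pd (Some j) f y))) y" by simp
    also have "\<dots> = (1/2) * (dlogdet G (Some i) y * pd None (\<lambda>y. A y $ i $ j * pd (Some j) f y) y
       + pd None (dlogdet G (Some i)) y * (A y $ i $ j * pd (Some j) f y))"
      by (subst pd_cmult, rule diff_div, intro smooth_on_mult openW_div smooth_dlogdet_div t)
        (subst pd_mult[OF diff_div[OF smooth_dlogdet_div] diff_div[OF t]], rule refl)
    finally show ?thesis unfolding q[OF y] pd_None_dlogdet by (simp add: algebra_simps)
  qed
  have "pd None (slice_div_grad G A f) y = (\<Sum>i\<in>UNIV. \<Sum>j\<in>UNIV. pd None (pd (Some i) (\<lambda>y. A y $ i $ j * pd (Some j) f y)) y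
      + pd None (\<lambda>y. dlogdet G (Some i) y / 2 * (A y $ i $ j * pd (Some j) f y)) y)"
  proof -
    have s: "smooth_on W (\<lambda>y. dlogdet G (Some i) y / 2 * (A y $ i $ j * pd (Some j) f y))" for i j
      unfolding divide_inverse by (intro smooth_on_mult openW_div smooth_dlogdet_div smooth_on_const t)
    have st: "smooth_on W (\<lambda>y. pd (Some i) (\<lambda>y. A y $ i $ j * pd (Some j) f y) y
        + dlogdet G (Some i) y / 2 * (A y $ i $ j * pd (Some j) f y))" for i j
      by (intro smooth_on_add openW_div smooth_on_pd_fun t s)
    show ?thesis unfolding slice_div_grad_def[abs_def] pd_double_sum[OF openW_div y st]
      by (intro sum.cong refl pd_add diff_div smooth_on_pd_fun t s)
  qed
  then show ?thesis
    unfolding c e by (simp add: slice_div_grad_def pairing_def sum.distrib sum_divide_distrib algebra_simps)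
qed

lemma pd_None_pairing:
  assumes A: "smooth_mat W A" and \<phi>: "smooth_on W \<phi>" and f: "smooth_on W f"
  shows "pd None (pairing A \<phi> f) y = pairing (mpd None A) \<phi> f y + pairing A (pd None \<phi>) f y + pairing A \<phi> (pd None f) y"
proof -
  have "pd None (\<lambda>y. pd (Some i) \<phi> y * (A y $ i $ j * pd (Some j) f y)) y
    = pd (Some i) \<phi> y * (mpd None A y $ i $ j * pd (Some j) f y) + pd (Some i) (pd None \<phi>) y * (A y $ i $ j * pd (Some j) f y)
     + pd (Some i) \<phi> y * (A y $ i $ j * pd (Some j) (pd None f) y)" for i j
    using pd_mult[OF diff_div[OF smooth_on_pd[OF \<phi>, of "Some i"]] diff_div[OF smooth_on_mult[OF openW_div smooth_matD[OF A, of i j] smooth_on_pd[OF f, of "Some j"]]], of None]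
      pd_mult[OF diff_div[OF smooth_matD[OF A, of i j]] diff_div[OF smooth_on_pd[OF f, of "Some j"]], of None]
      pd_commute[OF openW_div f y, of None "Some j"] pd_commute[OF openW_div \<phi> y, of None "Some i"]
    by (simp add: mpd_component algebra_simps)
  moreover have "pd None (pairing A \<phi> f) y = (\<Sum>i\<in>UNIV. \<Sum>j\<in>UNIV. pd None (\<lambda>y. pd (Some i) \<phi> y * (A y $ i $ j * pd (Some j) f y)) y)"
  proof -
    have t: "smooth_on W (\<lambda>y. pd (Some i) \<phi> y * (A y $ i $ j * pd (Some j) f y))" for i j
      by (intro smooth_intros openW_div smooth_matD[OF A] f \<phi>)
    show ?thesis unfolding pairing_def[abs_def] by (rule pd_double_sum[OF openW_div y t])
  qed
  ultimately show ?thesis by (simp add: pairing_def sum.distrib)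
qed

end

lemma slice_div_grad_slice_cong:
  assumes A: "smooth_mat W A" and f: "smooth_on W f" and h: "smooth_on W h" and xW: "adjoin s x \<in> W"
    and eq: "\<And>x. adjoin s x \<in> W \<Longrightarrow> f (adjoin s x) = h (adjoin s x)"
  shows "slice_div_grad G A f (adjoin s x) = slice_div_grad G A h (adjoin s x)"
proof -
  have V: "open (slice W s)" by (rule open_slice[OF openW_div])
  have g: "grad_form (\<lambda>x. f (adjoin s x)) z = grad_form (\<lambda>x. h (adjoin s x)) z" if "z \<in> slice W s" for z
    by (rule grad_form_cong[OF V that]) (simp add: eq slice_def)
  have x: "x \<in> slice W s" using xW by (simp add: slice_def)
  have "pd i (\<lambda>x. (A (adjoin s x) *v grad_form (\<lambda>x. f (adjoin s x)) x) $ i) x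
      = pd i (\<lambda>x. (A (adjoin s x) *v grad_form (\<lambda>x. h (adjoin s x)) x) $ i) x" for i
    by (rule pd_cong[OF V x]) (simp add: g)
  then show ?thesis
    unfolding slice_div_grad_slice[OF A f xW] slice_div_grad_slice[OF A h xW] div_grad_def divg_def by (simp add: g[OF x])
qed

end


section \<open>The Laplacian of the ambient metric\<close>

lemma pd_homogeneous:
  assumes u: "u differentiable (at (base y))" and t: "y $ None > 0"
  shows "(\<lambda>y. (y $ None) powr c * u (base y)) differentiable (at y)"
    "pd None (\<lambda>y. (y $ None) powr c * u (base y)) y = c * (y $ None) powr (c - 1) * u (base y)"
    "pd (Some b) (\<lambda>y. (y $ None) powr c * u (base y)) y = (y $ None) powr c * pd b u (base y)"
proof -
  have co: "(\<lambda>y. y $ None) differentiable (at y)"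
    using smooth_on_differentiable[OF smooth_on_coord[of UNIV]] by simp
  have der: "((\<lambda>t. t powr c) has_real_derivative c * (y $ None) powr (c - 1)) (at (y $ None))"
    using t by (auto intro!: derivative_eq_intros)
  note 1 = pd_compose_real[OF co der] and 2 = pd_base[OF u]
  show "(\<lambda>y. (y $ None) powr c * u (base y)) differentiable (at y)" using 1(1) 2(1) by (rule differentiable_mult)
  show "pd None (\<lambda>y. (y $ None) powr c * u (base y)) y = c * (y $ None) powr (c - 1) * u (base y)"
    "pd (Some b) (\<lambda>y. (y $ None) powr c * u (base y)) y = (y $ None) powr c * pd b u (base y)"
    unfolding pd_mult[OF 1(1) 2(1)] 1(2) 2(2,3) by (simp_all add: pd_coord)
qed

definition ambient_cone :: "(real^('n::finite option)) set \<Rightarrow> (real^('n option option)) set" where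
  "ambient_cone W = {y. y $ None > 0 \<and> base y \<in> W}"

lemma open_ambient_cone:
  assumes "open W" shows "open (ambient_cone W)"
proof -
  have "ambient_cone W = {y. 0 < y $ None} \<inter> base -` W" by (auto simp: ambient_cone_def)
  moreover have "open {y :: real^('a option option). 0 < y $ None}" by (intro open_Collect_less continuous_intros)
  moreover have "open (base -` W)" by (rule open_vimage[OF assms continuous_on_base])
  ultimately show ?thesis by (simp add: open_Int)
qed

lemma smooth_on_homogeneous:
  assumes "open W" "smooth_on W u"
  shows "smooth_on (ambient_cone W) (\<lambda>y. (y $ None) powr c * u (base y))"
proof -
  have "smooth_on (ambient_cone W) (\<lambda>y. u (base y))"
    by (rule smooth_on_compose[OF assms(2) open_ambient_cone[OF assms(1)] smooth_on_base_component]) (simp add: ambient_cone_def)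
  moreover have "smooth_on (ambient_cone W) (\<lambda>y. (y $ None) powr c)"
    by (rule smooth_on_powr[OF open_ambient_cone[OF assms(1)] smooth_on_coord]) (simp add: ambient_cone_def)
  ultimately show ?thesis by (rule smooth_on_mult[OF open_ambient_cone[OF assms(1)], rotated])
qed

definition ambient :: "(real^('n::finite option) \<Rightarrow> real^'n^'n) \<Rightarrow> real^('n option option) \<Rightarrow> real^('n option option)^('n option option)" where
  "ambient G = ambient_metric (\<lambda>x \<rho>. G (adjoin \<rho> x))"

lemma ambient_component:
  "ambient G y $ None $ None = 2 * y $ Some None"
  "ambient G y $ None $ Some None = y $ None" "ambient G y $ Some None $ None = y $ None"
  "ambient G y $ Some None $ Some None = 0"
  "ambient G y $ None $ Some (Some j) = 0" "ambient G y $ Some (Some i) $ None = 0"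
  "ambient G y $ Some None $ Some (Some j) = 0" "ambient G y $ Some (Some i) $ Some None = 0"
  "ambient G y $ Some (Some i) $ Some (Some j) = (y $ None)\<^sup>2 * G (base y) $ i $ j"
proof -
  have "adjoin (y $ Some None) (base (base y)) = base y"
    using adjoin_base[of "base y"] by simp
  then show "ambient G y $ Some (Some i) $ Some (Some j) = (y $ None)\<^sup>2 * G (base y) $ i $ j"
    by (simp add: ambient_def ambient_metric_def Let_def)
qed (simp_all add: ambient_def ambient_metric_def Let_def)

text \<open>This is the factor of \<open>t\<^sup>a\<^sup>-\<^sup>2\<close> in the ambient Laplacian of \<open>t\<^sup>a f(\<rho>, x)\<close>. Its coefficients involve \<open>\<theta>\<close>, since the volume
  density of the ambient metric is \<open>t\<^sup>n\<^sup>+\<^sup>1 (det g(\<rho>))\<^sup>1\<^sup>/\<^sup>2\<close>.\<close>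

definition homogeneous_laplacian :: "(real^('n::finite option) \<Rightarrow> real^'n^'n) \<Rightarrow> real \<Rightarrow> (real^('n option) \<Rightarrow> real) \<Rightarrow> real^('n option) \<Rightarrow> real" where
  "homogeneous_laplacian G a f y = slice_div_grad G (\<lambda>y. matrix_inv (G y)) f y - 2 * y $ None * pd None (pd None f) y
     + (2 * a + real CARD('n) - 2 - y $ None * trace (rate G y)) * pd None f y + a / 2 * trace (rate G y) * f y"

definition ambient_inverse :: "(real^('n::finite option) \<Rightarrow> real^'n^'n) \<Rightarrow> real^('n option option) \<Rightarrow> real^('n option option)^('n option option)" where
  "ambient_inverse G y = (\<chi> a b. case (a, b) of
       (None, Some None) \<Rightarrow> 1 / y $ None | (Some None, None) \<Rightarrow> 1 / y $ None
     | (Some None, Some None) \<Rightarrow> - 2 * y $ Some None / (y $ None)\<^sup>2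
     | (Some (Some i), Some (Some j)) \<Rightarrow> matrix_inv (G (base y)) $ i $ j / (y $ None)\<^sup>2
     | _ \<Rightarrow> 0)"

context
  fixes W :: "(real^('n::finite option)) set" and G :: "real^('n option) \<Rightarrow> real^'n^'n"
  assumes G: "metric_on W G"
begin

private lemma openW_amb: "open W"
  using G by (rule metric_onD)

private lemmas smooth_G_amb = metric_on_smooth_mat[OF G]
private lemmas smooth_Ginv_amb = metric_on_inverse_smooth_mat[OF G]
private lemmas smooth_rate_amb = smooth_mat_rate[OF G]

lemma smooth_on_homogeneous_laplacian:
  "smooth_on W f \<Longrightarrow> smooth_on W (homogeneous_laplacian G a f)"
  unfolding homogeneous_laplacian_def[abs_def]
  by (intro smooth_intros openW_amb smooth_on_slice_div_grad[OF G smooth_Ginv_amb] smooth_mat_trace smooth_rate_amb) assumption+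

lemma ambient_inverse:
  assumes y: "y \<in> ambient_cone W"
  shows "ambient G y ** ambient_inverse G y = mat 1"
proof -
  have yW: "base y \<in> W" and t: "y $ None > 0" using y by (auto simp: ambient_cone_def)
  have "(\<Sum>k\<in>UNIV. G (base y) $ i $ k * matrix_inv (G (base y)) $ k $ j) = (if i = j then 1 else 0)" for i j
    using metric_on_inverse(1)[OF G yW] by (simp add: vec_eq_iff matrix_mult_component mat_def)
  then have "(\<Sum>k\<in>UNIV. y $ None * y $ None * G (base y) $ i $ k * matrix_inv (G (base y)) $ k $ j) = (if i = j then y $ None * y $ None else 0)" for i j
    by (simp add: mult.assoc flip: sum_distrib_left)
  then show ?thesis
    using t by (simp add: vec_eq_iff matrix_mult_component sum_option ambient_component mat_def ambient_inverse_def
        split_option_all sum_distrib_left[symmetric] sum_divide_distrib[symmetric] power2_eq_square)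
qed

lemma metric_on_ambient: "metric_on (ambient_cone W) (ambient G)"
  unfolding metric_on_def
proof (intro conjI ballI allI)
  show o: "open (ambient_cone W)" by (rule open_ambient_cone[OF openW_amb])
  have sb: "smooth_on (ambient_cone W) (\<lambda>y. G (base y) $ i $ j)" for i j
    by (rule smooth_on_compose[OF smooth_matD[OF smooth_G_amb] o smooth_on_base_component]) (simp add: ambient_cone_def)
  show "smooth_on (ambient_cone W) (\<lambda>x. ambient G x $ a $ b)" for a b
    by (cases a; cases b; (cases "the a")?; (cases "the b")?)
      (simp_all add: ambient_component o sb smooth_on_const smooth_on_coord smooth_on_mult smooth_on_power)
  fix y assume y: "y \<in> ambient_cone W"
  show "det (ambient G y) \<noteq> 0" using matrix_inv_unique(2)[OF ambient_inverse[OF y]] .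
  have gs: "G (base y) $ i $ j = G (base y) $ j $ i" for i j
    using y metric_onD(4)[OF G] by (simp add: ambient_cone_def)
  show "ambient G y $ a $ b = ambient G y $ b $ a" for a b
    by (cases a; cases b; (cases "the a")?; (cases "the b")?) (simp_all add: ambient_component gs)
qed

context
  fixes y :: "real^('n option option)"
  assumes y: "y \<in> ambient_cone W"
begin

private lemma t_pos: "y $ None > 0" and base_in_W: "base y \<in> W"
  using y by (auto simp: ambient_cone_def)

lemma dlogdet_ambient:
  "dlogdet (ambient G) None y = (2 + 2 * real CARD('n)) / y $ None"
  "dlogdet (ambient G) (Some None) y = trace (rate G (base y))"
  "dlogdet (ambient G) (Some (Some k)) y = dlogdet G (Some k) (base y)"
proof -
  have inv: "matrix_inv (ambient G y) = ambient_inverse G y"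
    by (rule matrix_inv_unique(1)[OF ambient_inverse[OF y]])
  have d: "(\<lambda>y. G y $ i $ j) differentiable (at (base y))" for i j
    by (rule smooth_mat_component_differentiable[OF smooth_G_amb base_in_W])
  have sq: "pd None (\<lambda>y. (y $ None)\<^sup>2 * G (base y) $ i $ j) y = 2 * y $ None * G (base y) $ i $ j"
     "pd (Some b) (\<lambda>y. (y $ None)\<^sup>2 * G (base y) $ i $ j) y = (y $ None)\<^sup>2 * pd b (\<lambda>y. G y $ i $ j) (base y)" for i j b
  proof -
    have o: "open {y :: real^('n option option). 0 < y $ None}" by (intro open_Collect_less continuous_intros)
    have e: "(y $ None) powr 2 * G (base y) $ i $ j = (y $ None)\<^sup>2 * G (base y) $ i $ j"
      if "y \<in> {y. 0 < y $ None}" for y :: "real^('n option option)" using that by (simp add: powr_numeral)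
    note h = pd_homogeneous[OF d t_pos, where c = 2]
    have c: "pd a (\<lambda>y. (y $ None)\<^sup>2 * G (base y) $ i $ j) y = pd a (\<lambda>y. (y $ None) powr 2 * G (base y) $ i $ j) y" for a
      by (rule pd_cong[OF o _ e[symmetric]]) (simp_all add: t_pos)
    show "pd None (\<lambda>y. (y $ None)\<^sup>2 * G (base y) $ i $ j) y = 2 * y $ None * G (base y) $ i $ j"
     "pd (Some b) (\<lambda>y. (y $ None)\<^sup>2 * G (base y) $ i $ j) y = (y $ None)\<^sup>2 * pd b (\<lambda>y. G y $ i $ j) (base y)"
      unfolding c h(2,3) using t_pos by (simp_all add: powr_numeral)
  qed
  have co: "(\<lambda>y. y $ a) differentiable (at y)" for a
    using smooth_on_differentiable[OF smooth_on_coord[of UNIV]] by simp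
  have tr: "(\<Sum>i\<in>UNIV. \<Sum>j\<in>UNIV. matrix_inv (G (base y)) $ i $ j * G (base y) $ j $ i) = real CARD('n)"
    using metric_on_inverse(2)[OF G base_in_W] by (simp flip: trace_mult add: trace_I)
  have tr': "(\<Sum>i\<in>UNIV. \<Sum>j\<in>UNIV. G (base y) $ j $ i * matrix_inv (G (base y)) $ i $ j) = real CARD('n)"
    using tr by (simp add: mult.commute)
  show "dlogdet (ambient G) None y = (2 + 2 * real CARD('n)) / y $ None"
    "dlogdet (ambient G) (Some None) y = trace (rate G (base y))"
    "dlogdet (ambient G) (Some (Some k)) y = dlogdet G (Some k) (base y)"
    unfolding dlogdet_def[of "ambient G"] inv sum_option
    using t_pos by (simp_all add: ambient_component ambient_inverse_def pd_cmult co pd_coord sq)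
      (simp_all add: power2_eq_square sum_distrib_left[symmetric] sum_divide_distrib[symmetric] tr tr'
        dlogdet_def rate_def trace_mult mpd_component field_simps)
qed

end

lemma laplacian_ambient:
  assumes f: "smooth_on W f" and y: "y \<in> ambient_cone W"
  shows "laplacian (ambient_cone W) (ambient G) (\<lambda>y. (y $ None) powr a * f (base y)) y
    = (y $ None) powr (a - 2) * homogeneous_laplacian G a f (base y)"
proof -
  let ?F = "\<lambda>y::real^('n option option). (y $ None) powr a * f (base y)"
  let ?X = "\<lambda>z. matrix_inv (ambient G z) *v grad_form ?F z"
  let ?u = "\<lambda>w. a * f w - 2 * (w $ None * pd None f w)"
  let ?v = "\<lambda>i w. \<Sum>j\<in>UNIV. matrix_inv (G w) $ i $ j * pd (Some j) f w"
  have o: "open (ambient_cone W)" by (rule open_ambient_cone[OF openW_amb])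
  have su: "smooth_on W ?u" by (intro smooth_intros openW_amb f)
  have sv: "smooth_on W (?v i)" for i by (intro smooth_intros openW_amb f smooth_matD[OF smooth_Ginv_amb])
  have t: "y $ None > 0" and yW: "base y \<in> W" using y by (auto simp: ambient_cone_def)
  have X: "?X z $ None = (z $ None) powr (a - 1) * pd None f (base z)"
    "?X z $ Some None = (z $ None) powr (a - 2) * ?u (base z)"
    "?X z $ Some (Some i) = (z $ None) powr (a - 2) * ?v i (base z)" if z: "z \<in> ambient_cone W" for z i
  proof -
    have tz: "z $ None > 0" and zW: "base z \<in> W" using z by (auto simp: ambient_cone_def)
    have inv: "matrix_inv (ambient G z) = ambient_inverse G z"
      by (rule matrix_inv_unique(1)[OF ambient_inverse[OF z]])
    note p = pd_homogeneous[OF smooth_on_differentiable[OF f zW] tz, where c = a]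
    have pw: "(z $ None) powr a = (z $ None) powr (a - 2) * (z $ None)\<^sup>2" "(z $ None) powr (a - 1) = (z $ None) powr (a - 2) * (z $ None)"
      using tz by (simp_all add: powr_diff powr_numeral power2_eq_square)
    show "?X z $ None = (z $ None) powr (a - 1) * pd None f (base z)"
      "?X z $ Some None = (z $ None) powr (a - 2) * ?u (base z)"
      "?X z $ Some (Some i) = (z $ None) powr (a - 2) * ?v i (base z)"
      unfolding inv matrix_vector_mult_def vec_lambda_beta sum_option grad_form_def p
      using tz by (simp_all add: ambient_inverse_def pw power2_eq_square field_simps sum_distrib_left)
  qed
  note d = smooth_on_differentiable[OF _ yW]
  have p: "pd None (\<lambda>z. ?X z $ None) y = (a - 1) * (y $ None) powr (a - 2) * pd None f (base y)"
    "pd (Some None) (\<lambda>z. ?X z $ Some None) y = (y $ None) powr (a - 2) * pd None ?u (base y)"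
    "pd (Some (Some i)) (\<lambda>z. ?X z $ Some (Some i)) y = (y $ None) powr (a - 2) * pd (Some i) (?v i) (base y)" for i
  proof -
    have "pd None (\<lambda>z. ?X z $ None) y = pd None (\<lambda>z. (z $ None) powr (a - 1) * pd None f (base z)) y"
      by (rule pd_cong[OF o y X(1)])
    then show "pd None (\<lambda>z. ?X z $ None) y = (a - 1) * (y $ None) powr (a - 2) * pd None f (base y)"
      unfolding pd_homogeneous(2)[OF d[OF smooth_on_pd[OF f]] t] by simp
    have "pd (Some None) (\<lambda>z. ?X z $ Some None) y = pd (Some None) (\<lambda>z. (z $ None) powr (a - 2) * ?u (base z)) y"
      by (rule pd_cong[OF o y X(2)])
    then show "pd (Some None) (\<lambda>z. ?X z $ Some None) y = (y $ None) powr (a - 2) * pd None ?u (base y)"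
      unfolding pd_homogeneous(3)[OF d[OF su] t] .
    have "pd (Some (Some i)) (\<lambda>z. ?X z $ Some (Some i)) y = pd (Some (Some i)) (\<lambda>z. (z $ None) powr (a - 2) * ?v i (base z)) y"
      by (rule pd_cong[OF o y X(3)])
    then show "pd (Some (Some i)) (\<lambda>z. ?X z $ Some (Some i)) y = (y $ None) powr (a - 2) * pd (Some i) (?v i) (base y)"
      unfolding pd_homogeneous(3)[OF d[OF sv] t] .
  qed
  have pu: "pd None ?u (base y) = a * pd None f (base y) - 2 * (pd None f (base y) + base y $ None * pd None (pd None f) (base y))"
  proof -
    have "pd None ?u (base y) = a * pd None f (base y) - 2 * pd None (\<lambda>w. w $ None * pd None f w) (base y)"
      by (subst pd_diff pd_cmult, (rule d, intro smooth_intros openW_amb f)+)+ simp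
    also have "pd None (\<lambda>w. w $ None * pd None f w) (base y) = pd None f (base y) + base y $ None * pd None (pd None f) (base y)"
      by (subst pd_mult[OF d[OF smooth_on_coord] d[OF smooth_on_pd[OF f]]]) (simp add: pd_coord)
    finally show ?thesis .
  qed
  have pv: "pd (Some i) (?v i) (base y) = (\<Sum>j\<in>UNIV. pd (Some i) (\<lambda>w. matrix_inv (G w) $ i $ j * pd (Some j) f w) (base y))" for i
    by (rule pd_sum) (auto intro!: d smooth_intros openW_amb f smooth_matD[OF smooth_Ginv_amb])
  have slice_div_grad: "slice_div_grad G (\<lambda>y. matrix_inv (G y)) f (base y) = (\<Sum>i\<in>UNIV. pd (Some i) (?v i) (base y) + dlogdet G (Some i) (base y) / 2 * ?v i (base y))"
    unfolding slice_div_grad_def pv by (simp add: sum.distrib sum_distrib_left)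
  have pw: "(y $ None) powr (a - 1) = (y $ None) powr (a - 2) * (y $ None)"
    using t by (simp add: powr_diff powr_numeral power2_eq_square)
  have "laplacian (ambient_cone W) (ambient G) ?F y = divg (ambient G) ?X y"
    by (simp add: laplacian_eq_div_grad[OF metric_on_ambient smooth_on_homogeneous[OF openW_amb f] y] div_grad_def)
  also have "\<dots> = (a - 1) * (y $ None) powr (a - 2) * pd None f (base y)
      + (2 + 2 * real CARD('n)) / y $ None * ((y $ None) powr (a - 1) * pd None f (base y)) / 2
      + (y $ None) powr (a - 2) * pd None ?u (base y) + trace (rate G (base y)) * ((y $ None) powr (a - 2) * ?u (base y)) / 2
      + (y $ None) powr (a - 2) * slice_div_grad G (\<lambda>y. matrix_inv (G y)) f (base y)"
    unfolding divg_def sum_option p dlogdet_ambient[OF y] X[OF y] slice_div_grad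
    by (simp add: sum_distrib_left sum_divide_distrib algebra_simps)
  also have "\<dots> = (y $ None) powr (a - 2) * homogeneous_laplacian G a f (base y)"
    unfolding pu pw homogeneous_laplacian_def using t by (simp add: field_simps)
  finally show ?thesis .
qed

end


section \<open>The third power of the ambient Laplacian at \<open>\<rho> = 0\<close>\<close>

text \<open>\<open>Lap1\<close> and \<open>Lap2\<close> are the first and second derivatives of the slice Laplacian \<open>Lap0\<close> with respect to \<open>\<rho>\<close>, as
  operators: the terms of \<open>(\<Delta> u)'\<close> and \<open>(\<Delta> u)''\<close> in which \<open>u\<close> is not differentiated in \<open>\<rho>\<close>.\<close>

abbreviation (input) "ginv G \<equiv> \<lambda>y. matrix_inv (G y)"
abbreviation (input) "trB G \<equiv> \<lambda>y. trace (rate G y)"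
abbreviation (input) "Lap0 G \<equiv> slice_div_grad G (ginv G)"
abbreviation (input) "Lap1 G \<equiv> \<lambda>u y. slice_div_grad G (mpd None (ginv G)) u y + pairing (ginv G) (trB G) u y / 2"
abbreviation (input) "Lap2 G \<equiv> \<lambda>u y. slice_div_grad G (mpd None (mpd None (ginv G))) u y
  + pairing (mpd None (ginv G)) (trB G) u y + pairing (ginv G) (pd None (trB G)) u y / 2"

context
  fixes W :: "(real^('n::finite option)) set" and G :: "real^('n option) \<Rightarrow> real^'n^'n"
  assumes G: "metric_on W G"
begin

private lemma openW_tri: "open W"
  using G by (rule metric_onD)


private lemmas smooth_Ginv_tri = metric_on_inverse_smooth_mat[OF G]
private lemmas smooth_dGinv_tri = smooth_mat_mpd[OF smooth_Ginv_tri, of None]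

private lemma smooth_trB_tri: "smooth_on W (trB G)"
  by (rule smooth_mat_trace[OF openW_tri smooth_mat_rate[OF G]])

private lemma smooth_Lap0: "smooth_on W u \<Longrightarrow> smooth_on W ((Lap0 G) u)"
  by (rule smooth_on_slice_div_grad[OF G smooth_Ginv_tri])

private lemma smooth_Lap1: "smooth_on W u \<Longrightarrow> smooth_on W ((Lap1 G) u)"
  unfolding divide_inverse by (intro smooth_intros openW_tri smooth_on_slice_div_grad[OF G smooth_dGinv_tri] smooth_on_pairing[OF G smooth_Ginv_tri smooth_trB_tri])

private lemma pd_Lap0:
  assumes "smooth_on W u" "y \<in> W"
  shows "pd None ((Lap0 G) u) y = (Lap0 G) (pd None u) y + (Lap1 G) u y"
  using pd_None_slice_div_grad[OF G assms(2) smooth_Ginv_tri assms(1)] by simp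

private lemma pd_Lap1:
  assumes u: "smooth_on W u" and y: "y \<in> W"
  shows "pd None ((Lap1 G) u) y = (Lap1 G) (pd None u) y + (Lap2 G) u y"
proof -
  note d = smooth_on_differentiable[OF _ y]
  have s: "smooth_on W (slice_div_grad G (mpd None (ginv G)) u)" "smooth_on W (pairing (ginv G) (trB G) u)"
    using smooth_on_slice_div_grad[OF G smooth_dGinv_tri u] smooth_on_pairing[OF G smooth_Ginv_tri smooth_trB_tri u] .
  have "pd None ((Lap1 G) u) y = pd None (\<lambda>y. slice_div_grad G (mpd None (ginv G)) u y + (1/2) * pairing (ginv G) (trB G) u y) y" by simp
  also have "\<dots> = pd None (slice_div_grad G (mpd None (ginv G)) u) y + (1/2) * pd None (pairing (ginv G) (trB G) u) y"
    by (subst pd_add pd_cmult, (rule d, intro smooth_intros openW_tri s)+)+ simp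
  finally show ?thesis
    unfolding pd_None_slice_div_grad[OF G y smooth_dGinv_tri u] pd_None_pairing[OF G y smooth_Ginv_tri smooth_trB_tri u] by (simp add: add_divide_distrib)
qed

private lemma pd_homogeneous_laplacian:
  assumes u: "smooth_on W u" and y: "y \<in> W"
  shows "pd None (homogeneous_laplacian G a u) y = (Lap0 G) (pd None u) y + (Lap1 G) u y
    - 2 * (pd None (pd None u) y + y $ None * pd None (pd None (pd None u)) y)
    + (2 * a + real CARD('n) - 2 - y $ None * (trB G) y) * pd None (pd None u) y
    - ((trB G) y + y $ None * (pd None (trB G)) y) * pd None u y + a / 2 * ((trB G) y * pd None u y + (pd None (trB G)) y * u y)"
proof -
  note d = smooth_on_differentiable[OF _ y]
  define c where "c = a / 2"
  have a: "a = 2 * c" by (simp add: c_def)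
  have e: "homogeneous_laplacian G a u = (\<lambda>y. (Lap0 G) u y - 2 * (y $ None * pd None (pd None u) y)
     + (2 * a + real CARD('n) - 2 - y $ None * (trB G) y) * pd None u y + c * ((trB G) y * u y))"
    by (simp add: homogeneous_laplacian_def fun_eq_iff c_def)
  note s = smooth_Lap0[OF u] smooth_trB_tri u smooth_on_pd[OF u] smooth_on_pd[OF smooth_on_pd[OF u]] smooth_on_coord openW_tri
  show ?thesis
    unfolding e unfolding a
    by (simp add: pd_add pd_diff pd_mult pd_cmult pd_coord d s smooth_on_add smooth_on_diff smooth_on_mult smooth_on_const pd_Lap0[OF u y])
      (simp add: algebra_simps)
qed

private lemma pd2_homogeneous_laplacian_0:
  assumes n: "CARD('n) = 6" and u: "smooth_on W u" and xW: "adjoin 0 x \<in> W"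
  shows "pd None (pd None (homogeneous_laplacian G 0 u)) (adjoin 0 x)
    = (Lap0 G) (pd None (pd None u)) (adjoin 0 x) + 2 * (Lap1 G) (pd None u) (adjoin 0 x) + (Lap2 G) u (adjoin 0 x)
      - 2 * (pd None (trB G)) (adjoin 0 x) * pd None u (adjoin 0 x) - 2 * (trB G) (adjoin 0 x) * pd None (pd None u) (adjoin 0 x)"
proof -
  let ?y = "adjoin 0 x"
  let ?Z = "\<lambda>y. 2 * pd None (pd None (pd None u)) y + (trB G) y * pd None (pd None u) y + (pd None (trB G)) y * pd None u y"
  note d = smooth_on_differentiable[OF _ xW]
  note s = smooth_Lap0[OF smooth_on_pd[OF u]] smooth_Lap1[OF u] smooth_trB_tri smooth_on_pd[OF smooth_trB_tri] u smooth_on_pd[OF u] smooth_on_pd[OF smooth_on_pd[OF u]]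
    smooth_on_pd[OF smooth_on_pd[OF smooth_on_pd[OF u]]] smooth_on_coord openW_tri
  have sZ: "smooth_on W ?Z" by (intro smooth_intros s)
  have "pd None (pd None (homogeneous_laplacian G 0 u)) ?y
      = pd None (\<lambda>y. (Lap0 G) (pd None u) y + (Lap1 G) u y + 2 * pd None (pd None u) y - (trB G) y * pd None u y - y $ None * ?Z y) ?y"
    by (rule pd_cong[OF openW_tri xW]) (simp add: pd_homogeneous_laplacian[OF u] n algebra_simps)
  also have "\<dots> = pd None ((Lap0 G) (pd None u)) ?y + pd None ((Lap1 G) u) ?y + 2 * pd None (pd None (pd None u)) ?y
      - ((trB G) ?y * pd None (pd None u) ?y + (pd None (trB G)) ?y * pd None u ?y) - ?Z ?y"
  proof -
    have 1: "pd None (\<lambda>y. y $ None * ?Z y) ?y = ?Z ?y"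
      by (subst pd_mult[OF d[OF smooth_on_coord] d[OF sZ]]) (simp add: pd_coord)
    have 2: "pd None (\<lambda>y. (trB G) y * pd None u y) ?y = (trB G) ?y * pd None (pd None u) ?y + (pd None (trB G)) ?y * pd None u ?y"
      by (rule pd_mult[OF d[OF smooth_trB_tri] d[OF smooth_on_pd[OF u]]])
    have 3: "pd None (\<lambda>y. 2 * pd None (pd None u) y) ?y = 2 * pd None (pd None (pd None u)) ?y"
      by (rule pd_cmult[OF d[OF smooth_on_pd[OF smooth_on_pd[OF u]]]])
    have "pd None (\<lambda>y. (Lap0 G) (pd None u) y + (Lap1 G) u y + 2 * pd None (pd None u) y - (trB G) y * pd None u y - y $ None * ?Z y) ?y
      = pd None (\<lambda>y. (Lap0 G) (pd None u) y + (Lap1 G) u y + 2 * pd None (pd None u) y - (trB G) y * pd None u y) ?y - pd None (\<lambda>y. y $ None * ?Z y) ?y"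
      by (rule pd_diff; rule d; intro smooth_intros s sZ)
    also have "pd None (\<lambda>y. (Lap0 G) (pd None u) y + (Lap1 G) u y + 2 * pd None (pd None u) y - (trB G) y * pd None u y) ?y
      = pd None (\<lambda>y. (Lap0 G) (pd None u) y + (Lap1 G) u y + 2 * pd None (pd None u) y) ?y - pd None (\<lambda>y. (trB G) y * pd None u y) ?y"
      by (rule pd_diff; rule d; intro smooth_intros s)
    also have "pd None (\<lambda>y. (Lap0 G) (pd None u) y + (Lap1 G) u y + 2 * pd None (pd None u) y) ?y
      = pd None (\<lambda>y. (Lap0 G) (pd None u) y + (Lap1 G) u y) ?y + pd None (\<lambda>y. 2 * pd None (pd None u) y) ?y"
      by (rule pd_add; rule d; intro smooth_on_add smooth_on_mult smooth_on_const s)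
    also have "pd None (\<lambda>y. (Lap0 G) (pd None u) y + (Lap1 G) u y) ?y = pd None ((Lap0 G) (pd None u)) ?y + pd None ((Lap1 G) u) ?y"
      by (rule pd_add; rule d; intro s)
    finally show ?thesis unfolding 1 2 3 .
  qed
  finally show ?thesis
    unfolding pd_Lap0[OF smooth_on_pd[OF u] xW] pd_Lap1[OF u xW] by (simp add: algebra_simps)
qed

text \<open>Three factors with \<open>a = 0, -2, -4\<close> involve the \<open>\<rho>\<close>-derivatives of \<open>f\<close> at \<open>\<rho> = 0\<close> up to the third order. All of them cancel,
  so that the operator does not depend on the extension of a function from \<open>\<rho> = 0\<close>.\<close>

lemma homogeneous_laplacian_triple:
  assumes n: "CARD('n) = 6" and f: "smooth_on W f" and xW: "adjoin 0 x \<in> W"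
  defines "y \<equiv> adjoin 0 x"
  shows "homogeneous_laplacian G (- 4) (homogeneous_laplacian G (- 2) (homogeneous_laplacian G 0 f)) y
    = (Lap0 G) ((Lap0 G) ((Lap0 G) f)) y - 4 * (Lap0 G) ((Lap1 G) f) y - 4 * (Lap1 G) ((Lap0 G) f) y + 8 * (Lap2 G) f y + 8 * (trB G) y * (Lap1 G) f y
      + 4 * (pd None (trB G)) y * (Lap0 G) f y - (Lap0 G) (\<lambda>y. (trB G) y * (Lap0 G) f y) y - 2 * (trB G) y * (Lap0 G) ((Lap0 G) f) y + 2 * ((trB G) y)\<^sup>2 * (Lap0 G) f y"
proof -
  let ?f1 = "homogeneous_laplacian G 0 f"
  let ?f2 = "homogeneous_laplacian G (- 2) ?f1"
  let ?v1 = "pd None f" and ?v2 = "pd None (pd None f)"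
  have yW: "y \<in> W" using xW by (simp add: y_def)
  have y0: "y $ None = 0" by (simp add: y_def)
  note sv = f smooth_on_pd[OF f] smooth_on_pd[OF smooth_on_pd[OF f]]
  have s1: "smooth_on W ?f1" by (rule smooth_on_homogeneous_laplacian[OF G f])
  have s2: "smooth_on W ?f2" by (rule smooth_on_homogeneous_laplacian[OF G s1])
  note add = slice_div_grad_add[OF G yW smooth_Ginv_tri] and cm = slice_div_grad_cmult[OF G yW smooth_Ginv_tri]
  note addK = slice_div_grad_add[OF G yW smooth_dGinv_tri] and cmK = slice_div_grad_cmult[OF G yW smooth_dGinv_tri]
  \<comment> \<open>The slice Laplacian at \<open>\<rho> = 0\<close> depends only on the restriction to \<open>\<rho> = 0\<close>, so that the two inner factors may be
    replaced by simpler functions with the same restriction.\<close>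
  have lc: "(Lap0 G) a y = (Lap0 G) b y"
    if "smooth_on W a" "smooth_on W b" "\<And>x. adjoin 0 x \<in> W \<Longrightarrow> a (adjoin 0 x) = b (adjoin 0 x)" for a b
    unfolding y_def by (rule slice_div_grad_slice_cong[OF G smooth_Ginv_tri that(1,2) xW that(3)])
  have e1: "?f1 (adjoin 0 x) = 4 * ?v1 (adjoin 0 x) + (Lap0 G) f (adjoin 0 x)" if "adjoin 0 x \<in> W" for x
    by (simp add: homogeneous_laplacian_def n)
  have sg1: "smooth_on W (\<lambda>y. 4 * ?v1 y + (Lap0 G) f y)" by (intro smooth_intros openW_tri sv smooth_Lap0)
  have e1': "pd None ?f1 z = 2 * ?v2 z - (trB G) z * ?v1 z + (Lap0 G) ?v1 z + (Lap1 G) f z" if "z \<in> W" "z $ None = 0" for z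
    by (simp add: pd_homogeneous_laplacian[OF f that(1)] n that(2))
  have sg1': "smooth_on W (\<lambda>z. 2 * ?v2 z - (trB G) z * ?v1 z + (Lap0 G) ?v1 z + (Lap1 G) f z)"
    by (intro smooth_on_add smooth_on_diff smooth_on_mult smooth_on_const openW_tri sv smooth_trB_tri smooth_Lap0 smooth_Lap1)
  have e1'': "pd None (pd None ?f1) y = (Lap0 G) ?v2 y + 2 * (Lap1 G) ?v1 y + (Lap2 G) f y - 2 * (pd None (trB G)) y * ?v1 y - 2 * (trB G) y * ?v2 y"
    unfolding y_def by (rule pd2_homogeneous_laplacian_0[OF n f xW])
  have e2: "?f2 (adjoin 0 x) = (Lap0 G) ?f1 (adjoin 0 x) - (trB G) (adjoin 0 x) * ?f1 (adjoin 0 x)" if "adjoin 0 x \<in> W" for x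
    by (simp add: homogeneous_laplacian_def[of G "- 2"] n)
  have e2': "pd None ?f2 y = - 2 * pd None (pd None ?f1) y - 2 * (trB G) y * pd None ?f1 y + (Lap0 G) (pd None ?f1) y + (Lap1 G) ?f1 y - (pd None (trB G)) y * ?f1 y"
    by (simp add: pd_homogeneous_laplacian[OF s1 yW] n y0)
  have L1: "(Lap0 G) ?f1 z = 4 * (Lap0 G) ?v1 z + (Lap0 G) ((Lap0 G) f) z" if z: "z \<in> W" "z $ None = 0" for z
  proof -
    have zz: "z = adjoin 0 (base z)" using adjoin_base[of z] z(2) by simp
    have "(Lap0 G) ?f1 z = (Lap0 G) (\<lambda>y. 4 * ?v1 y + (Lap0 G) f y) z"
      using slice_div_grad_slice_cong[OF G smooth_Ginv_tri s1 sg1, of 0 "base z"] e1 z by (simp flip: zz)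
    then show ?thesis
      by (simp add: slice_div_grad_add[OF G z(1) smooth_Ginv_tri _ smooth_Lap0[OF f]] slice_div_grad_cmult[OF G z(1) smooth_Ginv_tri] smooth_on_mult openW_tri smooth_on_const sv)
  qed
  have L1': "(Lap1 G) ?f1 y = 4 * (Lap1 G) ?v1 y + (Lap1 G) ((Lap0 G) f) y"
  proof -
    have pc: "pairing (ginv G) (trB G) ?f1 y = 4 * pairing (ginv G) (trB G) ?v1 y + pairing (ginv G) (trB G) ((Lap0 G) f) y"
    proof -
      have "pd (Some j) ?f1 y = 4 * pd (Some j) ?v1 y + pd (Some j) ((Lap0 G) f) y" for j
      proof -
        have d: "a differentiable (at (adjoin 0 x))" if "smooth_on W a" for a
          by (rule smooth_on_differentiable[OF that xW])
        have o: "open (slice W 0)" by (rule open_slice[OF openW_tri])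
        have xs: "x \<in> slice W 0" using xW by (simp add: slice_def)
        have "pd (Some j) ?f1 y = pd j (\<lambda>x. ?f1 (adjoin 0 x)) x" unfolding y_def by (rule pd_slice[OF d[OF s1], symmetric])
        also have "\<dots> = pd j (\<lambda>x. (\<lambda>y. 4 * ?v1 y + (Lap0 G) f y) (adjoin 0 x)) x"
          by (rule pd_cong[OF o xs]) (simp add: e1 slice_def)
        also have "\<dots> = pd (Some j) (\<lambda>y. 4 * ?v1 y + (Lap0 G) f y) y" unfolding y_def by (rule pd_slice[OF d[OF sg1]])
        also have "\<dots> = 4 * pd (Some j) ?v1 y + pd (Some j) ((Lap0 G) f) y"
          using d sv smooth_Lap0[OF f] by (simp add: pd_add pd_cmult y_def smooth_on_mult openW_tri smooth_on_const)
        finally show ?thesis .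
      qed
      then show ?thesis by (simp add: pairing_def sum.distrib sum_distrib_left algebra_simps)
    qed
    have "slice_div_grad G (mpd None (ginv G)) ?f1 y = slice_div_grad G (mpd None (ginv G)) (\<lambda>y. 4 * ?v1 y + (Lap0 G) f y) y"
      unfolding y_def by (rule slice_div_grad_slice_cong[OF G smooth_dGinv_tri s1 sg1 xW e1])
    also have "\<dots> = 4 * slice_div_grad G (mpd None (ginv G)) ?v1 y + slice_div_grad G (mpd None (ginv G)) ((Lap0 G) f) y"
      by (simp add: addK[OF _ smooth_Lap0[OF f]] cmK smooth_on_mult openW_tri smooth_on_const sv)
    finally show ?thesis using pc by simp
  qed
  have L1d: "(Lap0 G) (pd None ?f1) y = 2 * (Lap0 G) ?v2 y - (Lap0 G) (\<lambda>z. (trB G) z * ?v1 z) y + (Lap0 G) ((Lap0 G) ?v1) y + (Lap0 G) ((Lap1 G) f) y"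
  proof -
    have "(Lap0 G) (pd None ?f1) y = (Lap0 G) (\<lambda>z. 2 * ?v2 z - (trB G) z * ?v1 z + (Lap0 G) ?v1 z + (Lap1 G) f z) y"
      by (rule lc[OF smooth_on_pd[OF s1] sg1']) (simp add: e1')
    also have "\<dots> = (Lap0 G) (\<lambda>z. ((2 * ?v2 z + (-1) * ((trB G) z * ?v1 z)) + (Lap0 G) ?v1 z) + (Lap1 G) f z) y" by simp
    also have "\<dots> = (Lap0 G) (\<lambda>z. (2 * ?v2 z + (-1) * ((trB G) z * ?v1 z)) + (Lap0 G) ?v1 z) y + (Lap0 G) ((Lap1 G) f) y"
      by (rule add; intro smooth_on_add smooth_on_mult smooth_on_const openW_tri sv smooth_trB_tri smooth_Lap0 smooth_Lap1)
    also have "(Lap0 G) (\<lambda>z. (2 * ?v2 z + (-1) * ((trB G) z * ?v1 z)) + (Lap0 G) ?v1 z) y = (Lap0 G) (\<lambda>z. 2 * ?v2 z + (-1) * ((trB G) z * ?v1 z)) y + (Lap0 G) ((Lap0 G) ?v1) y"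
      by (rule add; intro smooth_on_add smooth_on_mult smooth_on_const openW_tri sv smooth_trB_tri smooth_Lap0)
    also have "(Lap0 G) (\<lambda>z. 2 * ?v2 z + (-1) * ((trB G) z * ?v1 z)) y = (Lap0 G) (\<lambda>z. 2 * ?v2 z) y + (Lap0 G) (\<lambda>z. (-1) * ((trB G) z * ?v1 z)) y"
      by (rule add; intro smooth_on_mult smooth_on_const openW_tri sv smooth_trB_tri)
    also have "(Lap0 G) (\<lambda>z. 2 * ?v2 z) y = 2 * (Lap0 G) ?v2 y" by (rule cm[OF sv(3)])
    also have "(Lap0 G) (\<lambda>z. (-1) * ((trB G) z * ?v1 z)) y = (-1) * (Lap0 G) (\<lambda>z. (trB G) z * ?v1 z) y"
      by (rule cm[OF smooth_on_mult[OF openW_tri smooth_trB_tri sv(2)]])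
    finally show ?thesis by simp
  qed
  have L2: "(Lap0 G) ?f2 y = 4 * (Lap0 G) ((Lap0 G) ?v1) y + (Lap0 G) ((Lap0 G) ((Lap0 G) f)) y - 4 * (Lap0 G) (\<lambda>z. (trB G) z * ?v1 z) y - (Lap0 G) (\<lambda>z. (trB G) z * (Lap0 G) f z) y"
  proof -
    let ?g = "\<lambda>z. (4 * (Lap0 G) ?v1 z + (Lap0 G) ((Lap0 G) f) z) + ((-4) * ((trB G) z * ?v1 z) + (-1) * ((trB G) z * (Lap0 G) f z))"
    have "(Lap0 G) ?f2 y = (Lap0 G) ?g y"
    proof (rule lc[OF s2])
      show "smooth_on W ?g" by (intro smooth_on_add smooth_on_mult smooth_on_const openW_tri sv smooth_trB_tri smooth_Lap0)
      show "?f2 (adjoin 0 x) = ?g (adjoin 0 x)" if "adjoin 0 x \<in> W" for x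
        unfolding e2[OF that] e1[OF that] using L1[of "adjoin 0 x"] that by (simp add: algebra_simps)
    qed
    also have "\<dots> = (Lap0 G) (\<lambda>z. 4 * (Lap0 G) ?v1 z + (Lap0 G) ((Lap0 G) f) z) y + (Lap0 G) (\<lambda>z. (-4) * ((trB G) z * ?v1 z) + (-1) * ((trB G) z * (Lap0 G) f z)) y"
      by (rule add; intro smooth_on_add smooth_on_mult smooth_on_const openW_tri sv smooth_trB_tri smooth_Lap0)
    also have "(Lap0 G) (\<lambda>z. 4 * (Lap0 G) ?v1 z + (Lap0 G) ((Lap0 G) f) z) y = (Lap0 G) (\<lambda>z. 4 * (Lap0 G) ?v1 z) y + (Lap0 G) ((Lap0 G) ((Lap0 G) f)) y"
      by (rule add; intro smooth_on_mult smooth_on_const openW_tri sv smooth_Lap0)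
    also have "(Lap0 G) (\<lambda>z. 4 * (Lap0 G) ?v1 z) y = 4 * (Lap0 G) ((Lap0 G) ?v1) y" by (rule cm[OF smooth_Lap0[OF sv(2)]])
    also have "(Lap0 G) (\<lambda>z. (-4) * ((trB G) z * ?v1 z) + (-1) * ((trB G) z * (Lap0 G) f z)) y = (Lap0 G) (\<lambda>z. (-4) * ((trB G) z * ?v1 z)) y + (Lap0 G) (\<lambda>z. (-1) * ((trB G) z * (Lap0 G) f z)) y"
      by (rule add; intro smooth_on_mult smooth_on_const openW_tri sv smooth_trB_tri smooth_Lap0)
    also have "(Lap0 G) (\<lambda>z. (-4) * ((trB G) z * ?v1 z)) y = (-4) * (Lap0 G) (\<lambda>z. (trB G) z * ?v1 z) y"
      by (rule cm[OF smooth_on_mult[OF openW_tri smooth_trB_tri sv(2)]])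
    also have "(Lap0 G) (\<lambda>z. (-1) * ((trB G) z * (Lap0 G) f z)) y = (-1) * (Lap0 G) (\<lambda>z. (trB G) z * (Lap0 G) f z) y"
      by (rule cm[OF smooth_on_mult[OF openW_tri smooth_trB_tri smooth_Lap0[OF f]]])
    finally show ?thesis by simp
  qed
  have f1y: "?f1 y = 4 * ?v1 y + (Lap0 G) f y" unfolding y_def by (rule e1[OF xW])
  have f2y: "?f2 y = (Lap0 G) ?f1 y - (trB G) y * ?f1 y" unfolding y_def by (rule e2[OF xW])
  have "homogeneous_laplacian G (- 4) ?f2 y = (Lap0 G) ?f2 y - 4 * pd None ?f2 y - 2 * (trB G) y * ?f2 y"
    by (simp add: homogeneous_laplacian_def[of G "- 4"] n y0)
  then show ?thesis
    unfolding e2' e1'' e1'[OF yW y0] L1d L1' L2 f2y L1[OF yW y0] f1y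
    by (simp add: algebra_simps power2_eq_square)
qed

end


lemma mat_eq_scaleR: "(mat c :: real^'n^'n) = c *\<^sub>R mat 1"
  by (simp add: vec_eq_iff mat_def)

lemma div_grad_cong:
  assumes U: "open U" "x \<in> U" and A: "\<And>x. x \<in> U \<Longrightarrow> A x = A' x"
  shows "div_grad g A f x = div_grad g A' f x"
proof -
  have "pd i (\<lambda>x. (A x *v grad_form f x) $ i) x = pd i (\<lambda>x. (A' x *v grad_form f x) $ i) x" for i
    by (rule pd_cong[OF U]) (simp add: A)
  then show ?thesis by (simp add: div_grad_def divg_def A[OF U(2)])
qed

lemma delta_T_d_cong:
  assumes "open U" "\<And>x. x \<in> U \<Longrightarrow> f x = f' x"
  shows "delta_T_d U g T f = delta_T_d U g T f'"
  unfolding delta_T_d_def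
  by (rule codifferential_cong) (simp_all add: grad_form_cong[OF assms(1) _ assms(2)])

section \<open>The operator in divergence form\<close>

text \<open>These are \<open>g\<^sup>-\<^sup>1 T\<^sub>2\<close> and \<open>- g\<^sup>-\<^sup>1 T\<^sub>4\<close> at \<open>\<rho> = 0\<close> when the family satisfies the Einstein equation. With the volume
  density \<open>\<sigma>\<close>, they are \<open>(\<sigma> g\<^sup>-\<^sup>1)' / \<sigma>\<close> and \<open>(\<sigma> g\<^sup>-\<^sup>1)'' / \<sigma>\<close>.\<close>

definition T2_raised :: "(real^('n::finite option) \<Rightarrow> real^'n^'n) \<Rightarrow> real^('n option) \<Rightarrow> real^'n^'n" where
  "T2_raised G y = mpd None (\<lambda>y. matrix_inv (G y)) y + (1 / 2 * trace (rate G y)) *\<^sub>R matrix_inv (G y)"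

definition T4_raised :: "(real^('n::finite option) \<Rightarrow> real^'n^'n) \<Rightarrow> real^('n option) \<Rightarrow> real^'n^'n" where
  "T4_raised G y = (mpd None (mpd None (\<lambda>y. matrix_inv (G y))) y + trace (rate G y) *\<^sub>R mpd None (\<lambda>y. matrix_inv (G y)) y)
     + (1 / 2 * pd None (\<lambda>y. trace (rate G y)) y + 1 / 4 * (trace (rate G y) * trace (rate G y))) *\<^sub>R matrix_inv (G y)"

context
  fixes W :: "(real^('n::finite option)) set" and G :: "real^('n option) \<Rightarrow> real^'n^'n"
  assumes G: "metric_on W G"
begin

private lemma openW_fin: "open W"
  using G by (rule metric_onD)

private lemmas smooth_G_fin = metric_on_smooth_mat[OF G]
private lemmas smooth_Ginv_fin = metric_on_inverse_smooth_mat[OF G]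
private lemmas smooth_dGinv_fin = smooth_mat_mpd[OF smooth_Ginv_fin, of None]
private lemmas smooth_ddGinv_fin = smooth_mat_mpd[OF smooth_dGinv_fin, of None]

private lemma smooth_trB_fin: "smooth_on W (\<lambda>y. trace (rate G y))"
  by (rule smooth_mat_trace[OF openW_fin smooth_mat_rate[OF G]])

lemma smooth_mat_T_raised: "smooth_mat W (T2_raised G)" "smooth_mat W (T4_raised G)"
  unfolding T2_raised_def[abs_def] T4_raised_def[abs_def]
  by (intro smooth_mat_add smooth_mat_scale smooth_mat_mpd smooth_intros openW_fin smooth_Ginv_fin smooth_trB_fin)+

text \<open>The product rule \<open>div (\<phi> A df) = \<phi> div (A df) + \<langle>d\<phi>, A df\<rangle>\<close> collects the terms into divergence form.\<close>

lemma homogeneous_laplacian_triple_divergence_form: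
  assumes n: "CARD('n) = 6" and f: "smooth_on W f" and xW: "adjoin 0 x \<in> W"
  shows "homogeneous_laplacian G (- 4) (homogeneous_laplacian G (- 2) (homogeneous_laplacian G 0 f)) (adjoin 0 x)
    = (Lap0 G) ((Lap0 G) ((Lap0 G) f)) (adjoin 0 x) + 4 * (Lap0 G) (\<lambda>y. (- 1) * slice_div_grad G (T2_raised G) f y) (adjoin 0 x)
      - 4 * slice_div_grad G (T2_raised G) ((Lap0 G) f) (adjoin 0 x)
      + 2 * (Lap0 G) (\<lambda>y. (1 / 2 * trace (rate G y)) * (Lap0 G) f y) (adjoin 0 x) + 8 * slice_div_grad G (T4_raised G) f (adjoin 0 x)"
proof -
  let ?y = "adjoin 0 x" and ?h = "\<lambda>y. matrix_inv (G y)" and ?t = "\<lambda>y. trace (rate G y)"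
  let ?K = "mpd None ?h"
  let ?L' = "\<lambda>u y. slice_div_grad G ?K u y + pairing ?h ?t u y / 2"
  note sm = smooth_intros openW_fin smooth_trB_fin smooth_on_slice_div_grad[OF G smooth_Ginv_fin] smooth_on_slice_div_grad[OF G smooth_dGinv_fin] smooth_on_pairing[OF G smooth_Ginv_fin smooth_trB_fin]
  have T2: "slice_div_grad G (T2_raised G) u z = ?L' u z + 1 / 2 * (?t z * (Lap0 G) u z)" if u: "smooth_on W u" and z: "z \<in> W" for u z
  proof -
    have "pairing ?h (\<lambda>y. 1 / 2 * ?t y) u z = 1 / 2 * pairing ?h ?t u z"
      unfolding pairing_def
      by (simp only: pd_cmult[OF smooth_on_differentiable[OF smooth_trB_fin z]] sum_distrib_left mult.assoc)
    moreover have "slice_div_grad G (T2_raised G) u z = slice_div_grad G ?K u z + slice_div_grad G (\<lambda>y. (1 / 2 * ?t y) *\<^sub>R ?h y) u z"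
      unfolding T2_raised_def[abs_def] by (intro slice_div_grad_add_left[OF G z] smooth_dGinv_fin smooth_mat_scale sm smooth_Ginv_fin u)
    moreover have "slice_div_grad G (\<lambda>y. (1 / 2 * ?t y) *\<^sub>R ?h y) u z = 1 / 2 * ?t z * (Lap0 G) u z + pairing ?h (\<lambda>y. 1 / 2 * ?t y) u z"
      by (rule slice_div_grad_scale_left[OF G z smooth_Ginv_fin _ u]) (intro sm)
    ultimately show ?thesis by simp
  qed
  have sL': "smooth_on W (?L' f)" unfolding divide_inverse by (intro sm f)
  have a: "(Lap0 G) (\<lambda>y. (- 1) * slice_div_grad G (T2_raised G) f y) ?y = - (Lap0 G) (?L' f) ?y - 1 / 2 * (Lap0 G) (\<lambda>y. ?t y * (Lap0 G) f y) ?y"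
  proof -
    have s: "smooth_on W (slice_div_grad G (T2_raised G) f)" by (rule smooth_on_slice_div_grad[OF G smooth_mat_T_raised(1) f])
    have "(Lap0 G) (\<lambda>y. (- 1) * slice_div_grad G (T2_raised G) f y) ?y = (- 1) * (Lap0 G) (slice_div_grad G (T2_raised G) f) ?y"
      by (rule slice_div_grad_cmult[OF G xW smooth_Ginv_fin s])
    also have "(Lap0 G) (slice_div_grad G (T2_raised G) f) ?y = (Lap0 G) (\<lambda>y. ?L' f y + 1 / 2 * (?t y * (Lap0 G) f y)) ?y"
      by (rule slice_div_grad_slice_cong[OF G smooth_Ginv_fin s _ xW T2[OF f]]) (intro smooth_on_add smooth_on_mult smooth_on_const sL' sm f)
    also have "\<dots> = (Lap0 G) (?L' f) ?y + (Lap0 G) (\<lambda>y. 1 / 2 * (?t y * (Lap0 G) f y)) ?y"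
      by (intro slice_div_grad_add[OF G xW smooth_Ginv_fin sL'] smooth_on_mult smooth_on_const sm f)
    also have "(Lap0 G) (\<lambda>y. 1 / 2 * (?t y * (Lap0 G) f y)) ?y = 1 / 2 * (Lap0 G) (\<lambda>y. ?t y * (Lap0 G) f y) ?y"
      by (rule slice_div_grad_cmult[OF G xW smooth_Ginv_fin]) (intro sm f)
    finally show ?thesis by simp
  qed
  have b: "(Lap0 G) (\<lambda>y. (1 / 2 * ?t y) * (Lap0 G) f y) ?y = 1 / 2 * (Lap0 G) (\<lambda>y. ?t y * (Lap0 G) f y) ?y"
    unfolding mult.assoc by (rule slice_div_grad_cmult[OF G xW smooth_Ginv_fin]) (intro sm f)
  have T4: "slice_div_grad G (T4_raised G) f ?y = slice_div_grad G (mpd None ?K) f ?y + pairing ?K ?t f ?y + pairing ?h (pd None ?t) f ?y / 2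
      + ?t ?y * ?L' f ?y + (pd None ?t ?y / 2 + (?t ?y)\<^sup>2 / 4) * (Lap0 G) f ?y"
  proof -
    let ?p = "\<lambda>y. 1 / 2 * pd None ?t y + 1 / 4 * (?t y * ?t y)"
    note d = smooth_on_differentiable[OF _ xW]
    have "pd i ?p ?y = 1 / 2 * pd i (pd None ?t) ?y + 1 / 2 * ?t ?y * pd i ?t ?y" for i
    proof -
      have "pd i ?p ?y = pd i (\<lambda>y. 1 / 2 * pd None ?t y) ?y + pd i (\<lambda>y. 1 / 4 * (?t y * ?t y)) ?y"
        by (rule pd_add; rule d; intro sm)
      also have "pd i (\<lambda>y. 1 / 2 * pd None ?t y) ?y = 1 / 2 * pd i (pd None ?t) ?y"
        by (rule pd_cmult; rule d; intro sm)
      also have "pd i (\<lambda>y. 1 / 4 * (?t y * ?t y)) ?y = 1 / 4 * pd i (\<lambda>y. ?t y * ?t y) ?y"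
        by (rule pd_cmult; rule d; intro sm)
      also have "pd i (\<lambda>y. ?t y * ?t y) ?y = ?t ?y * pd i ?t ?y + pd i ?t ?y * ?t ?y"
        by (rule pd_mult; rule d; intro sm)
      finally show ?thesis by simp
    qed
    then have pp: "pairing ?h ?p f ?y = pairing ?h (pd None ?t) f ?y / 2 + ?t ?y * pairing ?h ?t f ?y / 2"
      unfolding pairing_def by (simp add: sum.distrib sum_distrib_left sum_divide_distrib algebra_simps)
    have "slice_div_grad G (T4_raised G) f ?y = slice_div_grad G (\<lambda>y. mpd None ?K y + ?t y *\<^sub>R ?K y) f ?y + slice_div_grad G (\<lambda>y. ?p y *\<^sub>R ?h y) f ?y"
      unfolding T4_raised_def[abs_def]
      by (intro slice_div_grad_add_left[OF G xW] smooth_dGinv_fin smooth_ddGinv_fin smooth_mat_add smooth_mat_scale sm smooth_Ginv_fin f)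
    also have "slice_div_grad G (\<lambda>y. mpd None ?K y + ?t y *\<^sub>R ?K y) f ?y = slice_div_grad G (mpd None ?K) f ?y + slice_div_grad G (\<lambda>y. ?t y *\<^sub>R ?K y) f ?y"
      by (intro slice_div_grad_add_left[OF G xW] smooth_dGinv_fin smooth_ddGinv_fin smooth_mat_scale sm f)
    also have "slice_div_grad G (\<lambda>y. ?t y *\<^sub>R ?K y) f ?y = ?t ?y * slice_div_grad G ?K f ?y + pairing ?K ?t f ?y"
      by (rule slice_div_grad_scale_left[OF G xW smooth_dGinv_fin smooth_trB_fin f])
    also have "slice_div_grad G (\<lambda>y. ?p y *\<^sub>R ?h y) f ?y = ?p ?y * (Lap0 G) f ?y + pairing ?h ?p f ?y"
      by (rule slice_div_grad_scale_left[OF G xW smooth_Ginv_fin _ f]) (intro sm)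
    finally show ?thesis unfolding pp by (simp add: power2_eq_square algebra_simps)
  qed
  have sLf: "smooth_on W ((Lap0 G) f)" by (intro sm f)
  show ?thesis
    unfolding homogeneous_laplacian_triple[OF G n f xW] a b T4 T2[OF sLf xW]
    by (simp add: algebra_simps power2_eq_square)
qed

context
  assumes n: "CARD('n) = 6"
    and tangential: "\<And>x a b. adjoin 0 x \<in> W \<Longrightarrow> einstein_tangential G a b (adjoin 0 x) = 0"
    and tangential': "\<And>x a b. adjoin 0 x \<in> W \<Longrightarrow> pd None (einstein_tangential G a b) (adjoin 0 x) = 0"
    and mixed: "\<And>x a. adjoin 0 x \<in> W \<Longrightarrow> einstein_mixed G a (adjoin 0 x) = 0"
    and normal: "\<And>x. adjoin 0 x \<in> W \<Longrightarrow> einstein_normal G (adjoin 0 x) = 0"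
begin

private lemma dim_gt_2: "CARD('n) > 2"
  using n by simp

private lemma first_order:
  assumes "adjoin 0 x \<in> W"
  shows "mpd None G (adjoin 0 x) = 2 *\<^sub>R schouten (initial G) x" "trace (rate G (adjoin 0 x)) = 2 * schouten_J (initial G) x"
  using first_coefficient[OF G dim_gt_2 tangential tangential' mixed normal] assms by blast+

private lemma second_order:
  assumes "adjoin 0 x \<in> W"
  shows "mpd None (mpd None G) (adjoin 0 x) = 2 *\<^sub>R (schouten (initial G) x ** matrix_inv ((initial G) x) ** schouten (initial G) x) - bach (initial G) x"
proof -
  have "(real CARD('n) / 2 - 2) *\<^sub>R mpd None (mpd None G) (adjoin 0 x)
    = (real CARD('n) - 4) *\<^sub>R (schouten (initial G) x ** matrix_inv ((initial G) x) ** schouten (initial G) x) - bach (initial G) x"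
    using second_coefficient[OF G dim_gt_2 tangential tangential' mixed normal] assms by blast
  then show ?thesis by (simp add: n)
qed

private lemma trace_order:
  assumes "adjoin 0 x \<in> W"
  shows "pd None (\<lambda>y. trace (rate G y)) (adjoin 0 x) = - 2 * schouten_norm2 (initial G) x"
  using derivative_of_trace[OF G dim_gt_2 tangential tangential' mixed normal] assms by blast

lemma T2_raised_slice:
  assumes xW: "adjoin 0 x \<in> W"
  shows "T2_raised G (adjoin 0 x) = matrix_inv ((initial G) x) ** T2 (initial G) x"
  unfolding T2_raised_def mpd_matrix_inv[OF G xW] first_order(1)[OF xW] first_order(2)[OF xW] T2_def endo_def
  by (simp add: matrix_algebra mat_eq_scaleR[of "schouten_J (initial G) x"])

text \<open>Substitute \<open>g' = 2P\<close>, \<open>g'' = 2 P\<^sup>2 - B\<close>, \<open>\<theta> = 2J\<close> and \<open>\<theta>' = - 2 \<bar>P\<bar>\<^sup>2\<close> into \<open>(\<sigma> g\<^sup>-\<^sup>1)'' / \<sigma>\<close>.\<close>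

lemma T4_raised_slice:
  assumes xW: "adjoin 0 x \<in> W"
  shows "T4_raised G (adjoin 0 x) = - (matrix_inv ((initial G) x) ** T4 (initial G) x)"
proof -
  let ?y = "adjoin 0 x" and ?h = "matrix_inv ((initial G) x)" and ?P = "schouten (initial G) x"
  let ?H = "\<lambda>y. matrix_inv (G y)"
  have G'': "mpd None (mpd None G) ?y = 2 *\<^sub>R (?P ** ?h ** ?P) - bach (initial G) x"
    by (rule second_order[OF xW])
  have "mpd None (mpd None ?H) ?y = mpd None (\<lambda>y. - (?H y ** mpd None G y ** ?H y)) ?y"
    by (rule mpd_cong[OF openW_fin xW]) (simp add: mpd_matrix_inv[OF G])
  also have "\<dots> = - (?h ** mpd None G ?y ** mpd None ?H ?y + (?h ** mpd None (mpd None G) ?y + mpd None ?H ?y ** mpd None G ?y) ** ?h)"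
    by (simp add: mpd_uminus[OF xW smooth_mat_mult[OF openW_fin smooth_mat_mult[OF openW_fin smooth_Ginv_fin smooth_mat_mpd[OF smooth_G_fin]] smooth_Ginv_fin]]
       mpd_mult[OF xW openW_fin smooth_mat_mult[OF openW_fin smooth_Ginv_fin smooth_mat_mpd[OF smooth_G_fin]] smooth_Ginv_fin]
       mpd_mult[OF xW openW_fin smooth_Ginv_fin smooth_mat_mpd[OF smooth_G_fin]])
  finally have K': "mpd None (mpd None ?H) ?y
      = - (?h ** mpd None G ?y ** mpd None ?H ?y + (?h ** mpd None (mpd None G) ?y + mpd None ?H ?y ** mpd None G ?y) ** ?h)" .
  show ?thesis
    unfolding T4_raised_def K' G'' mpd_matrix_inv[OF G xW] first_order(1)[OF xW] first_order(2)[OF xW] trace_order[OF xW] T4_def endo_def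
      mat_eq_scaleR[of "- (schouten_J (initial G) x)\<^sup>2 + schouten_norm2 (initial G) x"]
    by (simp add: matrix_algebra power2_eq_square algebra_simps)
      (simp add: vec_eq_iff algebra_simps)
qed

text \<open>On the slice \<open>\<rho> = 0\<close> the operators of the family become those of the metric \<open>g\<close>. The tensors \<open>T\<^sub>2\<close> and \<open>T\<^sub>4\<close> are smooth,
  because the raised tensors are.\<close>

context
  fixes u :: "real^('n option) \<Rightarrow> real"
  assumes u: "smooth_on W u"
begin

lemma LapG_slice:
  assumes xW: "adjoin 0 x \<in> W"
  shows "(Lap0 G) u (adjoin 0 x) = laplacian (slice W 0) (initial G) (\<lambda>x. u (adjoin 0 x)) x"
  using laplacian_eq_div_grad[OF metric_on_slice[OF G] smooth_on_slice[OF openW_fin u], of x 0] xW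
  by (simp add: slice_div_grad_slice[OF G smooth_Ginv_fin u xW] slice_def)

lemma smooth_mat_of_raised:
  assumes A: "smooth_mat W A" and eq: "\<And>x. adjoin 0 x \<in> W \<Longrightarrow> A (adjoin 0 x) = c *\<^sub>R (matrix_inv ((initial G) x) ** T x)" and c: "c \<noteq> 0"
  shows "smooth_mat (slice W 0) T"
proof (rule smooth_mat_cong[OF open_slice[OF openW_fin]])
  show "smooth_mat (slice W 0) (\<lambda>x. (1 / c) *\<^sub>R ((initial G) x ** A (adjoin 0 x)))"
    by (intro smooth_mat_scale smooth_mat_mult open_slice openW_fin smooth_on_const smooth_mat_slice smooth_G_fin A)
  show "(1 / c) *\<^sub>R ((initial G) x ** A (adjoin 0 x)) = T x" if "x \<in> (slice W 0)" for x
    using that c metric_on_inverse(1)[OF G, of "adjoin 0 x"] by (simp add: slice_def eq matrix_algebra)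
qed

lemma slice_div_grad_T2_slice:
  assumes xW: "adjoin 0 x \<in> W"
  shows "slice_div_grad G (T2_raised G) u (adjoin 0 x) = - delta_T_d (slice W 0) (initial G) (T2 (initial G)) (\<lambda>x. u (adjoin 0 x)) x"
proof -
  have x: "x \<in> (slice W 0)" using xW by (simp add: slice_def)
  have "smooth_mat (slice W 0) (T2 (initial G))"
    by (rule smooth_mat_of_raised[OF smooth_mat_T_raised(1), of 1]) (simp_all add: T2_raised_slice)
  then have "delta_T_d (slice W 0) (initial G) (T2 (initial G)) (\<lambda>x. u (adjoin 0 x)) x
      = - div_grad (initial G) (\<lambda>x. matrix_inv ((initial G) x) ** T2 (initial G) x) (\<lambda>x. u (adjoin 0 x)) x"
    by (rule delta_T_d_eq_div_grad[OF metric_on_slice[OF G] smooth_on_slice[OF openW_fin u] _ x])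
  also have "div_grad (initial G) (\<lambda>x. matrix_inv ((initial G) x) ** T2 (initial G) x) (\<lambda>x. u (adjoin 0 x)) x
      = div_grad (initial G) (\<lambda>x. T2_raised G (adjoin 0 x)) (\<lambda>x. u (adjoin 0 x)) x"
    by (rule div_grad_cong[OF open_slice[OF openW_fin] x]) (simp add: T2_raised_slice slice_def)
  finally show ?thesis by (simp add: slice_div_grad_slice[OF G smooth_mat_T_raised(1) u xW])
qed

lemma slice_div_grad_T4_slice:
  assumes xW: "adjoin 0 x \<in> W"
  shows "slice_div_grad G (T4_raised G) u (adjoin 0 x) = delta_T_d (slice W 0) (initial G) (T4 (initial G)) (\<lambda>x. u (adjoin 0 x)) x"
proof -
  have x: "x \<in> (slice W 0)" using xW by (simp add: slice_def)
  have T: "smooth_mat (slice W 0) (\<lambda>x. - T4 (initial G) x)"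
    by (rule smooth_mat_of_raised[OF smooth_mat_T_raised(2), of 1]) (simp_all add: T4_raised_slice matrix_minus_right)
  then have "smooth_mat (slice W 0) (\<lambda>x. - (- T4 (initial G) x))" by (rule smooth_mat_uminus[OF open_slice[OF openW_fin]])
  then have "delta_T_d (slice W 0) (initial G) (T4 (initial G)) (\<lambda>x. u (adjoin 0 x)) x
      = - div_grad (initial G) (\<lambda>x. matrix_inv ((initial G) x) ** T4 (initial G) x) (\<lambda>x. u (adjoin 0 x)) x"
    by (intro delta_T_d_eq_div_grad[OF metric_on_slice[OF G] smooth_on_slice[OF openW_fin u] _ x]) simp
  also have "\<dots> = div_grad (initial G) (\<lambda>x. - (matrix_inv ((initial G) x) ** T4 (initial G) x)) (\<lambda>x. u (adjoin 0 x)) x"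
  proof -
    have "smooth_on (slice W 0) (\<lambda>x. (matrix_inv ((initial G) x) ** T4 (initial G) x *v grad_form (\<lambda>x. u (adjoin 0 x)) x) $ i)" for i
    proof -
      have "smooth_mat (slice W 0) (\<lambda>x. matrix_inv ((initial G) x) ** - (- T4 (initial G) x))"
        by (intro smooth_mat_mult smooth_mat_uminus open_slice openW_fin metric_on_inverse_smooth_mat[OF metric_on_slice[OF G]] T)
      then show ?thesis
        unfolding matrix_vector_mult_def vec_lambda_beta
        by (intro smooth_intros open_slice openW_fin smooth_on_grad_form smooth_on_slice u) (simp add: smooth_matD)
    qed
    note d = smooth_on_differentiable[OF this x]
    have m: "(- A) *v w = - (A *v w)" for A :: "real^'n^'n" and w
      by (simp add: matrix_vector_mult_def vec_eq_iff sum_negf)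
    show ?thesis unfolding div_grad_def divg_def
      by (simp add: m pd_minus[OF d] sum.distrib sum_negf sum_subtractf)
  qed
  also have "\<dots> = div_grad (initial G) (\<lambda>x. T4_raised G (adjoin 0 x)) (\<lambda>x. u (adjoin 0 x)) x"
    by (rule div_grad_cong[OF open_slice[OF openW_fin] x]) (simp add: T4_raised_slice slice_def)
  finally show ?thesis by (simp add: slice_div_grad_slice[OF G smooth_mat_T_raised(2) u xW])
qed

end

lemma homogeneous_laplacian_triple_eq:
  assumes f: "smooth_on W f" and xW: "adjoin 0 x \<in> W"
  defines "V \<equiv> slice W 0" and "w \<equiv> \<lambda>x. f (adjoin 0 x)"
  shows "homogeneous_laplacian G (- 4) (homogeneous_laplacian G (- 2) (homogeneous_laplacian G 0 f)) (adjoin 0 x)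
    = laplacian V (initial G) (laplacian V (initial G) (laplacian V (initial G) w)) x
      + 4 * laplacian V (initial G) (delta_T_d V (initial G) (T2 (initial G)) w) x
      + 4 * delta_T_d V (initial G) (T2 (initial G)) (laplacian V (initial G) w) x
      + 2 * laplacian V (initial G) (\<lambda>x. schouten_J (initial G) x * laplacian V (initial G) w x) x
      + 8 * delta_T_d V (initial G) (T4 (initial G)) w x"
proof -
  have V: "open V" unfolding V_def by (rule open_slice[OF openW_fin])
  have VW: "z \<in> V \<longleftrightarrow> adjoin 0 z \<in> W" for z by (simp add: V_def slice_def)
  note lc = laplacian_cong[OF V refl]
  have s1: "smooth_on W ((Lap0 G) f)" and s2: "smooth_on W ((Lap0 G) ((Lap0 G) f))"
    by (intro smooth_on_slice_div_grad[OF G smooth_Ginv_fin] f)+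
  have s3: "smooth_on W (\<lambda>y. (- 1) * slice_div_grad G (T2_raised G) f y)"
    by (intro smooth_on_mult openW_fin smooth_on_const smooth_on_slice_div_grad[OF G smooth_mat_T_raised(1) f])
  have s4: "smooth_on W (\<lambda>y. (1 / 2 * trace (rate G y)) * (Lap0 G) f y)"
    by (intro smooth_on_mult openW_fin smooth_on_const smooth_trB_fin s1)
  have 1: "(Lap0 G) f (adjoin 0 z) = laplacian V (initial G) w z" if "z \<in> V" for z
    using LapG_slice[OF f, of z] that by (simp add: V_def w_def slice_def)
  have 2: "(Lap0 G) ((Lap0 G) f) (adjoin 0 z) = laplacian V (initial G) (laplacian V (initial G) w) z" if "z \<in> V" for z
    using LapG_slice[OF s1, of z] that lc[of "\<lambda>x. (Lap0 G) f (adjoin 0 x)" "laplacian V (initial G) w", OF 1]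
    by (simp add: VW flip: V_def)
  have 3: "(Lap0 G) ((Lap0 G) ((Lap0 G) f)) (adjoin 0 x) = laplacian V (initial G) (laplacian V (initial G) (laplacian V (initial G) w)) x"
    using LapG_slice[OF s2 xW] lc[of "\<lambda>x. (Lap0 G) ((Lap0 G) f) (adjoin 0 x)" "laplacian V (initial G) (laplacian V (initial G) w)", OF 2]
    by (simp flip: V_def)
  have 4: "(Lap0 G) (\<lambda>y. (- 1) * slice_div_grad G (T2_raised G) f y) (adjoin 0 x) = laplacian V (initial G) (delta_T_d V (initial G) (T2 (initial G)) w) x"
    using LapG_slice[OF s3 xW] lc[of "\<lambda>x. (- 1) * slice_div_grad G (T2_raised G) f (adjoin 0 x)" "delta_T_d V (initial G) (T2 (initial G)) w"]
      slice_div_grad_T2_slice[OF f] by (simp add: VW w_def flip: V_def)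
  have 5: "slice_div_grad G (T2_raised G) ((Lap0 G) f) (adjoin 0 x) = - delta_T_d V (initial G) (T2 (initial G)) (laplacian V (initial G) w) x"
    using slice_div_grad_T2_slice[OF s1 xW] delta_T_d_cong[OF V, of "\<lambda>x. (Lap0 G) f (adjoin 0 x)" "laplacian V (initial G) w", OF 1]
    by (simp flip: V_def)
  have 6: "(Lap0 G) (\<lambda>y. (1 / 2 * trace (rate G y)) * (Lap0 G) f y) (adjoin 0 x)
      = laplacian V (initial G) (\<lambda>x. schouten_J (initial G) x * laplacian V (initial G) w x) x"
    using LapG_slice[OF s4 xW] lc[of "\<lambda>x. (1 / 2 * trace (rate G (adjoin 0 x))) * (Lap0 G) f (adjoin 0 x)"
        "\<lambda>x. schouten_J (initial G) x * laplacian V (initial G) w x"] first_order(2) 1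
    by (simp add: VW flip: V_def)
  have 7: "slice_div_grad G (T4_raised G) f (adjoin 0 x) = delta_T_d V (initial G) (T4 (initial G)) w x"
    using slice_div_grad_T4_slice[OF f xW] by (simp add: w_def V_def)
  show ?thesis
    unfolding homogeneous_laplacian_triple_divergence_form[OF n f xW] 3 4 5 6 7 by simp
qed

end

end

section \<open>Charts and collars\<close>

lemma chart_inv_props:
  assumes "is_chart M c"
  shows "x \<in> chart_image c \<Longrightarrow> chart_inv c x \<in> fst c" "x \<in> chart_image c \<Longrightarrow> snd c (chart_inv c x) = x"
    "fst c \<subseteq> topspace M" "continuous_map (top_of_set (chart_image c)) M (chart_inv c)"
proof -
  show i: "chart_inv c x \<in> fst c" if "x \<in> chart_image c" for x
    using that by (simp add: chart_image_def chart_inv_def inv_into_into)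
  show s: "snd c (chart_inv c x) = x" if "x \<in> chart_image c" for x
    using that by (simp add: chart_image_def chart_inv_def f_inv_into_f)
  show sub: "fst c \<subseteq> topspace M"
    using assms openin_subset by (auto simp: is_chart_def)
  obtain k where k: "homeomorphic_maps (subtopology M (fst c)) (top_of_set (chart_image c)) (snd c) k"
    using assms by (auto simp: is_chart_def homeomorphic_map_maps)
  have "continuous_map (top_of_set (chart_image c)) (subtopology M (fst c)) k"
    using k by (simp add: homeomorphic_maps_def)
  then have "continuous_map (top_of_set (chart_image c)) M k"
    by (simp add: continuous_map_in_subtopology)
  moreover have "k x = chart_inv c x" if "x \<in> topspace (top_of_set (chart_image c))" for x
  proof -
    have x: "x \<in> chart_image c" using that by simp
    have "k (snd c (chart_inv c x)) = chart_inv c x"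
      using k i[OF x] sub by (auto simp: homeomorphic_maps_def)
    then show ?thesis by (simp add: s[OF x])
  qed
  ultimately show "continuous_map (top_of_set (chart_image c)) M (chart_inv c)"
    by (rule continuous_map_eq)
qed

text \<open>The inverse of a chart is continuous as a map into the manifold, so that the collar in coordinates is a
  preimage of an open set.\<close>

lemma open_collar_image:
  fixes c :: "('a, 'n::finite) chart"
  assumes c: "is_chart M c" and D: "openin (prod_topology M euclideanreal) D"
  shows "open (collar_image c D)"
proof -
  let ?S = "{y :: real^('n option). base y \<in> chart_image c}"
  have "open (chart_image c)" using c by (simp add: is_chart_def)
  then have S: "open ?S"
    using open_vimage[OF _ continuous_on_base] by (simp add: vimage_def)
  have "continuous_map (top_of_set ?S) (top_of_set (chart_image c)) base"
    using continuous_on_base by (auto simp: continuous_map_in_subtopology)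
  then have 1: "continuous_map (top_of_set ?S) M (\<lambda>y. chart_inv c (base y))"
    by (rule continuous_map_compose[OF _ chart_inv_props(4)[OF c], unfolded o_def])
  have 2: "continuous_map (top_of_set ?S) euclideanreal (\<lambda>y. y $ None)"
    by (auto intro!: continuous_intros)
  have "continuous_map (top_of_set ?S) (prod_topology M euclideanreal) (\<lambda>y. (chart_inv c (base y), y $ None))"
    using 1 2 by (simp add: continuous_map_pairedI)
  from openin_continuous_map_preimage[OF this D]
  have "openin (top_of_set ?S) {y \<in> ?S. (chart_inv c (base y), y $ None) \<in> D}" by simp
  then have "open {y \<in> ?S. (chart_inv c (base y), y $ None) \<in> D}"
    using S by (simp add: openin_open_eq)
  moreover have "collar_image c D = {y \<in> ?S. (chart_inv c (base y), y $ None) \<in> D}"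
    by (auto simp: collar_image_def)
  ultimately show ?thesis by simp
qed

lemma pos_def_imp:
  fixes S :: "real^'n^'n"
  assumes "pos_def S"
  shows "det S \<noteq> 0" "S $ i $ j = S $ j $ i"
proof -
  have "v = 0" if "S *v v = 0" for v
    using assms that by (force simp: pos_def_def)
  then have "\<exists>B. B ** S = mat 1" by (simp add: matrix_left_invertible_ker)
  then show "det S \<noteq> 0" by (metis det_I det_mul mult_eq_0_iff zero_neq_one mult.commute)
  show "S $ i $ j = S $ j $ i" using assms by (metis pos_def_def transpose_component)
qed

section \<open>The GJMS-operator of order six in dimension six\<close>

theorem theorem10p1:
  fixes M :: "'a topology"
    and A :: "('a, 'n::finite) chart set"
    and g :: "('a, 'n) chart \<Rightarrow> real^'n \<Rightarrow> real^'n^'n"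
    and gr grho :: "('a, 'n) chart \<Rightarrow> real^'n \<Rightarrow> real \<Rightarrow> real^'n^'n"
    and D D' :: "('a \<times> real) set"
    and u :: "'a \<Rightarrow> real"
    and ut :: "'a \<Rightarrow> real \<Rightarrow> real"
  assumes "CARD('n) = 6"
    and "smooth_manifold M A"
    and "riemannian_metric A g"
    and "poincare_einstein M A g D gr"
    and "ambient_family M A D gr D' grho"
    and "smooth_function A u"
    and "smooth_extension A D' u ut"
  shows "\<forall>c\<in>A. \<forall>x\<in>chart_image c.
    (let V = chart_image c;
         \<Delta> = laplacian V (g c);
         \<delta>T\<^sub>2d = delta_T_d V (g c) (T2 (g c));
         \<delta>T\<^sub>4d = delta_T_d V (g c) (T4 (g c));
         J = schouten_J (g c);
         w = (\<lambda>x. u (chart_inv c x))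
     in gjms 3 D' grho ut c x
        = (\<Delta> ^^ 3) w x + 4 * \<Delta> (\<delta>T\<^sub>2d w) x + 4 * \<delta>T\<^sub>2d (\<Delta> w) x
          + 2 * \<Delta> (\<lambda>y. J y * \<Delta> w y) x + 8 * \<delta>T\<^sub>4d w x)"
proof (intro ballI)
  fix c x assume c: "c \<in> A" and x: "x \<in> chart_image c"
  note n = assms(1)
  define V where "V = chart_image c"
  define W where "W = collar_image c D'"
  \<comment> \<open>Off the collar the family is continued by \<open>g\<close>, so that its restriction to \<open>\<rho> = 0\<close> is \<open>g\<close> everywhere and not only
    on the image of the chart.\<close>
  define G where "G y = (if y \<in> W then grho c (base y) (y $ None) else g c (base y))" for y
  define f where "f y = ut (chart_inv c (base y)) (y $ None)" for y
  have ch: "is_chart M c" using assms(2) c by (simp add: smooth_manifold_def)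
  note ci = chart_inv_props[OF ch]
  have coll: "collar M D" "collar M D'"
    using assms(4,5) by (auto simp: poincare_einstein_def ambient_family_def)
  have oD: "open (collar_image c D)" and oW: "open W"
    unfolding W_def using open_collar_image[OF ch] coll by (auto simp: collar_def)
  have oV: "open V" using ch by (simp add: V_def is_chart_def)
  have zero: "(chart_inv c z, 0) \<in> D" "(chart_inv c z, 0) \<in> D'" if "z \<in> V" for z
  proof -
    have "chart_inv c z \<in> topspace M" using ci(1,3) that by (auto simp: V_def)
    then show "(chart_inv c z, 0) \<in> D" "(chart_inv c z, 0) \<in> D'" using coll by (auto simp: collar_def)
  qed
  have VW: "adjoin 0 z \<in> W \<longleftrightarrow> z \<in> V" for z
    using zero[of z] by (auto simp: W_def collar_image_def V_def)
  have slice: "slice W 0 = V" by (auto simp: slice_def VW)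
  have G: "metric_on W G"
    unfolding metric_on_def
  proof (intro conjI allI ballI)
    have fam: "smooth_on W (\<lambda>y. grho c (base y) (y $ None) $ i $ j)" "y \<in> W \<Longrightarrow> pos_def (grho c (base y) (y $ None))" for i j y
      using assms(5) c by (auto simp: ambient_family_def metric_family_def W_def)
    show "open W" by (rule oW)
    show "smooth_on W (\<lambda>y. G y $ i $ j)" for i j
      by (rule smooth_on_cong[OF oW, THEN iffD2, OF _ fam(1)]) (simp add: G_def)
    fix y assume y: "y \<in> W"
    show "det (G y) \<noteq> 0" "G y $ i $ j = G y $ j $ i" for i j
      using pos_def_imp[OF fam(2)[OF y]] y by (simp_all add: G_def)
  qed
  have rho: "grho c z (- r\<^sup>2 / 2) = gr c z r" if "z \<in> V" "(chart_inv c z, r) \<in> D" "(chart_inv c z, - r\<^sup>2 / 2) \<in> D'" for z r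
    using assms(5) c that by (auto simp: ambient_family_def V_def)
  have G0: "(\<lambda>z. G (adjoin 0 z)) = g c"
  proof
    fix z
    show "G (adjoin 0 z) = g c z"
    proof (cases "z \<in> V")
      case True
      have "grho c z 0 = gr c z 0" using rho[OF True, of 0] zero[OF True] by simp
      also have "\<dots> = g c z" using assms(4) c True by (simp add: poincare_einstein_def V_def)
      finally show ?thesis using VW[of z] True by (simp add: G_def)
    qed (simp add: G_def VW)
  qed
  have E: "einstein_tangential G a b (adjoin 0 z) = 0" "pd None (einstein_tangential G a b) (adjoin 0 z) = 0"
    "einstein_mixed G a (adjoin 0 z) = 0" "einstein_normal G (adjoin 0 z) = 0"
    if z: "adjoin 0 z \<in> W" for a b z
  proof -
    let ?N = "collar_image c D \<inter> to_rho -` W"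
    have zV: "z \<in> V" using z by (simp add: VW)
    have "open (to_rho -` W)" by (rule open_vimage[OF oW continuous_on_to_rho])
    then have N: "open ?N" using oD by (simp add: open_Int)
    have zN: "adjoin 0 z \<in> ?N"
      using zero[OF zV] zV z by (simp add: collar_image_def V_def to_rho_def)
    have NW: "to_rho y \<in> W \<and> gr c (base y) (y $ None) = G (to_rho y)" if "y \<in> ?N" for y
    proof -
      have "to_rho y \<in> W" "(chart_inv c (base y), y $ None) \<in> D" "base y \<in> V"
        using that by (auto simp: collar_image_def V_def)
      moreover have "base (to_rho y) = base y" "to_rho y $ None = - (y $ None)\<^sup>2 / 2"
        by (simp_all add: to_rho_def)
      moreover have "(chart_inv c (base y), - (y $ None)\<^sup>2 / 2) \<in> D'"
        using calculation by (simp add: W_def collar_image_def)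
      ultimately show ?thesis using rho[of "base y" "y $ None"] by (simp add: G_def)
    qed
    have "asymptotically_einstein (g c) (gr c) z"
      using assms(4) c zV by (simp add: poincare_einstein_def V_def)
    then have "(\<lambda>r. einstein_defect (gr c) z r $ a $ b) \<in> O[at_right 0](\<lambda>r. r ^ 4)" for a b
      using n by (simp add: asymptotically_einstein_def)
    from einstein_equations[OF G z N zN NW this]
    show "einstein_tangential G a b (adjoin 0 z) = 0" "pd None (einstein_tangential G a b) (adjoin 0 z) = 0"
      "einstein_mixed G a (adjoin 0 z) = 0" "einstein_normal G (adjoin 0 z) = 0" by blast+
  qed
  have f: "smooth_on W f"
    using assms(7) c by (simp add: smooth_extension_def W_def f_def[abs_def])
  have xW: "adjoin 0 x \<in> W" using x by (simp add: VW V_def)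
  let ?f1 = "homogeneous_laplacian G 0 f"
  let ?f2 = "homogeneous_laplacian G (- 2) ?f1"
  let ?f3 = "homogeneous_laplacian G (- 4) ?f2"
  have s1: "smooth_on W ?f1" and s2: "smooth_on W ?f2"
    by (intro smooth_on_homogeneous_laplacian[OF G] f)+
  have gj: "gjms 3 D' grho ut c x = ?f3 (adjoin 0 x)"
  proof -
    let ?L = "laplacian (ambient_cone W) (ambient G)"
    let ?F = "\<lambda>a f y. (y $ None) powr a * f (base y)"
    have oC: "open (ambient_cone W)" by (rule open_ambient_cone[OF oW])
    have dom: "ambient_domain c D' = ambient_cone W" by (simp add: ambient_domain_def ambient_cone_def W_def)
    have met: "ambient_metric (grho c) y = ambient G y" if "y \<in> ambient_cone W" for y
    proof -
      have "adjoin (y $ Some None) (base (base y)) = base y" using adjoin_base[of "base y"] by simp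
      then have "grho c (base (base y)) (y $ Some None) = G (adjoin (y $ Some None) (base (base y)))"
        using that by (simp add: G_def ambient_cone_def)
      then show ?thesis
        by (simp add: ambient_def ambient_metric_def Let_def vec_eq_iff split: option.split)
    qed
    have L: "laplacian (ambient_cone W) (ambient_metric (grho c)) = ?L"
      by (rule ext, rule laplacian_cong[OF oC met]) auto
    have it: "?L F = ?L (?F a k)" if "\<And>y. y \<in> ambient_cone W \<Longrightarrow> F y = ?F a k y" for F a k
      by (rule laplacian_cong[OF oC refl that])
    have l1: "?L (?F 0 f) y = ?F (- 2) ?f1 y" if "y \<in> ambient_cone W" for y
      using laplacian_ambient[OF G f that, of 0] by simp
    have e1: "?L (?L (?F 0 f)) = ?L (?F (- 2) ?f1)" by (rule it) (rule l1)
    have l2: "?L (?L (?F 0 f)) y = ?F (- 4) ?f2 y" if "y \<in> ambient_cone W" for y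
      using laplacian_ambient[OF G s1 that, of "- 2"] unfolding e1 by simp
    have e2: "?L (?L (?L (?F 0 f))) = ?L (?F (- 4) ?f2)" by (rule it) (rule l2)
    have l3: "?L (?L (?L (?F 0 f))) y = ?F (- 6) ?f3 y" if "y \<in> ambient_cone W" for y
      using laplacian_ambient[OF G s2 that, of "- 4"] unfolding e2 by simp
    \<comment> \<open>The initial weight \<open>3 - n/2\<close> is zero in dimension 6.\<close>
    have F0: "(\<lambda>y. (y $ None) powr (real 3 - real CARD('n) / 2) * ut (chart_inv c (base (base y))) (y $ Some None)) = ?F 0 f"
      by (simp add: n f_def fun_eq_iff)
    have "gjms 3 D' grho ut c x = ?L (?L (?L (?F 0 f))) (adjoin 1 (adjoin 0 x))"
      unfolding gjms_def dom L F0 by (simp add: eval_nat_numeral)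
    also have "\<dots> = ?f3 (adjoin 0 x)"
      using l3[of "adjoin 1 (adjoin 0 x)"] xW by (simp add: ambient_cone_def)
    finally show ?thesis .
  qed
  let ?w = "\<lambda>x. u (chart_inv c x)"
  have w: "f (adjoin 0 z) = ?w z" if "z \<in> V" for z
    using assms(7) c ci(1) that by (simp add: smooth_extension_def f_def V_def)
  have lw: "laplacian V (g c) (\<lambda>x. f (adjoin 0 x)) = laplacian V (g c) ?w"
    by (rule laplacian_cong[OF oV refl w])
  have dw: "delta_T_d V (g c) T (\<lambda>x. f (adjoin 0 x)) = delta_T_d V (g c) T ?w" for T
    by (rule delta_T_d_cong[OF oV w])
  show "let V = chart_image c;
         \<Delta> = laplacian V (g c);
         \<delta>T\<^sub>2d = delta_T_d V (g c) (T2 (g c));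
         \<delta>T\<^sub>4d = delta_T_d V (g c) (T4 (g c));
         J = schouten_J (g c);
         w = (\<lambda>x. u (chart_inv c x))
     in gjms 3 D' grho ut c x
        = (\<Delta> ^^ 3) w x + 4 * \<Delta> (\<delta>T\<^sub>2d w) x + 4 * \<delta>T\<^sub>2d (\<Delta> w) x
          + 2 * \<Delta> (\<lambda>y. J y * \<Delta> w y) x + 8 * \<delta>T\<^sub>4d w x"
    using homogeneous_laplacian_triple_eq[OF G n E f xW]
    unfolding gj slice G0 lw dw by (simp add: Let_def eval_nat_numeral flip: V_def)
qed

end
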